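(* Let $n\geq 2$. For every $i=1,\ldots,n$, let $T_i$ be a bi-regular tree and denote by $\mathrm{Aut}^+(T_i)$ the group of bi-coloring preserving automorphisms of $T_i$. Let $\Gamma < \mathrm{Aut}^+(T_1) \times \cdots \times \mathrm{Aut}^+(T_n)$ be a cocompact lattice. Denote by $G_i$ the closure of the image of $\Gamma$ in $\mathrm{Aut}^+(T_i)$ and assume that $G_i$ is $2$-transitive on the boundary $\partial T_i$ for every $i$. Further assume that $\Gamma < G_1 \times \cdots \times G_n$ is with dense projections, i.e. for every $i_0$ the image of $\Gamma$ in $\prod_{i\neq i_0}G_i$ is dense. Then for each finite dimension $d$, $\Gamma$ has only finitely many isomorphism types of unitary representations of dimension $d$.
   Context: A *bi-regular tree* is a $(p+1,q+1)$-biregular simplicial tree with natural numbers $p,q>1$: the vertices are $2$-colored so that adjacent vertices have different colors, vertices of one color have degree $p+1$ and vertices of the other color have degree $q+1$. Its automorphism group has the topology of pointwise convergence, and $\partial T$ denotes the visual boundary (space of ends). *)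

theory Defs
  imports
    "HOL-Algebra.Product_Groups"
    "HOL-Algebra.Bij"
    "HOL-Algebra.Left_Coset"
    "HOL-Analysis.Function_Topology"
    "Jordan_Normal_Form.Schur_Decomposition"
begin

section \<open>Bi-regular trees\<close>

text \<open>
  A simplicial graph is given by its vertex set and its symmetric irreflexive adjacency relation
  (each geometric edge occurs as two ordered pairs). The 2-colouring is part of the structure.
\<close>

record 'v coloured_graph =
  verts :: "'v set"
  adj :: "('v \<times> 'v) set"
  colour :: "'v \<Rightarrow> bool"

definition simplicial_graph :: "('v, 'x) coloured_graph_scheme \<Rightarrow> bool" where
  "simplicial_graph T \<longleftrightarrow> adj T \<subseteq> verts T \<times> verts T \<and> sym (adj T) \<and> irrefl (adj T)"

definition connected_graph :: "('v, 'x) coloured_graph_scheme \<Rightarrow> bool" where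
  "connected_graph T \<longleftrightarrow> verts T \<noteq> {} \<and> (\<forall>u\<in>verts T. \<forall>v\<in>verts T. (u, v) \<in> (adj T)\<^sup>*)"

definition simple_cycle :: "('v, 'x) coloured_graph_scheme \<Rightarrow> 'v list \<Rightarrow> bool" where
  "simple_cycle T xs \<longleftrightarrow> 3 \<le> length xs \<and> distinct xs \<and>
     (\<forall>k<length xs. (xs ! k, xs ! (Suc k mod length xs)) \<in> adj T)"

definition simplicial_tree :: "('v, 'x) coloured_graph_scheme \<Rightarrow> bool" where
  "simplicial_tree T \<longleftrightarrow> simplicial_graph T \<and> connected_graph T \<and> (\<nexists>xs. simple_cycle T xs)"

definition biregular_tree :: "('v, 'x) coloured_graph_scheme \<Rightarrow> bool" where
  "biregular_tree T \<longleftrightarrow> simplicial_tree T \<and>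
     (\<forall>(u, v)\<in>adj T. colour T u \<noteq> colour T v) \<and>
     (\<exists>p q. p > 1 \<and> q > 1 \<and>
       (\<forall>v\<in>verts T. card (adj T `` {v}) = (if colour T v then p + 1 else q + 1)))"


section \<open>Colour-preserving automorphisms and the topology of pointwise convergence\<close>

definition aut_plus :: "('v, 'x) coloured_graph_scheme \<Rightarrow> ('v \<Rightarrow> 'v) set" where
  "aut_plus T = {g \<in> Bij (verts T).
     (\<forall>u\<in>verts T. \<forall>v\<in>verts T. (g u, g v) \<in> adj T \<longleftrightarrow> (u, v) \<in> adj T) \<and>
     (\<forall>v\<in>verts T. colour T (g v) = colour T v)}"

definition AutPlus :: "('v, 'x) coloured_graph_scheme \<Rightarrow> ('v \<Rightarrow> 'v) monoid" where
  "AutPlus T = BijGroup (verts T) \<lparr>carrier := aut_plus T\<rparr>"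

definition aut_topology :: "('v, 'x) coloured_graph_scheme \<Rightarrow> ('v \<Rightarrow> 'v) topology" where
  "aut_topology T =
     subtopology (product_topology (\<lambda>_. discrete_topology (verts T)) (verts T)) (aut_plus T)"

lemma aut_plus_subset_PiE: "aut_plus T \<subseteq> (\<Pi>\<^sub>E v\<in>verts T. verts T)"
  by (auto simp: aut_plus_def Bij_def PiE_def bij_betw_def)

lemma topspace_aut_topology [simp]: "topspace (aut_topology T) = aut_plus T"
  using aut_plus_subset_PiE[of T] by (auto simp: aut_topology_def)

lemma subgroup_aut_plus: "subgroup (aut_plus T) (BijGroup (verts T))"
proof -
  interpret group "BijGroup (verts T)" by (rule group_BijGroup)
  show ?thesis
  proof (rule subgroupI)
    show "aut_plus T \<subseteq> carrier (BijGroup (verts T))"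
      by (auto simp: aut_plus_def BijGroup_def)
    have "(\<lambda>x\<in>verts T. x) \<in> aut_plus T"
      by (auto simp: aut_plus_def id_Bij)
    then show "aut_plus T \<noteq> {}" by blast
  next
    fix g assume g: "g \<in> aut_plus T"
    then have gB: "g \<in> Bij (verts T)" by (simp add: aut_plus_def)
    then have bij: "bij_betw g (verts T) (verts T)" by (simp add: Bij_def)
    let ?h = "restrict (inv_into (verts T) g) (verts T)"
    have h1: "?h v \<in> verts T" and h2: "g (?h v) = v" if "v \<in> verts T" for v
      using that bij by (auto simp: bij_betw_def inv_into_into f_inv_into_f)
    have "?h \<in> aut_plus T"
      unfolding aut_plus_def
    proof (intro CollectI conjI ballI)
      show "?h \<in> Bij (verts T)" by (rule restrict_inv_into_Bij[OF gB])
    next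
      fix u v assume u: "u \<in> verts T" and v: "v \<in> verts T"
      have "(g (?h u), g (?h v)) \<in> adj T \<longleftrightarrow> (?h u, ?h v) \<in> adj T"
        using g h1[OF u] h1[OF v] by (auto simp: aut_plus_def)
      then show "(?h u, ?h v) \<in> adj T \<longleftrightarrow> (u, v) \<in> adj T"
        using h2[OF u] h2[OF v] by simp
    next
      fix v assume v: "v \<in> verts T"
      have "colour T (g (?h v)) = colour T (?h v)"
        using g h1[OF v] by (auto simp: aut_plus_def)
      then show "colour T (?h v) = colour T v"
        using h2[OF v] by simp
    qed
    then show "inv\<^bsub>BijGroup (verts T)\<^esub> g \<in> aut_plus T"
      using gB by (simp add: inv_BijGroup)
  next
    fix g h assume g: "g \<in> aut_plus T" and h: "h \<in> aut_plus T"
    then have gB: "g \<in> Bij (verts T)" and hB: "h \<in> Bij (verts T)"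
      by (auto simp: aut_plus_def)
    have hv: "h v \<in> verts T" if "v \<in> verts T" for v
      using hB that by (auto simp: Bij_def bij_betw_def)
    have "compose (verts T) g h \<in> aut_plus T"
      using g h hv compose_Bij[OF gB hB] by (auto simp: aut_plus_def compose_eq)
    then show "g \<otimes>\<^bsub>BijGroup (verts T)\<^esub> h \<in> aut_plus T"
      using gB hB by (simp add: BijGroup_def)
  qed
qed

lemma group_AutPlus: "group (AutPlus T)"
  unfolding AutPlus_def
  by (rule subgroup.subgroup_is_group[OF subgroup_aut_plus group_BijGroup])

lemma carrier_AutPlus [simp]: "carrier (AutPlus T) = aut_plus T"
  by (simp add: AutPlus_def)


section \<open>The visual boundary\<close>

definition graph_dist :: "('v, 'x) coloured_graph_scheme \<Rightarrow> 'v \<Rightarrow> 'v \<Rightarrow> nat" where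
  "graph_dist T u v = (LEAST k. (u, v) \<in> adj T ^^ k)"

definition geodesic_rays :: "('v, 'x) coloured_graph_scheme \<Rightarrow> (nat \<Rightarrow> 'v) set" where
  "geodesic_rays T =
     {r. range r \<subseteq> verts T \<and> (\<forall>j k. j \<le> k \<longrightarrow> graph_dist T (r j) (r k) = k - j)}"

definition asymptotic :: "('v, 'x) coloured_graph_scheme \<Rightarrow> ((nat \<Rightarrow> 'v) \<times> (nat \<Rightarrow> 'v)) set" where
  "asymptotic T = {(r, s). r \<in> geodesic_rays T \<and> s \<in> geodesic_rays T \<and>
     (\<exists>C. \<forall>k. graph_dist T (r k) (s k) \<le> C)}"

definition boundary :: "('v, 'x) coloured_graph_scheme \<Rightarrow> (nat \<Rightarrow> 'v) set set" where
  "boundary T = geodesic_rays T // asymptotic T"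

definition boundary_action :: "('v \<Rightarrow> 'v) \<Rightarrow> (nat \<Rightarrow> 'v) set \<Rightarrow> (nat \<Rightarrow> 'v) set" where
  "boundary_action g \<xi> = (\<lambda>r. g \<circ> r) ` \<xi>"

definition two_transitive_on_boundary ::
    "('v, 'x) coloured_graph_scheme \<Rightarrow> ('v \<Rightarrow> 'v) set \<Rightarrow> bool" where
  "two_transitive_on_boundary T H \<longleftrightarrow>
     (\<forall>\<xi>\<in>boundary T. \<forall>\<xi>'\<in>boundary T. \<forall>\<eta>\<in>boundary T. \<forall>\<eta>'\<in>boundary T.
        \<xi> \<noteq> \<xi>' \<longrightarrow> \<eta> \<noteq> \<eta>' \<longrightarrow>
        (\<exists>g\<in>H. boundary_action g \<xi> = \<eta> \<and> boundary_action g \<xi>' = \<eta>'))"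


section \<open>Cocompact lattices\<close>

text \<open>In the following, \<open>X\<close> is the topology of the topological group \<open>G\<close>.\<close>

definition coset_space :: "('g, 'm) monoid_scheme \<Rightarrow> 'g topology \<Rightarrow> 'g set \<Rightarrow> 'g set topology" where
  "coset_space G X H = topology (\<lambda>U. U \<subseteq> (lcosets\<^bsub>G\<^esub> H) \<and>
     openin X {x \<in> topspace X. x <#\<^bsub>G\<^esub> H \<in> U})"

lemma openin_coset_space:
  "openin (coset_space G X H) U \<longleftrightarrow>
     U \<subseteq> (lcosets\<^bsub>G\<^esub> H) \<and> openin X {x \<in> topspace X. x <#\<^bsub>G\<^esub> H \<in> U}"
proof -
  have "istopology (\<lambda>U. U \<subseteq> (lcosets\<^bsub>G\<^esub> H) \<and> openin X {x \<in> topspace X. x <#\<^bsub>G\<^esub> H \<in> U})"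
    unfolding istopology_def
  proof (rule conjI; intro allI impI; (elim conjE)?)
    fix S U
    assume "S \<subseteq> (lcosets\<^bsub>G\<^esub> H)" "openin X {x \<in> topspace X. x <#\<^bsub>G\<^esub> H \<in> S}"
      "openin X {x \<in> topspace X. x <#\<^bsub>G\<^esub> H \<in> U}"
    moreover have "{x \<in> topspace X. x <#\<^bsub>G\<^esub> H \<in> S \<inter> U} =
        {x \<in> topspace X. x <#\<^bsub>G\<^esub> H \<in> S} \<inter> {x \<in> topspace X. x <#\<^bsub>G\<^esub> H \<in> U}"
      by blast
    ultimately show "S \<inter> U \<subseteq> (lcosets\<^bsub>G\<^esub> H) \<and> openin X {x \<in> topspace X. x <#\<^bsub>G\<^esub> H \<in> S \<inter> U}"
      by auto
  next
    fix K
    assume K: "\<forall>S\<in>K. S \<subseteq> (lcosets\<^bsub>G\<^esub> H) \<and> openin X {x \<in> topspace X. x <#\<^bsub>G\<^esub> H \<in> S}"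
    have "{x \<in> topspace X. x <#\<^bsub>G\<^esub> H \<in> \<Union>K} = (\<Union>S\<in>K. {x \<in> topspace X. x <#\<^bsub>G\<^esub> H \<in> S})"
      by blast
    with K show "\<Union>K \<subseteq> (lcosets\<^bsub>G\<^esub> H) \<and> openin X {x \<in> topspace X. x <#\<^bsub>G\<^esub> H \<in> \<Union>K}"
      by (auto intro!: openin_Union)
  qed
  then show ?thesis
    unfolding coset_space_def by (simp add: topology_inverse')
qed

lemma quotient_map_coset_space:
  assumes "topspace X = carrier G"
  shows "quotient_map X (coset_space G X H) (\<lambda>x. x <#\<^bsub>G\<^esub> H)"
proof -
  have img: "(\<lambda>x. x <#\<^bsub>G\<^esub> H) ` topspace X = (lcosets\<^bsub>G\<^esub> H)"
    using assms by (auto simp: LCOSETS_def)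
  have "{x \<in> topspace X. x <#\<^bsub>G\<^esub> H \<in> (lcosets\<^bsub>G\<^esub> H)} = topspace X"
    using img by blast
  then have "topspace (coset_space G X H) = (lcosets\<^bsub>G\<^esub> H)"
    unfolding topspace_def[of "coset_space G X H"] openin_coset_space by auto
  then show ?thesis
    using img by (auto simp: quotient_map_def openin_coset_space)
qed

text \<open>
  A discrete subgroup with compact quotient automatically has finite covolume, so no invariant
  measure needs to be mentioned.
\<close>

definition cocompact_lattice :: "('g, 'm) monoid_scheme \<Rightarrow> 'g topology \<Rightarrow> 'g set \<Rightarrow> bool" where
  "cocompact_lattice G X \<Gamma> \<longleftrightarrow> subgroup \<Gamma> G \<and>
     subtopology X \<Gamma> = discrete_topology \<Gamma> \<and> compact_space (coset_space G X \<Gamma>)"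


section \<open>Products of trees\<close>

abbreviation prod_AutPlus ::
    "nat set \<Rightarrow> (nat \<Rightarrow> ('v, 'x) coloured_graph_scheme) \<Rightarrow> (nat \<Rightarrow> 'v \<Rightarrow> 'v) monoid" where
  "prod_AutPlus I T \<equiv> product_group I (\<lambda>i. AutPlus (T i))"

abbreviation prod_aut_topology ::
    "nat set \<Rightarrow> (nat \<Rightarrow> ('v, 'x) coloured_graph_scheme) \<Rightarrow> (nat \<Rightarrow> 'v \<Rightarrow> 'v) topology" where
  "prod_aut_topology I T \<equiv> product_topology (\<lambda>i. aut_topology (T i)) I"

definition proj_closure ::
    "(nat \<Rightarrow> ('v, 'x) coloured_graph_scheme) \<Rightarrow> (nat \<Rightarrow> 'v \<Rightarrow> 'v) set \<Rightarrow> nat \<Rightarrow> ('v \<Rightarrow> 'v) set" where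
  "proj_closure T \<Gamma> i = aut_topology (T i) closure_of ((\<lambda>\<gamma>. \<gamma> i) ` \<Gamma>)"

definition dense_projections ::
    "nat set \<Rightarrow> (nat \<Rightarrow> ('v, 'x) coloured_graph_scheme) \<Rightarrow> (nat \<Rightarrow> ('v \<Rightarrow> 'v) set) \<Rightarrow>
     (nat \<Rightarrow> 'v \<Rightarrow> 'v) set \<Rightarrow> bool" where
  "dense_projections I T G \<Gamma> \<longleftrightarrow>
     (\<forall>i0\<in>I. product_topology (\<lambda>i. subtopology (aut_topology (T i)) (G i)) (I - {i0})
         closure_of ((\<lambda>\<gamma>. restrict \<gamma> (I - {i0})) ` \<Gamma>) = (\<Pi>\<^sub>E i\<in>I - {i0}. G i))"


section \<open>Finite-dimensional unitary representations\<close>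

definition unitary_group :: "nat \<Rightarrow> complex mat monoid" where
  "unitary_group d =
     \<lparr>carrier = {A \<in> carrier_mat d d. mat_adjoint A * A = 1\<^sub>m d \<and> A * mat_adjoint A = 1\<^sub>m d},
      monoid.mult = (*), one = 1\<^sub>m d\<rparr>"

definition unitary_reps :: "('g, 'm) monoid_scheme \<Rightarrow> nat \<Rightarrow> ('g \<Rightarrow> complex mat) set" where
  "unitary_reps G d = hom G (unitary_group d)"

text \<open>
  The values of a homomorphism outside the carrier are irrelevant for unitary equivalence, so the
  equivalence classes are exactly the isomorphism types.
\<close>

definition unitarily_equivalent ::
    "('g, 'm) monoid_scheme \<Rightarrow> nat \<Rightarrow> (('g \<Rightarrow> complex mat) \<times> ('g \<Rightarrow> complex mat)) set" where
  "unitarily_equivalent G d = {(\<rho>, \<sigma>). \<rho> \<in> unitary_reps G d \<and> \<sigma> \<in> unitary_reps G d \<and>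
     (\<exists>U\<in>carrier (unitary_group d). \<forall>g\<in>carrier G. U * \<rho> g = \<sigma> g * U)}"

definition unitary_rep_types :: "('g, 'm) monoid_scheme \<Rightarrow> nat \<Rightarrow> ('g \<Rightarrow> complex mat) set set" where
  "unitary_rep_types G d = unitary_reps G d // unitarily_equivalent G d"

end

theory Submission
  imports
    Defs
    "HOL-Library.Poly_Mapping"
    "HOL-Complex_Analysis.Great_Picard"
begin

text \<open>
  The lattice \<open>\<Gamma>\<close> acts properly and cocompactly on the product \<open>X\<close> of the vertex sets of the trees.
  If there were no uniform spectral gap for the representations of dimension at most \<open>d\<close>, rescaled
  minimisers of the energy would converge to a nonconstant harmonic map from \<open>X\<close> to a
  finite-dimensional Hilbert space whose Gram matrix is \<open>\<Gamma>\<close>-invariant. There is no such map: by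
  mass transport it is harmonic in each factor separately, with vanishing mixed differences; and on a
  single tree, since a group that is 2-transitive on the boundary has boundedly many orbits on the
  pairs of vertices at any given distance, far from a base vertex all outgoing neighbours are
  equivalent under a group that fixes the values near the base vertex, so that harmonicity makes the
  increments decay geometrically, while the Gram invariance leaves only finitely many possible norms
  of increments. By the gap, representations that are close on a finite set are intertwined by a
  matrix close to the identity, hence by a unitary one, and compactness of the unitary group leaves
  finitely many isomorphism types.
\<close>

section \<open>Biregular trees\<close>

text \<open>Rescaling destroys equivariance: after subtraction of the value at a base point, each
  rescaled minimiser is equivariant only for an affine action, and these actions vary along the
  sequence. Invariance of the inner products of differences is a closed condition that survives the
  limit, so all rigidity statements are phrased with it and no limit action is formed. The lattice
  projects only to a dense subgroup of each closure, which can imitate the closure on finite sets of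
  vertices. Finite dimension makes this enough: finitely many differences of values span all of
  them, so an element that fixes their end points changes no difference at all. The gap is not
  applied to two representations \<sigma>, \<tau> but to the action A -> \<sigma>(g) A \<tau>(g)^-1
  on matrices. Its invariants are the intertwiners from \<tau> to \<sigma>, the identity matrix is
  almost invariant when \<sigma> and \<tau> are close, and its dimension depends only on d, so that
  one gap serves all pairs.\<close>

locale biregular =
  fixes T :: "('v, 'x) coloured_graph_scheme"
  assumes biregular_tree: "biregular_tree T"
begin

abbreviation "V \<equiv> verts T"
abbreviation "E \<equiv> adj T"
abbreviation "d \<equiv> graph_dist T"

lemma adj_verts: "(x, y) \<in> E \<Longrightarrow> x \<in> V" "(x, y) \<in> E \<Longrightarrow> y \<in> V"
  using biregular_tree
  by (auto simp: biregular_tree_def simplicial_tree_def simplicial_graph_def)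

lemma adj_sym: "(x, y) \<in> E \<Longrightarrow> (y, x) \<in> E"
  using biregular_tree
  by (auto simp: biregular_tree_def simplicial_tree_def simplicial_graph_def dest: symD)

lemma no_cycle: "\<not> simple_cycle T xs"
  using biregular_tree by (auto simp: biregular_tree_def simplicial_tree_def)

lemma verts_nonempty: "V \<noteq> {}"
  using biregular_tree by (auto simp: biregular_tree_def simplicial_tree_def connected_graph_def)

lemma reachable: "u \<in> V \<Longrightarrow> v \<in> V \<Longrightarrow> (u, v) \<in> E\<^sup>*"
  using biregular_tree by (auto simp: biregular_tree_def simplicial_tree_def connected_graph_def)

lemma adj_colour: "(u, v) \<in> E \<Longrightarrow> colour T u \<noteq> colour T v"
  using biregular_tree by (auto simp: biregular_tree_def)

lemma degree_ge: "v \<in> V \<Longrightarrow> 3 \<le> card (E `` {v})"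
  using biregular_tree by (auto simp: biregular_tree_def split: if_splits)

text \<open>An infinite set would have \<open>card\<close> 0, against
  \<open>degree_ge\<close>.\<close>

lemma finite_nbrs: "v \<in> V \<Longrightarrow> finite (E `` {v})"
  using degree_ge[of v] by (metis card.infinite not_numeral_le_zero)

text \<open>One excluded vertex is what is needed to continue a path without backtracking, two to
  branch off from both of two rays at once.\<close>

lemma exists_nbr_avoiding:
  assumes "v \<in> V" shows "\<exists>c. (v, c) \<in> E \<and> c \<noteq> a \<and> c \<noteq> b"
proof -
  have "card {a, b} \<le> 2" by (simp add: card_insert_if)
  then have "\<not> E `` {v} \<subseteq> {a, b}"
    using degree_ge[OF assms] card_mono[of "{a, b}" "E `` {v}"] by auto
  then show ?thesis by blast
qed

lemma dist_relpow: assumes "u \<in> V" "v \<in> V" shows "(u, v) \<in> E ^^ d u v"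
proof -
  obtain k where "(u, v) \<in> E ^^ k" using reachable[OF assms] by (meson rtrancl_imp_relpow)
  then show ?thesis unfolding graph_dist_def by (rule LeastI)
qed

lemma dist_le: "(u, v) \<in> E ^^ k \<Longrightarrow> d u v \<le> k"
  unfolding graph_dist_def by (rule Least_le)

lemma dist_triangle:
  assumes "u \<in> V" "v \<in> V" "w \<in> V" shows "d u w \<le> d u v + d v w"
  by (rule dist_le) (use dist_relpow[OF assms(1,2)] dist_relpow[OF assms(2,3)] in \<open>auto simp: relpow_add\<close>)

lemma dist_self [simp]: "d u u = 0"
  using dist_le[of u u 0] by simp

lemma dist_0_iff: "u \<in> V \<Longrightarrow> v \<in> V \<Longrightarrow> d u v = 0 \<longleftrightarrow> u = v"
  using dist_relpow[of u v] by auto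

lemma relpow_sym: "(u, v) \<in> E ^^ k \<Longrightarrow> (v, u) \<in> E ^^ k"
proof (induction k arbitrary: u)
  case (Suc k)
  then obtain w where "(u, w) \<in> E" "(w, v) \<in> E ^^ k" by (meson relpow_Suc_D2)
  then show ?case using Suc.IH[of w] adj_sym by (auto intro: relpow_Suc_I)
qed simp

lemma dist_commute: "u \<in> V \<Longrightarrow> v \<in> V \<Longrightarrow> d u v = d v u"
  by (rule antisym; rule dist_le, rule relpow_sym, rule dist_relpow)

lemma adj_dist: "(u, v) \<in> E \<Longrightarrow> d u v \<le> 1"
  by (rule dist_le) simp

lemma relpow_colour: "(u, v) \<in> E ^^ k \<Longrightarrow> colour T u = colour T v \<longleftrightarrow> even k"
proof (induction k arbitrary: v)
  case (Suc k)
  then obtain w where "(u, w) \<in> E ^^ k" "(w, v) \<in> E" by auto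
  then show ?case using Suc.IH[of w] adj_colour[of w v] by auto
qed auto

lemma dist_colour: "u \<in> V \<Longrightarrow> v \<in> V \<Longrightarrow> colour T u = colour T v \<longleftrightarrow> even (d u v)"
  using relpow_colour dist_relpow by blast

text \<open>Equal distances are impossible because the colouring fixes the parity of the
  distance.\<close>

lemma dist_step:
  assumes "u \<in> V" "(x, y) \<in> E"
  shows "d u y = Suc (d u x) \<or> d u x = Suc (d u y)"
proof -
  have V: "x \<in> V" "y \<in> V" using assms adj_verts by auto
  have "d u y \<le> d u x + 1" "d u x \<le> d u y + 1"
    using dist_triangle[of u x y] dist_triangle[of u y x] adj_dist[OF assms(2)]
      adj_dist[OF adj_sym[OF assms(2)]] V assms(1) by auto
  moreover have "d u x \<noteq> d u y"
    using adj_colour[OF assms(2)] dist_colour[OF assms(1)] V by metis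
  ultimately show ?thesis by linarith
qed

lemma exists_pred:
  assumes "u \<in> V" "x \<in> V" "d u x = Suc n"
  shows "\<exists>y. (x, y) \<in> E \<and> d u y = n"
proof -
  have "(u, x) \<in> E ^^ Suc n" using dist_relpow[OF assms(1,2)] assms(3) by simp
  then obtain y where y: "(u, y) \<in> E ^^ n" "(y, x) \<in> E" by auto
  then have "d u y \<le> n" by (auto intro: dist_le)
  with dist_step[OF assms(1) y(2)] assms(3) y(2) show ?thesis using adj_sym by auto
qed

lemma descending_chain:
  assumes "u \<in> V" "x \<in> V"
  shows "\<exists>p. p 0 = x \<and> (\<forall>j\<le>d u x. p j \<in> V \<and> d u (p j) = d u x - j) \<and>
    (\<forall>j<d u x. (p j, p (Suc j)) \<in> E)"
  using assms(2)
proof (induction "d u x" arbitrary: x)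
  case 0
  then show ?case by (intro exI[of _ "\<lambda>_. x"]) auto
next
  case (Suc n)
  obtain y where y: "(x, y) \<in> E" "d u y = n"
    using exists_pred[OF assms(1) Suc.prems] Suc.hyps(2) by metis
  obtain p where p: "p 0 = y" "\<forall>j\<le>n. p j \<in> V \<and> d u (p j) = n - j" "\<forall>j<n. (p j, p (Suc j)) \<in> E"
    using Suc.hyps(1)[of y] y adj_verts by metis
  show ?case
    using p y Suc.prems Suc.hyps(2)[symmetric]
    by (intro exI[of _ "\<lambda>j. case j of 0 \<Rightarrow> x | Suc i \<Rightarrow> p i"]) (auto split: nat.splits)
qed

text \<open>This is where acyclicity enters: two predecessors would start two descending paths
  towards u, and these paths, cut off where they first meet again, bound a simple cycle.\<close>

lemma pred_unique:
  assumes "u \<in> V" "(x, y) \<in> E" "(x, y') \<in> E" "d u x = Suc (d u y)" "d u x = Suc (d u y')"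
  shows "y = y'"
proof (rule ccontr)
  assume ne: "y \<noteq> y'"
  define n where "n = d u y"
  have V: "x \<in> V" "y \<in> V" "y' \<in> V" using assms adj_verts by auto
  obtain p where p: "p 0 = y" "\<forall>j\<le>n. p j \<in> V \<and> d u (p j) = n - j" "\<forall>j<n. (p j, p (Suc j)) \<in> E"
    using descending_chain[OF assms(1) V(2)] n_def by metis
  have n': "d u y' = n" using assms n_def by auto
  obtain q where q: "q 0 = y'" "\<forall>j\<le>n. q j \<in> V \<and> d u (q j) = n - j" "\<forall>j<n. (q j, q (Suc j)) \<in> E"
    using descending_chain[OF assms(1) V(3)] n' by metis
  define a where "a = (\<lambda>j. case j of 0 \<Rightarrow> x | Suc i \<Rightarrow> p i)"
  define b where "b = (\<lambda>j. case j of 0 \<Rightarrow> x | Suc i \<Rightarrow> q i)"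
  have a0: "a 0 = x" "b 0 = x" by (auto simp: a_def b_def)
  have la: "d u (a j) = Suc n - j" "d u (b j) = Suc n - j" if "j \<le> Suc n" for j
    using that p(2) q(2) assms(4) n_def by (auto simp: a_def b_def split: nat.splits)
  have ea: "(a j, a (Suc j)) \<in> E" "(b j, b (Suc j)) \<in> E" if "j < Suc n" for j
    using that p q assms(2,3) by (auto simp: a_def b_def split: nat.splits)
  have "p n = u" "q n = u" using p(2) q(2) dist_0_iff[OF assms(1)] by force+
  then have "a (Suc n) = b (Suc n)" by (simp add: a_def b_def)
  then have ex: "\<exists>k. 0 < k \<and> k \<le> Suc n \<and> a k = b k" by blast
  define k where "k = (LEAST k. 0 < k \<and> k \<le> Suc n \<and> a k = b k)"
  have k: "0 < k" "k \<le> Suc n" "a k = b k"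
    using LeastI_ex[OF ex] by (auto simp: k_def)
  have min: "a j \<noteq> b j" if "0 < j" "j < k" for j
    using not_less_Least[of j "\<lambda>k. 0 < k \<and> k \<le> Suc n \<and> a k = b k"] that k(2) by (auto simp: k_def)
  have "k \<noteq> 1" using ne p(1) q(1) k(3) by (auto simp: a_def b_def)
  with k have k2: "2 \<le> k" by simp
  \<comment> \<open>Down along \<open>a\<close> from x to the meeting vertex
    \<open>a k = b k\<close>, then up again along \<open>b\<close>. The list stops at index
    \<open>2 * k - 1\<close>, so that x is not repeated.\<close>
  define c where "c = (\<lambda>j. if j \<le> k then a j else b (2 * k - j))"
  have "simple_cycle T (map c [0..<2 * k])"
    unfolding simple_cycle_def
  proof (intro conjI allI impI)
    show "3 \<le> length (map c [0..<2 * k])" using k2 by simp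
    have inj: "c i \<noteq> c j" if ij: "i < j" "j < 2 * k" for i j
    proof
      assume eq: "c i = c j"
      \<comment> \<open>The distance to u separates the vertices of one branch. A repetition would
        therefore be a common vertex of both branches at an index strictly between 0 and k, which
        \<open>min\<close> excludes.\<close>
      have lev: "d u (c m) = (if m \<le> k then Suc n - m else Suc n - (2 * k - m))" if "m < 2 * k" for m
        using that k(2) by (auto simp: c_def la)
      have "(if i \<le> k then i else 2 * k - i) = (if j \<le> k then j else 2 * k - j)"
        using lev[of i] lev[of j] eq ij k(2) by (auto split: if_splits)
      with ij have "i < k" "k < j" "2 * k - j = i" by (auto split: if_splits)
      then have "a i = b i" using eq by (auto simp: c_def)
      moreover have "0 < i" using \<open>2 * k - j = i\<close> ij by linarith
      ultimately show False using min \<open>i < k\<close> by blast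
    qed
    show "distinct (map c [0..<2 * k])"
      unfolding distinct_map inj_on_def
      by (metis atLeastLessThan_iff distinct_upt inj linorder_neqE_nat set_upt)
    fix j assume "j < length (map c [0..<2 * k])"
    then have j: "j < 2 * k" by simp
    have e: "(c j, c (Suc j mod (2 * k))) \<in> E"
    proof (cases "j < k")
      case True
      then show ?thesis using ea(1)[of j] k by (simp add: c_def)
    next
      case jk: False
      show ?thesis
      proof (cases "Suc j = 2 * k")
        case True
        then have "j = 2 * k - 1" by simp
        then have "c j = b 1" using k2 by (auto simp: c_def)
        moreover have "c (Suc j mod (2 * k)) = b 0" using True a0 by (simp add: c_def)
        ultimately show ?thesis using ea(2)[of 0] adj_sym by simp
      next
        case False
        then have "Suc j < 2 * k" using j by simp
        moreover have "c j = b (2 * k - j)" using jk k(3) by (cases "j = k") (auto simp: c_def)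
        ultimately show ?thesis
          using jk ea(2)[of "2 * k - Suc j"] adj_sym k2 k(2)
          by (auto simp: c_def Suc_diff_Suc)
      qed
    qed
    then show "(map c [0..<2 * k] ! j, map c [0..<2 * k] ! (Suc j mod length (map c [0..<2 * k]))) \<in> E"
      using j by simp
  qed
  then show False using no_cycle by blast
qed

text \<open>Non-backtracking paths are geodesic, so geodesic rays and lines can be encoded locally.\<close>

definition ray :: "(nat \<Rightarrow> 'v) \<Rightarrow> bool" where
  "ray r \<longleftrightarrow> (\<forall>k. (r k, r (Suc k)) \<in> E \<and> r (Suc (Suc k)) \<noteq> r k)"

definition line :: "(int \<Rightarrow> 'v) \<Rightarrow> bool" where
  "line l \<longleftrightarrow> (\<forall>k. (l k, l (k + 1)) \<in> E \<and> l (k + 2) \<noteq> l k)"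

lemma ray_verts: "ray r \<Longrightarrow> r k \<in> V"
  using adj_verts by (auto simp: ray_def)

lemma line_verts: "line l \<Longrightarrow> l k \<in> V"
  using adj_verts by (auto simp: line_def)

text \<open>By \<open>pred_unique\<close>, x is the only neighbour of y that is closer to u, so any
  other continuation leads further away.\<close>

lemma away_step:
  assumes "u \<in> V" "(x, y) \<in> E" "(y, z) \<in> E" "z \<noteq> x" "d u y = Suc (d u x)"
  shows "d u z = Suc (d u y)"
  using dist_step[OF assms(1,3)] pred_unique[OF assms(1,3) adj_sym[OF assms(2)]] assms(4,5) by auto

lemma ray_away:
  assumes "ray r" "u \<in> V" "d u (r (Suc k)) = Suc (d u (r k))"
  shows "d u (r (k + i)) = d u (r k) + i"
proof -
  have "d u (r (k + i)) = d u (r k) + i \<and> d u (r (Suc (k + i))) = Suc (d u (r (k + i)))"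
  proof (induction i)
    case 0
    then show ?case using assms by simp
  next
    case (Suc i)
    then show ?case using assms(1) away_step[OF assms(2), of "r (k + i)" "r (Suc (k + i))"]
      by (auto simp: ray_def)
  qed
  then show ?thesis by simp
qed

lemma ray_dist:
  assumes "ray r" shows "d (r k) (r (k + i)) = i"
proof -
  have "d (r k) (r (Suc k)) = Suc (d (r k) (r k))"
    using assms dist_step[of "r k" "r k" "r (Suc k)"] ray_verts[OF assms] by (auto simp: ray_def)
  then show ?thesis using ray_away[OF assms, of "r k" k i] ray_verts[OF assms] by simp
qed

lemma ray_geodesic: assumes "ray r" shows "r \<in> geodesic_rays T"
proof -
  have "d (r j) (r k) = k - j" if "j \<le> k" for j k
    using ray_dist[OF assms, of j "k - j"] that by simp
  then show ?thesis using ray_verts[OF assms] by (auto simp: geodesic_rays_def)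
qed

lemma line_ray: "line l \<Longrightarrow> ray (\<lambda>k. l (j + int k))"
  unfolding line_def ray_def
proof (intro allI conjI)
  fix k assume *: "\<forall>k. (l k, l (k + 1)) \<in> E \<and> l (k + 2) \<noteq> l k"
  show "(l (j + int k), l (j + int (Suc k))) \<in> E" using *[rule_format, of "j + int k"] by (simp add: algebra_simps)
  show "l (j + int (Suc (Suc k))) \<noteq> l (j + int k)" using *[rule_format, of "j + int k"] by (simp add: algebra_simps)
qed

lemma line_reverse: "line l \<Longrightarrow> line (\<lambda>k. l (- k))"
  unfolding line_def
proof (intro allI conjI)
  fix k assume *: "\<forall>k. (l k, l (k + 1)) \<in> E \<and> l (k + 2) \<noteq> l k"
  show "(l (- k), l (- (k + 1))) \<in> E"
    using adj_sym[OF *[rule_format, of "- (k + 1)", THEN conjunct1]] by simp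
  show "l (- (k + 2)) \<noteq> l (- k)" using *[rule_format, of "- (k + 2)"] by auto
qed

lemma line_shift: "line l \<Longrightarrow> line (\<lambda>k. l (k + s))"
  unfolding line_def
proof (intro allI conjI)
  fix k assume *: "\<forall>k. (l k, l (k + 1)) \<in> E \<and> l (k + 2) \<noteq> l k"
  show "(l (k + s), l (k + 1 + s)) \<in> E" "l (k + 2 + s) \<noteq> l (k + s)"
    using *[rule_format, of "k + s"] by (simp_all add: algebra_simps)
qed

lemma line_dist: assumes "line l" "i \<le> j" shows "d (l i) (l j) = nat (j - i)"
  using ray_dist[OF line_ray[OF assms(1), of i], of 0 "nat (j - i)"] assms(2) by simp

lemma ray_from_edge:
  assumes "(a, b) \<in> E" shows "\<exists>r. ray r \<and> r 0 = a \<and> r 1 = b"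
proof -
  \<comment> \<open>The state of the recursion is a directed edge, because the next choice must
    avoid the previous vertex.\<close>
  define nxt where "nxt = (\<lambda>(a, b). (b, SOME c. (b, c) \<in> E \<and> c \<noteq> a))"
  define e where "e = (\<lambda>k. (nxt ^^ k) (a, b))"
  have nxt: "fst (nxt p) = snd p \<and> nxt p \<in> E \<and> snd (nxt p) \<noteq> fst p" if "p \<in> E" for p
  proof -
    obtain x y where p: "p = (x, y)" by force
    have "\<exists>c. (y, c) \<in> E \<and> c \<noteq> x" using exists_nbr_avoiding[of y x x] that adj_verts p by auto
    from someI_ex[OF this] show ?thesis by (simp add: nxt_def p)
  qed
  have eE: "e k \<in> E" for k
    by (induction k) (use assms nxt in \<open>auto simp: e_def\<close>)
  have st: "fst (e (Suc k)) = snd (e k)" "snd (e (Suc k)) \<noteq> fst (e k)" for k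
    using nxt[OF eE[of k]] by (auto simp: e_def)
  have "ray (\<lambda>k. fst (e k))" unfolding ray_def
    using eE st by (metis prod.collapse)
  moreover have "fst (e 0) = a" "fst (e 1) = b" using st(1)[of 0] by (auto simp: e_def)
  ultimately show ?thesis by (intro exI[of _ "\<lambda>k. fst (e k)"]) auto
qed

text \<open>The only possible backtracking is at the common origin, and
  \<open>r 1 \<noteq> s 1\<close> excludes it.\<close>

lemma glue:
  assumes "ray r" "ray s" "r 0 = s 0" "r 1 \<noteq> s 1"
  shows "\<exists>l. line l \<and> (\<forall>k. l (int k) = r k) \<and> (\<forall>k. l (- int k) = s k)"
proof -
  define l where "l = (\<lambda>j. if j \<ge> 0 then r (nat j) else s (nat (- j)))"
  have lr: "l (int k) = r k" for k by (simp add: l_def)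
  have ls: "l (- int k) = s k" for k using assms(3) by (auto simp: l_def)
  have "line l" unfolding line_def
  proof (intro allI conjI)
    fix k :: int
    consider n where "k = int n" | n where "k = - int (Suc n)"
      by (cases k) auto
    then show "(l k, l (k + 1)) \<in> E"
    proof cases
      case 1
      then show ?thesis using lr[of n] lr[of "Suc n"] assms(1) by (auto simp: ray_def add.commute)
    next
      case 2
      then have "k + 1 = - int n" by simp
      then show ?thesis using 2 ls[of n] ls[of "Suc n"] assms(2) adj_sym by (metis ray_def)
    qed
    consider n where "k = int n" | "k = -1" | n where "k = - int (Suc (Suc n))"
    proof (cases k)
      case (neg n)
      then show ?thesis using that by (cases n) auto
    qed (use that in blast)
    then show "l (k + 2) \<noteq> l k"
    proof cases
      case 1
      then have "k + 2 = int (Suc (Suc n))" by simp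
      then show ?thesis using 1 lr[of n] lr[of "Suc (Suc n)"] assms(1) by (metis ray_def)
    next
      case 2
      then show ?thesis using ls[of 1] lr[of 1] assms(4) by simp
    next
      case 3
      then have "k + 2 = - int n" by simp
      then show ?thesis using 3 ls[of n] ls[of "Suc (Suc n)"] assms(2) by (metis ray_def)
    qed
  qed
  with lr ls show ?thesis by blast
qed

text \<open>The hypothesis says that s runs straight away from u, so the geodesic from u to
  \<open>s 0\<close> continues into s without backtracking. The induction moves u one step towards
  \<open>s 0\<close>.\<close>

lemma ray_extend_back:
  assumes "ray s" "u \<in> V" "\<And>i. d u (s i) = t + i"
  shows "\<exists>r. ray r \<and> r 0 = u \<and> (\<forall>i. r (t + i) = s i)"
  using assms(2,3)
proof (induction t arbitrary: u)
  case 0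
  then have "s 0 = u" using dist_0_iff ray_verts[OF assms(1)] by (metis add_0)
  then show ?case using assms(1) by auto
next
  case (Suc t)
  have sV: "s i \<in> V" for i using ray_verts[OF assms(1)] .
  have "d (s 0) u = Suc t" using Suc.prems(2)[of 0] dist_commute[OF Suc.prems(1) sV] by simp
  then obtain u' where u': "(u, u') \<in> E" "d (s 0) u' = t"
    using exists_pred[OF sV Suc.prems(1)] by metis
  then have u'V: "u' \<in> V" and ut: "d u' (s 0) = t" using adj_verts dist_commute[OF _ sV] by metis+
  have "d u' (s i) = t + i" for i
  proof (rule antisym)
    show "d u' (s i) \<le> t + i"
      using dist_triangle[OF u'V sV sV, of i 0] ut ray_dist[OF assms(1), of 0 i] by simp
    show "t + i \<le> d u' (s i)"
      using dist_triangle[OF Suc.prems(1) u'V sV, of i] Suc.prems(2)[of i] adj_dist[OF u'(1)] by simp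
  qed
  then obtain r where r: "ray r" "r 0 = u'" "\<forall>i. r (t + i) = s i" using Suc.IH[OF u'V] by blast
  have "r 1 \<noteq> u"
  proof
    assume "r 1 = u"
    then have "d u (s 1) = t" using ray_dist[OF r(1), of 1 t] r(3)[rule_format, of 1] by (simp add: add.commute)
    then show False using Suc.prems(2)[of 1] by simp
  qed
  define r' where "r' = (\<lambda>k. case k of 0 \<Rightarrow> u | Suc k \<Rightarrow> r k)"
  have "ray r'" using r(1,2) u'(1) \<open>r 1 \<noteq> u\<close> by (auto simp: ray_def r'_def split: nat.splits)
  moreover have "r' 0 = u" "\<forall>i. r' (Suc t + i) = s i" using r(3) by (auto simp: r'_def)
  ultimately show ?case by blast
qed

text \<open>A neighbour of w on the far side from u starts a ray that never turns back, and
  \<open>ray_extend_back\<close> joins it to u.\<close>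

lemma ray_through:
  assumes "u \<in> V" "w \<in> V" shows "\<exists>r. ray r \<and> r 0 = u \<and> r (d u w) = w"
proof -
  obtain c where c: "(w, c) \<in> E" "d u c = Suc (d u w)"
  proof (cases "d u w")
    case 0
    then obtain c where "(w, c) \<in> E" using exists_nbr_avoiding[OF assms(2)] by blast
    then show ?thesis using that dist_step[OF assms(1)] 0 by fastforce
  next
    case (Suc n)
    then obtain y where y: "(w, y) \<in> E" "d u y = n" using exists_pred[OF assms] by blast
    obtain c where "(w, c) \<in> E" "c \<noteq> y" using exists_nbr_avoiding[OF assms(2)] by blast
    then show ?thesis using that away_step[OF assms(1) adj_sym[OF y(1)]] y(2) Suc by auto
  qed
  obtain s where s: "ray s" "s 0 = w" "s 1 = c" using ray_from_edge[OF c(1)] by blast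
  have "d u (s i) = d u w + i" for i
    using ray_away[OF s(1) assms(1), of 0 i] s c by simp
  from ray_extend_back[OF s(1) assms(1) this] obtain r
    where "ray r" "r 0 = u" "\<forall>i. r (d u w + i) = s i" by blast
  moreover from this(3) have "r (d u w) = w" using s(2) by (metis add.right_neutral)
  ultimately show ?thesis by blast
qed

lemma line_extending:
  assumes "ray r" shows "\<exists>l. line l \<and> (\<forall>k. l (int k) = r k)"
proof -
  obtain c where "(r 0, c) \<in> E" "c \<noteq> r 1" using exists_nbr_avoiding[OF ray_verts[OF assms]] by blast
  then show ?thesis using ray_from_edge[of "r 0" c] glue[OF assms] by metis
qed

lemma rays_agree_below:
  assumes "ray r" "ray s" "r 0 = s 0" "r k = s k" "i \<le> k"
  shows "r i = s i"
  using assms(4,5)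
proof (induction k)
  case (Suc k)
  have u: "r 0 \<in> V" using ray_verts[OF assms(1)] .
  have "r k = s k"
  proof (rule pred_unique[OF u])
    show "(r (Suc k), r k) \<in> E" using assms(1) adj_sym by (auto simp: ray_def)
    show "(r (Suc k), s k) \<in> E" using assms(2) adj_sym Suc.prems(1) by (auto simp: ray_def)
    show "d (r 0) (r (Suc k)) = Suc (d (r 0) (r k))"
      using ray_dist[OF assms(1), of 0 "Suc k"] ray_dist[OF assms(1), of 0 k] by simp
    show "d (r 0) (r (Suc k)) = Suc (d (r 0) (s k))"
      using ray_dist[OF assms(1), of 0 "Suc k"] ray_dist[OF assms(2), of 0 k] assms(3) by simp
  qed
  then show ?case using Suc by (cases "i = Suc k") auto
qed simp

text \<open>After the last common vertex the two rays are the halves of a line, so their distance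
  grows by 2 with every step.\<close>

lemma rays_diverge:
  assumes "ray r" "ray s" "r 0 = s 0" "\<And>k. d (r k) (s k) \<le> C"
  shows "r k = s k"
proof (rule ccontr)
  assume ne: "r k \<noteq> s k"
  define m where "m = (LEAST k. r k \<noteq> s k)"
  have m: "r m \<noteq> s m" unfolding m_def by (rule LeastI[of _ k]) (rule ne)
  have below: "r j = s j" if "j < m" for j
    using not_less_Least that unfolding m_def by blast
  have "m \<noteq> 0" using m assms(3) by metis
  then obtain j where j: "m = Suc j" by (cases m) auto
  have "ray (\<lambda>k. r (j + k))" "ray (\<lambda>k. s (j + k))" using assms(1,2) by (auto simp: ray_def)
  then obtain l where l: "line l" "\<forall>k. l (int k) = r (j + k)" "\<forall>k. l (- int k) = s (j + k)"
    using glue[of "\<lambda>k. r (j + k)" "\<lambda>k. s (j + k)"] below[of j] m j by auto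
  have "d (l (- int (Suc C))) (l (int (Suc C))) = 2 * Suc C"
    using line_dist[OF l(1), of "- int (Suc C)" "int (Suc C)"] by simp
  then have "d (s (j + Suc C)) (r (j + Suc C)) = 2 * Suc C" using l by metis
  then show False using assms(4)[of "j + Suc C"] dist_commute ray_verts assms(1,2)
    by (metis Suc_n_not_le_n add_leD1 mult_2)
qed

text \<open>From some vertex on, s moves away from \<open>r 0\<close>. Joining \<open>r 0\<close> to
  that tail gives a ray q with the same origin as r and at bounded distance from it, hence equal to
  r.\<close>

lemma rays_merge:
  assumes "ray r" "ray s" "\<And>k. d (r k) (s k) \<le> C"
  shows "\<exists>a b. \<forall>k. r (a + k) = s (b + k)"
proof -
  define u where "u = r 0"
  have rV: "\<And>k. r k \<in> V" and sV: "\<And>k. s k \<in> V" using ray_verts assms by auto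
  have u: "u \<in> V" by (simp add: u_def rV)
  have "\<exists>K. d u (s (Suc K)) = Suc (d u (s K))"
  proof (rule ccontr)
    assume "\<nexists>K. d u (s (Suc K)) = Suc (d u (s K))"
    then have "d u (s K) = Suc (d u (s (Suc K)))" for K
      using dist_step[OF u, of "s K" "s (Suc K)"] assms(2) by (auto simp: ray_def)
    then have dec: "d u (s K) = Suc (d u (s (Suc K)))" for K .
    have "d u (s K) + K = d u (s 0)" for K
    proof (induction K)
      case (Suc K)
      then show ?case using dec[of K] by linarith
    qed simp
    from this[of "Suc (d u (s 0))"] show False by simp
  qed
  then obtain K where K: "d u (s (Suc K)) = Suc (d u (s K))" by blast
  define t where "t = d u (s K)"
  have "ray (\<lambda>i. s (K + i))" using assms(2) by (auto simp: ray_def)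
  moreover have "d u (s (K + i)) = t + i" for i
    using ray_away[OF assms(2) u K] by (simp add: t_def)
  ultimately obtain q where q: "ray q" "q 0 = u" "\<And>i. q (t + i) = s (K + i)"
    using ray_extend_back[of "\<lambda>i. s (K + i)" u t] u by blast
  have qV: "q k \<in> V" for k using ray_verts[OF q(1)] .
  \<comment> \<open>From index t on, q is a shift of s by \<open>t - K\<close>; before t, both rays
    are within distance t of u. The constant is crude but uniform in k.\<close>
  have "d (r k) (q k) \<le> C + 2 * t + K" for k
  proof (cases "k < t")
    case True
    have "d (r k) (q k) \<le> d (r k) u + d u (q k)" by (rule dist_triangle[OF rV u qV])
    also have "d (r k) u = k" using ray_dist[OF assms(1), of 0 k] dist_commute[OF rV u] by (simp add: u_def)
    also have "d u (q k) = k" using ray_dist[OF q(1), of 0 k] q(2) by simp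
    finally show ?thesis using True by simp
  next
    case False
    then obtain i where i: "k = t + i" using le_Suc_ex by (metis not_less)
    have "d (s k) (s (K + i)) \<le> t + K"
    proof (cases "k \<le> K + i")
      case True
      then have "d (s k) (s (K + i)) = K + i - k" using ray_dist[OF assms(2), of k "K + i - k"] by simp
      then show ?thesis using i by simp
    next
      case False
      then have "d (s (K + i)) (s k) = k - (K + i)" using ray_dist[OF assms(2), of "K + i" "k - (K + i)"] by simp
      then have "d (s k) (s (K + i)) = k - (K + i)" using dist_commute[OF sV sV] by metis
      then show ?thesis using i by simp
    qed
    moreover have "d (r k) (q k) \<le> d (r k) (s k) + d (s k) (q k)" by (rule dist_triangle[OF rV sV qV])
    moreover have "q k = s (K + i)" using q(3) i by simp
    ultimately show ?thesis using assms(3)[of k] by simp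
  qed
  from rays_diverge[OF assms(1) q(1) _ this] have "r k = q k" for k
    using q(2) u_def by simp
  then have "r (t + k) = s (K + k)" for k using q(3) by simp
  then show ?thesis by blast
qed

text \<open>The positive ends agree index by index; at the negative end a shift
  \<open>b' - b\<close> is allowed at first. It vanishes because the distance between far vertices
  at the two ends can be read off on either line. A segment is then determined by its end
  vertices.\<close>

lemma lines_equal:
  assumes "line l" "line m" "\<And>k. l (a + int k) = m (a + int k)" "\<And>k. l (b - int k) = m (b' - int k)"
  shows "l j = m j"
proof -
  \<comment> \<open>Large enough for the vertex with index \<open>b - int N\<close> to lie before
    the indices a and j.\<close>
  define N where "N = nat \<bar>a - b\<bar> + nat \<bar>a - b'\<bar> + nat \<bar>b - j\<bar>"
  have le: "b - int N \<le> a" "b' - int N \<le> a" "b - int N \<le> j" by (auto simp: N_def)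
  have bb: "b = b'"
    using line_dist[OF assms(1) le(1)] line_dist[OF assms(2) le(2)] assms(3)[of 0] assms(4)[of N] le by simp
  define i where "i = nat (j - (b - int N))"
  define k where "k = nat (a - (b - int N))"
  define r where "r = (\<lambda>k. l (b - int N + int k))"
  define s where "s = (\<lambda>k. m (b - int N + int k))"
  have "ray r" "ray s" unfolding r_def s_def using line_ray assms by auto
  moreover have "r 0 = s 0" using assms(4)[of N] bb by (simp add: r_def s_def)
  moreover have "r (k + i) = s (k + i)"
  proof -
    have "b - int N + int (k + i) = a + int i" using le by (simp add: k_def)
    then show ?thesis unfolding r_def s_def using assms(3)[of i] by metis
  qed
  ultimately have "r i = s i" by (rule rays_agree_below) simp
  then show ?thesis using le by (simp add: r_def s_def i_def)
qed

end

section \<open>Automorphisms acting on distances, rays and lines\<close>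

context biregular
begin

lemma aut_bij: "g \<in> aut_plus T \<Longrightarrow> bij_betw g V V"
  by (simp add: aut_plus_def Bij_def)

lemma aut_verts [simp]: "g \<in> aut_plus T \<Longrightarrow> v \<in> V \<Longrightarrow> g v \<in> V"
  using aut_bij bij_betwE by blast

lemma aut_adj: "g \<in> aut_plus T \<Longrightarrow> u \<in> V \<Longrightarrow> v \<in> V \<Longrightarrow> (g u, g v) \<in> E \<longleftrightarrow> (u, v) \<in> E"
  by (simp add: aut_plus_def)

lemma aut_adj_iff:
  assumes "g \<in> aut_plus T" "u \<in> V"
  shows "E `` {g u} = g ` (E `` {u})"
proof -
  have "y \<in> g ` (E `` {u})" if y: "(g u, y) \<in> E" for y
  proof -
    obtain v where v: "v \<in> V" "y = g v"
      using adj_verts(2)[OF y] aut_bij[OF assms(1)] unfolding bij_betw_def by blast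
    then show ?thesis using y aut_adj[OF assms v(1)] by auto
  qed
  then show ?thesis using aut_adj[OF assms] adj_verts by auto
qed

lemma aut_inj: "g \<in> aut_plus T \<Longrightarrow> u \<in> V \<Longrightarrow> v \<in> V \<Longrightarrow> g u = g v \<longleftrightarrow> u = v"
  using aut_bij unfolding bij_betw_def inj_on_def by blast

lemma aut_relpow:
  assumes "g \<in> aut_plus T" "u \<in> V" "v \<in> V"
  shows "(g u, g v) \<in> E ^^ k \<longleftrightarrow> (u, v) \<in> E ^^ k"
  using assms(3)
proof (induction k arbitrary: v)
  case 0
  then show ?case using aut_inj assms by auto
next
  case (Suc k)
  have step: "(a, b) \<in> E ^^ Suc k \<longleftrightarrow> (\<exists>y\<in>V. (a, y) \<in> E ^^ k \<and> (y, b) \<in> E)" for a b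
    by (auto simp: relcomp_unfold dest: adj_verts(1))
  have "(\<exists>y\<in>V. (g u, y) \<in> E ^^ k \<and> (y, g v) \<in> E) \<longleftrightarrow> (\<exists>y\<in>g ` V. (g u, y) \<in> E ^^ k \<and> (y, g v) \<in> E)"
    using aut_bij[OF assms(1)] by (simp add: bij_betw_def)
  also have "\<dots> \<longleftrightarrow> (\<exists>y\<in>V. (u, y) \<in> E ^^ k \<and> (y, v) \<in> E)"
  proof -
    have "(g u, g y) \<in> E ^^ k \<and> (g y, g v) \<in> E \<longleftrightarrow> (u, y) \<in> E ^^ k \<and> (y, v) \<in> E" if "y \<in> V" for y
      using Suc.IH[OF that] aut_adj[OF assms(1) that Suc.prems] by simp
    then show ?thesis by simp
  qed
  finally show ?case by (simp only: step)
qed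

lemma aut_dist: "g \<in> aut_plus T \<Longrightarrow> u \<in> V \<Longrightarrow> v \<in> V \<Longrightarrow> d (g u) (g v) = d u v"
  by (simp add: graph_dist_def aut_relpow)

lemma aut_ray: "g \<in> aut_plus T \<Longrightarrow> ray r \<Longrightarrow> ray (\<lambda>k. g (r k))"
  using ray_verts[of r] by (auto simp: ray_def aut_adj aut_inj)

lemma aut_line: "g \<in> aut_plus T \<Longrightarrow> line l \<Longrightarrow> line (\<lambda>k. g (l k))"
  using line_verts[of l] by (auto simp: line_def aut_adj aut_inj)

lemma asymptotic_refl: "ray r \<Longrightarrow> (r, r) \<in> asymptotic T"
  using ray_geodesic by (auto simp: asymptotic_def)

lemma finite_ball: assumes "v \<in> V" shows "finite {x \<in> V. d v x \<le> n}"
proof (induction n)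
  case 0
  have "{x \<in> V. d v x \<le> 0} \<subseteq> {v}" using dist_0_iff[OF assms] by auto
  then show ?case using finite_subset by blast
next
  case (Suc n)
  have "{x \<in> V. d v x \<le> Suc n} \<subseteq> {x \<in> V. d v x \<le> n} \<union> (\<Union>x\<in>{x \<in> V. d v x \<le> n}. E `` {x})"
  proof
    fix x assume "x \<in> {x \<in> V. d v x \<le> Suc n}"
    then have x: "x \<in> V" "d v x \<le> Suc n" by auto
    show "x \<in> {x \<in> V. d v x \<le> n} \<union> (\<Union>x\<in>{x \<in> V. d v x \<le> n}. E `` {x})"
    proof (cases "d v x \<le> n")
      case False
      then obtain y where "(x, y) \<in> E" "d v y = n" using exists_pred[OF assms x(1), of n] x(2) by auto
      then show ?thesis using adj_sym adj_verts by blast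
    qed (use x in auto)
  qed
  moreover have "finite \<dots>" using Suc by (intro finite_UnI finite_UN_I) (auto intro: finite_nbrs)
  ultimately show ?case by (rule finite_subset)
qed

end

text \<open>Products and inverses are required only pointwise on V: the elements of
  \<open>aut_plus T\<close> are extensional functions, and a plain composition of such functions
  need not be extensional.\<close>

locale boundary_transitive = biregular T for T :: "('v, 'x) coloured_graph_scheme" +
  fixes G :: "('v \<Rightarrow> 'v) set"
  assumes aut: "g \<in> G \<Longrightarrow> g \<in> aut_plus T"
    and comp: "g \<in> G \<Longrightarrow> h \<in> G \<Longrightarrow> \<exists>k\<in>G. \<forall>v\<in>V. k v = g (h v)"
    and inv: "g \<in> G \<Longrightarrow> \<exists>k\<in>G. \<forall>v\<in>V. k (g v) = v \<and> g (k v) = v"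
    and two_transitive: "two_transitive_on_boundary T G"
begin

text \<open>A line determines an ordered pair of distinct ends, and the pair determines the line up
  to a shift. Two-transitivity moves the ends; \<open>rays_merge\<close> at each end and
  \<open>lines_equal\<close> then recover the line itself.\<close>

lemma transitive_on_lines:
  assumes "line l" "line l'"
  shows "\<exists>g\<in>G. \<exists>s. \<forall>j. g (l j) = l' (j + s)"
proof -
  define r where "r = (\<lambda>l (k::nat). l (int k) :: 'v)"
  define b where "b = (\<lambda>l (k::nat). l (- int k) :: 'v)"
  have rays: "ray (r m) \<and> ray (b m)" if "line m" for m
    using line_ray[OF that, of 0] line_ray[OF line_reverse[OF that], of 0] by (simp add: r_def b_def)
  define cl where "cl = (\<lambda>r. asymptotic T `` {r})"
  have bd: "cl s \<in> boundary T" if "ray s" for s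
    unfolding cl_def boundary_def by (rule quotientI) (rule ray_geodesic[OF that])
  have ne: "cl (r m) \<noteq> cl (b m)" if "line m" for m
  proof
    assume "cl (r m) = cl (b m)"
    then have "r m \<in> cl (b m)" using asymptotic_refl rays[OF that] by (auto simp: cl_def)
    then obtain C where C: "\<forall>k. d (b m k) (r m k) \<le> C" by (auto simp: cl_def asymptotic_def)
    have "d (b m (Suc C)) (r m (Suc C)) = 2 * Suc C"
      using line_dist[OF that, of "- int (Suc C)" "int (Suc C)"] by (simp add: r_def b_def)
    then show False using C[rule_format, of "Suc C"] by simp
  qed
  obtain g where g: "g \<in> G" "boundary_action g (cl (r l)) = cl (r l')" "boundary_action g (cl (b l)) = cl (b l')"
    using two_transitive[unfolded two_transitive_on_boundary_def, rule_format,
      of "cl (r l)" "cl (b l)" "cl (r l')" "cl (b l')"] bd ne rays assms by blast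
  have merge: "\<exists>i j. \<forall>k. s' (i + k) = g (s (j + k))"
    if s: "ray s" "ray s'" "boundary_action g (cl s) = cl s'" for s s'
  proof -
    have "g \<circ> s \<in> boundary_action g (cl s)"
      using asymptotic_refl[OF s(1)] by (auto simp: cl_def boundary_action_def)
    then obtain C where "\<forall>k. d (s' k) (g (s k)) \<le> C" using s(3) by (auto simp: cl_def asymptotic_def)
    then show ?thesis using rays_merge[OF s(2) aut_ray[OF aut[OF g(1)] s(1)]] by blast
  qed
  obtain i j where ij: "\<forall>k. r l' (i + k) = g (r l (j + k))"
    using merge[of "r l" "r l'"] rays assms g by blast
  obtain i' j' where ij': "\<forall>k. b l' (i' + k) = g (b l (j' + k))"
    using merge[of "b l" "b l'"] rays assms g by blast
  define s where "s = int i - int j"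
  have "g (l k) = l' (k + s)" for k
  proof (rule lines_equal[OF aut_line[OF aut[OF g(1)] assms(1)] line_shift[OF assms(2), of s]])
    fix k
    show "g (l (int j + int k)) = l' (int j + int k + s)"
      using ij[rule_format, of k] by (simp add: r_def s_def add.commute)
    have "g (l (- int j' - int k)) = l' (- int i' - int k)"
      using ij'[rule_format, of k] by (simp add: b_def)
    then show "g (l (- int j' - int k)) = l' (- int i' - s - int k + s)" by simp
  qed
  then show ?thesis using g(1) by blast
qed

text \<open>Pulling far vertices of the ray back by the inverse of g continues the ray to negative
  indices.\<close>

lemma axis:
  assumes "g \<in> G" "ray t" "0 < \<kappa>" "\<And>k. g (t k) = t (k + \<kappa>)"
  shows "\<exists>l. line l \<and> (\<forall>j. g (l j) = l (j + int \<kappa>))"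
proof -
  obtain h where h: "h \<in> G" "\<And>v. v \<in> V \<Longrightarrow> h (g v) = v" "\<And>v. v \<in> V \<Longrightarrow> g (h v) = v"
    using inv[OF assms(1)] by blast
  have tV: "t k \<in> V" for k using ray_verts[OF assms(2)] .
  have hV: "(h ^^ n) v \<in> V" if "v \<in> V" for n v
    by (induction n) (use that aut[OF h(1)] in auto)
  have hinj: "(h ^^ n) u = (h ^^ n) v \<longleftrightarrow> u = v" if "u \<in> V" "v \<in> V" for n u v
    by (induction n) (use that aut[OF h(1)] hV aut_inj in auto)
  have hadj: "((h ^^ n) u, (h ^^ n) v) \<in> E \<longleftrightarrow> (u, v) \<in> E" if "u \<in> V" "v \<in> V" for n u v
    by (induction n) (use that aut[OF h(1)] hV aut_adj in auto)
  have ht: "(h ^^ i) (t (k + i * \<kappa>)) = t k" for i k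
  proof (induction i arbitrary: k)
    case (Suc i)
    have "(h ^^ Suc i) (t (k + Suc i * \<kappa>)) = h ((h ^^ i) (t ((k + \<kappa>) + i * \<kappa>)))"
      by (simp add: algebra_simps)
    also have "\<dots> = h (t (k + \<kappa>))" using Suc by simp
    also have "\<dots> = t k" using h(2)[OF tV] assms(4) by metis
    finally show ?case .
  qed simp
  \<comment> \<open>A candidate for the vertex with index j: go n periods forward along the ray,
    then apply the inverse n times. The value no longer depends on n once the index is nonnegative,
    which \<open>pos\<close> ensures for n at least the absolute value of j.\<close>
  define P where "P = (\<lambda>n j. (h ^^ n) (t (nat (j + int n * int \<kappa>))))"
  have P: "P (n + i) j = P n j" if "0 \<le> j + int n * int \<kappa>" for n i j
  proof -
    have "nat (j + int (n + i) * int \<kappa>) = nat (j + int n * int \<kappa>) + i * \<kappa>"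
    proof -
      have "j + int (n + i) * int \<kappa> = (j + int n * int \<kappa>) + int (i * \<kappa>)" by (simp add: algebra_simps)
      then show ?thesis using that by (simp only: nat_add_distrib of_nat_0_le_iff nat_int)
    qed
    then show ?thesis using ht[of i "nat (j + int n * int \<kappa>)"] by (simp add: P_def funpow_add)
  qed
  define l where "l = (\<lambda>j. P (nat \<bar>j\<bar>) j)"
  have pos: "0 \<le> j + int n * int \<kappa>" if "nat \<bar>j\<bar> \<le> n" for j n
  proof -
    have "int n * 1 \<le> int n * int \<kappa>" using assms(3) by (intro mult_left_mono) auto
    then show ?thesis using that by linarith
  qed
  have l: "l j = P n j" if "nat \<bar>j\<bar> \<le> n" for j n
    using P[OF pos[OF order_refl], of j "n - nat \<bar>j\<bar>"] that by (simp add: l_def)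
  have "line l" unfolding line_def
  proof
    fix j :: int
    define n where "n = nat \<bar>j\<bar> + nat \<bar>j + 1\<bar> + nat \<bar>j + 2\<bar>"
    define k where "k = nat (j + int n * int \<kappa>)"
    have p: "0 \<le> j + int n * int \<kappa>" by (rule pos) (simp add: n_def)
    have "l j = P n j" "l (j + 1) = P n (j + 1)" "l (j + 2) = P n (j + 2)" by (auto intro!: l simp: n_def)
    moreover have "nat (j + 1 + int n * int \<kappa>) = Suc k" "nat (j + 2 + int n * int \<kappa>) = Suc (Suc k)"
      using p by (auto simp: k_def)
    ultimately show "(l j, l (j + 1)) \<in> E \<and> l (j + 2) \<noteq> l j"
      using assms(2) hadj hinj tV by (simp add: P_def ray_def flip: k_def)
  qed
  moreover have "g (l j) = l (j + int \<kappa>)" for j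
  proof -
    define n where "n = nat \<bar>j\<bar> + nat \<bar>j + int \<kappa>\<bar>"
    have "l j = P (Suc n) j" "l (j + int \<kappa>) = P n (j + int \<kappa>)" by (auto intro!: l simp: n_def)
    moreover have "j + int (Suc n) * int \<kappa> = j + int \<kappa> + int n * int \<kappa>" by (simp add: algebra_simps)
    ultimately show ?thesis using h(3)[OF hV[OF tV]] unfolding P_def by (simp add: add.assoc)
  qed
  ultimately show ?thesis by blast
qed

text \<open>Choose at z a third direction c that both rays avoid, and glue the ray t through c to
  each of them as negative half. An element carrying one line to the other shifts t along itself;
  without an axis the shift is 0, so z is fixed and one ray goes to the other.\<close>

lemma spheres_transitive:
  assumes no_axis: "\<nexists>g l \<kappa>. g \<in> G \<and> line l \<and> 0 < \<kappa> \<and> (\<forall>j. g (l j) = l (j + int \<kappa>))"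
    and "z \<in> V" "u \<in> V" "w \<in> V" "d z u = d z w"
  shows "\<exists>g\<in>G. g z = z \<and> g u = w"
proof -
  have no_shift: False if "g \<in> G" "ray t" "0 < \<kappa>" "\<And>k. g (t k) = t (k + \<kappa>)" for g t \<kappa>
    using axis[OF that] that(1,3) no_axis by blast
  have rays: "\<exists>g\<in>G. g z = z \<and> (\<forall>k. g (r k) = r' k)"
    if r: "ray r" "r 0 = z" "ray r'" "r' 0 = z" and c: "(z, c) \<in> E" "c \<noteq> r 1" "c \<noteq> r' 1" for r r' c
  proof -
    obtain t where t: "ray t" "t 0 = z" "t 1 = c" using ray_from_edge[OF c(1)] by blast
    obtain l where l: "line l" "\<forall>k. l (int k) = r k" "\<forall>k. l (- int k) = t k"
      using glue[OF r(1) t(1)] r t c by metis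
    obtain l' where l': "line l'" "\<forall>k. l' (int k) = r' k" "\<forall>k. l' (- int k) = t k"
      using glue[OF r(3) t(1)] r t c by metis
    obtain g s where g: "g \<in> G" "\<forall>j. g (l j) = l' (j + s)"
      using transitive_on_lines[OF l(1) l'(1)] by blast
    have tV: "t k \<in> V" for k using ray_verts[OF t(1)] .
    have "s = 0"
    proof (rule ccontr)
      assume "s \<noteq> 0"
      \<comment> \<open>For positive s the inverse of g pushes t into itself, for negative s it is
        g; \<open>no_shift\<close> excludes both.\<close>
      then consider "0 < s" | "s < 0" by linarith
      then show False
      proof cases
        case 1
        obtain h where h: "h \<in> G" "\<And>v. v \<in> V \<Longrightarrow> h (g v) = v" using inv[OF g(1)] by blast
        have "h (t k) = t (k + nat s)" for k
        proof -
          have "g (t (k + nat s)) = l' (- int (k + nat s) + s)" using g(2) l(3) by metis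
          also have "\<dots> = t k" using l'(3) 1 by simp
          finally show ?thesis using h(2)[OF tV] by metis
        qed
        then show False using no_shift[OF h(1) t(1), of "nat s"] 1 by simp
      next
        case 2
        have "g (t k) = t (k + nat (- s))" for k
        proof -
          have "g (t k) = l' (- int k + s)" using g(2) l(3) by metis
          also have "- int k + s = - int (k + nat (- s))" using 2 by simp
          also have "l' \<dots> = t (k + nat (- s))" using l'(3) by blast
          finally show ?thesis .
        qed
        then show False using no_shift[OF g(1) t(1), of "nat (- s)"] 2 by simp
      qed
    qed
    then have "g (r k) = r' k" for k using g(2) l(2) l'(2) by (metis add.right_neutral)
    then show ?thesis using g(1) r by metis
  qed
  obtain r where r: "ray r" "r 0 = z" "r (d z u) = u" using ray_through assms by blast
  obtain r' where r': "ray r'" "r' 0 = z" "r' (d z u) = w" using ray_through[of z w] assms by metis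
  obtain c where c: "(z, c) \<in> E" "c \<noteq> r 1" "c \<noteq> r' 1" using exists_nbr_avoiding[OF assms(2)] by blast
  from rays[OF r(1,2) r'(1,2) c] show ?thesis using r(3) r'(3) by metis
qed

text \<open>
  Either some element translates a line, and then every geodesic segment can be moved to one of
  finitely many positions on this line, or vertex stabilizers act transitively on spheres.
\<close>

lemma bounded_pair_orbits:
  "\<exists>D::nat. \<forall>m. \<exists>\<kappa>. \<forall>u\<in>V. \<forall>w\<in>V. d u w = m \<longrightarrow> \<kappa> u w < D \<and>
     (\<forall>u'\<in>V. \<forall>w'\<in>V. d u' w' = m \<longrightarrow> \<kappa> u' w' = \<kappa> u w \<longrightarrow> (\<exists>g\<in>G. g u = u' \<and> g w = w'))"
proof (cases "\<exists>g l \<kappa>. g \<in> G \<and> line l \<and> 0 < \<kappa> \<and> (\<forall>j. g (l j) = l (j + int \<kappa>))")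
  case True
  then obtain g l D where g: "g \<in> G" "line l" "0 < D" "\<And>j. g (l j) = l (j + int D)" by blast
  obtain g' where g': "g' \<in> G" "\<And>v. v \<in> V \<Longrightarrow> g' (g v) = v" using inv[OF g(1)] by blast
  have g'l: "g' (l j) = l (j - int D)" for j
    using g'(2)[OF line_verts[OF g(2), of "j - int D"]] g(4)[of "j - int D"] by simp
  \<comment> \<open>A segment extends to a line, which can be moved onto l. Translations by
    multiples of D then reduce the starting index modulo D.\<close>
  have pos: "\<exists>i<D. \<exists>h\<in>G. h u = l (int i) \<and> h w = l (int i + int (d u w))" if uw: "u \<in> V" "w \<in> V" for u w
  proof -
    define P where "P = (\<lambda>s. \<exists>h\<in>G. h u = l s \<and> h w = l (s + int (d u w)))"
    obtain r where r: "ray r" "r 0 = u" "r (d u w) = w" using ray_through uw by blast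
    obtain m where m: "line m" "\<forall>k. m (int k) = r k" using line_extending[OF r(1)] by blast
    obtain h s where h: "h \<in> G" "\<forall>j. h (m j) = l (j + s)" using transitive_on_lines[OF m(1) g(2)] by blast
    have "h u = l s" using h(2)[rule_format, of 0] m(2)[rule_format, of 0] r(2) by simp
    moreover have "h w = l (s + int (d u w))"
      using h(2)[rule_format, of "int (d u w)"] m(2)[rule_format, of "d u w"] r(3) by (simp add: add.commute)
    ultimately have Ps: "P s" unfolding P_def using h(1) by blast
    have up: "P (s + int D)" if Ps: "P s" for s
    proof -
      obtain h where h: "h \<in> G" "h u = l s" "h w = l (s + int (d u w))" using Ps by (auto simp: P_def)
      obtain k where "k \<in> G" "\<forall>v\<in>V. k v = g (h v)" using comp[OF g(1) h(1)] by blast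
      then show ?thesis using h g(4) uw by (auto simp: P_def algebra_simps intro!: bexI[of _ k])
    qed
    have down: "P (s - int D)" if Ps: "P s" for s
    proof -
      obtain h where h: "h \<in> G" "h u = l s" "h w = l (s + int (d u w))" using Ps by (auto simp: P_def)
      obtain k where "k \<in> G" "\<forall>v\<in>V. k v = g' (h v)" using comp[OF g'(1) h(1)] by blast
      then show ?thesis using h g'l uw by (auto simp: P_def algebra_simps intro!: bexI[of _ k])
    qed
    have "P (s + int D * q)" for q
    proof (induction q rule: int_induct[where k = 0])
      case (step1 i)
      then show ?case using up[of "s + int D * i"] by (simp add: algebra_simps)
    next
      case (step2 i)
      then show ?case using down[of "s + int D * i"] by (simp add: algebra_simps)
    qed (use Ps in simp)
    from this[of "- (s div int D)"] have "P (s mod int D)"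
      by (simp add: minus_mult_div_eq_mod)
    moreover have "s mod int D = int (nat (s mod int D))" "nat (s mod int D) < D"
      using g(3) pos_mod_bound[of "int D" s] by (simp_all add: nat_less_iff)
    ultimately show ?thesis unfolding P_def by metis
  qed
  \<comment> \<open>The label of a pair is a possible starting index on the axis. Pairs at equal
    distance with equal labels have a common image on l.\<close>
  define \<kappa> where "\<kappa> = (\<lambda>u w. SOME i. i < D \<and> (\<exists>h\<in>G. h u = l (int i) \<and> h w = l (int i + int (d u w))))"
  have \<kappa>: "\<kappa> u w < D \<and> (\<exists>h\<in>G. h u = l (int (\<kappa> u w)) \<and> h w = l (int (\<kappa> u w) + int (d u w)))"
    if "u \<in> V" "w \<in> V" for u w
    unfolding \<kappa>_def by (rule someI_ex) (use pos[OF that] in blast)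
  have "\<exists>g\<in>G. g u = u' \<and> g w = w'"
    if V: "u \<in> V" "w \<in> V" "u' \<in> V" "w' \<in> V" and eq: "d u w = d u' w'" "\<kappa> u' w' = \<kappa> u w" for u w u' w'
  proof -
    obtain h where h: "h \<in> G" "h u = l (int (\<kappa> u w))" "h w = l (int (\<kappa> u w) + int (d u w))"
      using \<kappa>[OF V(1,2)] by blast
    obtain h' where h': "h' \<in> G" "h' u' = l (int (\<kappa> u w))" "h' w' = l (int (\<kappa> u w) + int (d u w))"
      using \<kappa>[OF V(3,4)] eq by auto
    obtain h'' where h'': "h'' \<in> G" "\<forall>v\<in>V. h'' (h' v) = v" using inv[OF h'(1)] by blast
    obtain k where k: "k \<in> G" "\<forall>v\<in>V. k v = h'' (h v)" using comp[OF h''(1) h(1)] by blast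
    have "k u = u'" using k(2)[rule_format, OF V(1)] h''(2)[rule_format, OF V(3)] h(2) h'(2) by simp
    moreover have "k w = w'" using k(2)[rule_format, OF V(2)] h''(2)[rule_format, OF V(4)] h(3) h'(3) by simp
    ultimately show ?thesis using k(1) by blast
  qed
  then show ?thesis using \<kappa> by (intro exI[of _ D] allI exI[of _ \<kappa>]) auto
next
  case False
  note sph = spheres_transitive[OF False]
  have "\<exists>g\<in>G. g u = u' \<and> g w = w'"
    if V: "u \<in> V" "w \<in> V" "u' \<in> V" "w' \<in> V" and eq: "d u w = d u' w'" "colour T u = colour T u'" for u w u' w'
  proof -
    \<comment> \<open>Equal colours make the distance even. The stabilizer of the midpoint
      \<open>r k\<close> moves u to u', and the stabilizer of u' then corrects the second vertex;
      hence two labels, the colours, suffice.\<close>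
    obtain k where k: "d u u' = 2 * k" using dist_colour[OF V(1,3)] eq(2) by auto
    obtain r where r: "ray r" "r 0 = u" "r (d u u') = u'" using ray_through V by blast
    have zV: "r k \<in> V" using ray_verts[OF r(1)] .
    have "d (r k) u = k" using ray_dist[OF r(1), of 0 k] r(2) dist_commute V(1) zV by simp
    moreover have "d (r k) u' = k" using ray_dist[OF r(1), of k k] r(3) k by (simp add: mult_2)
    ultimately obtain g where g: "g \<in> G" "g u = u'" using sph[OF zV V(1,3)] by auto
    have "d u' (g w) = d u' w'" using aut_dist[OF aut[OF g(1)] V(1,2)] g(2) eq(1) by simp
    then obtain h where h: "h \<in> G" "h u' = u'" "h (g w) = w'"
      using sph[OF V(3) aut_verts[OF aut[OF g(1)] V(2)] V(4)] by auto
    obtain k where k: "k \<in> G" "\<forall>v\<in>V. k v = h (g v)" using comp[OF h(1) g(1)] by blast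
    have "k u = u'" "k w = w'" using k(2) V g(2) h(2,3) by simp_all
    then show ?thesis using k(1) by blast
  qed
  then show ?thesis
    by (intro exI[of _ 2] allI exI[of _ "\<lambda>u w. if colour T u then 1 else 0"]) auto
qed

end

section \<open>Harmonic functions with invariant Gram matrix\<close>

text \<open>f factors through c. This is the device by which orbits, norms and isomorphism types are
  counted by finitely many labels.\<close>

lemma card_image_le_colours:
  assumes "finite (c ` A)" "\<And>x y. x \<in> A \<Longrightarrow> y \<in> A \<Longrightarrow> c x = c y \<Longrightarrow> f x = f y"
  shows "finite (f ` A)" "card (f ` A) \<le> card (c ` A)"
proof -
  have "f x = f (inv_into A c (c x))" if "x \<in> A" for x
    using that by (intro assms(2) inv_into_into) (auto simp: f_inv_into_f)
  then have "f ` A = (\<lambda>z. f (inv_into A c z)) ` c ` A" by force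
  then show "finite (f ` A)" "card (f ` A) \<le> card (c ` A)"
    using assms(1) card_image_le by auto
qed

lemma bounded_mono_nat_eventually_const:
  fixes a :: "nat \<Rightarrow> nat"
  assumes "\<And>m. a m \<le> a (Suc m)" "\<And>m. a m \<le> K"
  shows "\<exists>m0. \<forall>m\<ge>m0. a m = a m0"
proof -
  obtain m0 where m0: "\<forall>m. a m \<le> a m0"
    using ex_has_greatest_nat[of "\<lambda>_. True" undefined a "Suc K"] assms(2) by (auto simp: less_Suc_eq_le)
  then have "a m = a m0" if "m \<ge> m0" for m
    using lift_Suc_mono_le[of a, OF assms(1) that] by (simp add: le_antisym)
  then show ?thesis by blast
qed

text \<open>H is the projection of the lattice and G its closure. Transitivity on the boundary is
  known for G only, whereas the Gram matrices are invariant only under H; \<open>dense\<close> is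
  density for pointwise convergence.\<close>

locale dense_action = boundary_transitive T G
  for T :: "('v, 'x) coloured_graph_scheme" and G :: "('v \<Rightarrow> 'v) set" +
  fixes H :: "('v \<Rightarrow> 'v) set"
  assumes autH: "h \<in> H \<Longrightarrow> h \<in> aut_plus T"
    and oneH: "\<exists>e\<in>H. \<forall>v\<in>V. e v = v"
    and compH: "g \<in> H \<Longrightarrow> h \<in> H \<Longrightarrow> \<exists>k\<in>H. \<forall>v\<in>V. k v = g (h v)"
    and invH: "g \<in> H \<Longrightarrow> \<exists>k\<in>H. \<forall>v\<in>V. k (g v) = v \<and> g (k v) = v"
    and dense: "g \<in> G \<Longrightarrow> finite F \<Longrightarrow> F \<subseteq> V \<Longrightarrow> \<exists>h\<in>H. \<forall>v\<in>F. h v = g v"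
begin

text \<open>Moving a pair of vertices prescribes only two values, so density lets H replace
  G.\<close>

lemma bounded_pair_orbits_dense:
  "\<exists>D::nat. \<forall>m. \<exists>\<kappa>. \<forall>u\<in>V. \<forall>w\<in>V. d u w = m \<longrightarrow> \<kappa> u w < D \<and>
     (\<forall>u'\<in>V. \<forall>w'\<in>V. d u' w' = m \<longrightarrow> \<kappa> u' w' = \<kappa> u w \<longrightarrow> (\<exists>g\<in>H. g u = u' \<and> g w = w'))"
proof -
  have GH: "(\<exists>g\<in>G. g u = u' \<and> g w = w') \<Longrightarrow> (\<exists>h\<in>H. h u = u' \<and> h w = w')"
    if "u \<in> V" "w \<in> V" for u w u' w'
    using dense[of _ "{u, w}"] that by fastforce
  obtain D :: nat where D: "\<forall>m. \<exists>\<kappa>. \<forall>u\<in>V. \<forall>w\<in>V. d u w = m \<longrightarrow> \<kappa> u w < D \<and>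
     (\<forall>u'\<in>V. \<forall>w'\<in>V. d u' w' = m \<longrightarrow> \<kappa> u' w' = \<kappa> u w \<longrightarrow> (\<exists>g\<in>G. g u = u' \<and> g w = w'))"
    using bounded_pair_orbits by blast
  show ?thesis
  proof (intro exI[of _ D] allI)
    fix m
    from D obtain \<kappa> where \<kappa>: "\<forall>u\<in>V. \<forall>w\<in>V. d u w = m \<longrightarrow> \<kappa> u w < D \<and>
     (\<forall>u'\<in>V. \<forall>w'\<in>V. d u' w' = m \<longrightarrow> \<kappa> u' w' = \<kappa> u w \<longrightarrow> (\<exists>g\<in>G. g u = u' \<and> g w = w'))"
      by blast
    show "\<exists>\<kappa>. \<forall>u\<in>V. \<forall>w\<in>V. d u w = m \<longrightarrow> \<kappa> u w < D \<and>
     (\<forall>u'\<in>V. \<forall>w'\<in>V. d u' w' = m \<longrightarrow> \<kappa> u' w' = \<kappa> u w \<longrightarrow> (\<exists>g\<in>H. g u = u' \<and> g w = w'))"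
      by (intro exI[of _ \<kappa>] ballI impI conjI) (use \<kappa> GH in \<open>simp_all\<close>)
  qed
qed

context
  fixes \<phi> :: "'v \<Rightarrow> 'w :: real_inner" and B :: "'w set"
  assumes gram: "\<And>h a b a' b'. h \<in> H \<Longrightarrow> a \<in> V \<Longrightarrow> b \<in> V \<Longrightarrow> a' \<in> V \<Longrightarrow> b' \<in> V \<Longrightarrow>
      inner (\<phi> (h a) - \<phi> (h b)) (\<phi> (h a') - \<phi> (h b')) = inner (\<phi> a - \<phi> b) (\<phi> a' - \<phi> b')"
    and finite_dim: "finite B" "\<phi> ` V \<subseteq> span B"
begin

text \<open>P consists of the end points of finitely many differences that span all differences. If
  h fixes P, the discrepancy e lies in that span and, by \<open>gram\<close>, is orthogonal to every
  spanning difference; so it is 0.\<close>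

lemma differences_fixed:
  "\<exists>P. finite P \<and> P \<subseteq> V \<and> (\<forall>h\<in>H. (\<forall>p\<in>P. h p = p) \<longrightarrow>
     (\<forall>x\<in>V. \<forall>y\<in>V. \<phi> (h x) - \<phi> (h y) = \<phi> x - \<phi> y))"
proof -
  define \<Delta> where "\<Delta> = (\<lambda>(x, y). \<phi> x - \<phi> y) ` (V \<times> V)"
  obtain C where C: "C \<subseteq> \<Delta>" "independent C" "\<Delta> \<subseteq> span C"
    using maximal_independent_subset by blast
  have "C \<subseteq> span B" using C(1) finite_dim(2) span_diff unfolding \<Delta>_def by fast
  with C(2) have "finite C" using independent_span_bound[OF finite_dim(1)] by blast
  then obtain Q where Q: "Q \<subseteq> V \<times> V" "finite Q" "C = (\<lambda>(x, y). \<phi> x - \<phi> y) ` Q"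
    using C(1) finite_subset_image[of C "\<lambda>(x, y). \<phi> x - \<phi> y" "V \<times> V"] by (auto simp: \<Delta>_def)
  define P where "P = fst ` Q \<union> snd ` Q"
  have "\<phi> (h x) - \<phi> (h y) = \<phi> x - \<phi> y"
    if h: "h \<in> H" "\<forall>p\<in>P. h p = p" and V: "x \<in> V" "y \<in> V" for h x y
  proof -
    define e where "e = (\<phi> (h x) - \<phi> (h y)) - (\<phi> x - \<phi> y)"
    have "(h x, h y) \<in> V \<times> V" using V aut_verts[OF autH[OF h(1)]] by simp
    then have "\<phi> (h x) - \<phi> (h y) \<in> \<Delta>" "\<phi> x - \<phi> y \<in> \<Delta>" using V by (auto simp: \<Delta>_def)
    then have "e \<in> span C" unfolding e_def using C(3) by (meson span_diff subsetD)
    moreover have inner_C: "inner e c = 0" if "c \<in> C" for c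
    proof -
      obtain a b where ab: "(a, b) \<in> Q" "c = \<phi> a - \<phi> b" using \<open>c \<in> C\<close> Q(3) by auto
      then have "a \<in> P" "b \<in> P" "a \<in> V" "b \<in> V" using Q(1) by (force simp: P_def)+
      then show ?thesis using gram[OF h(1) V, of a b] h(2) ab(2)
        by (simp add: e_def inner_diff_left)
    qed
    moreover have "inner e c = 0" if "c \<in> span C" for c
      using that inner_C by (induction rule: span_induct_alt) (auto simp: inner_right_distrib)
    ultimately have "inner e e = 0" by blast
    then show ?thesis by (simp add: e_def)
  qed
  moreover have "finite P" "P \<subseteq> V" using Q by (auto simp: P_def)
  ultimately show ?thesis by blast
qed

text \<open>Edges are pairs at distance 1 and thus fall into finitely many orbits;
  \<open>gram\<close> makes the norm constant on each.\<close>

lemma finite_edge_norms: "finite ((\<lambda>(x, y). norm (\<phi> x - \<phi> y)) ` E)"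
proof -
  have d1: "d x y = 1" if "(x, y) \<in> E" for x y
    using that adj_dist[OF that] dist_0_iff[of x y] adj_verts[OF that] adj_colour[OF that]
    by (metis One_nat_def le_Suc_eq le_zero_eq)
  obtain D :: nat where D: "\<forall>m. \<exists>\<kappa>. \<forall>u\<in>V. \<forall>w\<in>V. d u w = m \<longrightarrow> \<kappa> u w < D \<and>
     (\<forall>u'\<in>V. \<forall>w'\<in>V. d u' w' = m \<longrightarrow> \<kappa> u' w' = \<kappa> u w \<longrightarrow> (\<exists>g\<in>H. g u = u' \<and> g w = w'))"
    using bounded_pair_orbits_dense by blast
  from D[rule_format, of 1] obtain \<kappa> where \<kappa>: "\<forall>u\<in>V. \<forall>w\<in>V. d u w = 1 \<longrightarrow> \<kappa> u w < D \<and>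
     (\<forall>u'\<in>V. \<forall>w'\<in>V. d u' w' = 1 \<longrightarrow> \<kappa> u' w' = \<kappa> u w \<longrightarrow> (\<exists>g\<in>H. g u = u' \<and> g w = w'))"
    by blast
  show ?thesis
  proof (rule card_image_le_colours(1))
    have "\<kappa> x y < D" if "(x, y) \<in> E" for x y
      using \<kappa>[rule_format, OF adj_verts[OF that] d1[OF that]] by blast
    then have "(\<lambda>(x, y). \<kappa> x y) ` E \<subseteq> {..<D}" by auto
    then show "finite ((\<lambda>(x, y). \<kappa> x y) ` E)" by (rule finite_subset) simp
    fix p q assume "p \<in> E" "q \<in> E" and eq: "(case p of (x, y) \<Rightarrow> \<kappa> x y) = (case q of (x, y) \<Rightarrow> \<kappa> x y)"
    then obtain x y x' y' where e: "p = (x, y)" "q = (x', y')" "(x, y) \<in> E" "(x', y') \<in> E"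
      by (metis surj_pair)
    note V = adj_verts[OF e(3)] adj_verts[OF e(4)]
    obtain g where g: "g \<in> H" "g x = x'" "g y = y'"
      using \<kappa>[rule_format, OF V(1,2) d1[OF e(3)]] V d1[OF e(4)] eq e(1,2) by auto
    from gram[OF g(1) V(1,2) V(1,2)] g show "(case p of (x, y) \<Rightarrow> norm (\<phi> x - \<phi> y)) = (case q of (x, y) \<Rightarrow> norm (\<phi> x - \<phi> y))"
      by (simp add: e norm_eq_sqrt_inner)
  qed
qed

text \<open>
  The number of orbits on spheres around \<open>v\<close> of the subgroup acting trivially on the increments
  of \<open>\<phi>\<close> is bounded, hence eventually constant, so that far out siblings lie in a common orbit.
\<close>

lemma siblings_eventually_equal:
  assumes "v \<in> V"
  shows "\<exists>m0. \<forall>x y y'. m0 \<le> d v x \<longrightarrow> (x, y) \<in> E \<longrightarrow> (x, y') \<in> E \<longrightarrow>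
    d v y = Suc (d v x) \<longrightarrow> d v y' = Suc (d v x) \<longrightarrow> \<phi> y = \<phi> y'"
proof -
  obtain P where P: "finite P" "P \<subseteq> V" and *: "\<forall>h\<in>H. (\<forall>p\<in>P. h p = p) \<longrightarrow>
     (\<forall>x\<in>V. \<forall>y\<in>V. \<phi> (h x) - \<phi> (h y) = \<phi> x - \<phi> y)"
    using differences_fixed by (elim exE conjE)
  have fixP: "\<phi> (h x) - \<phi> (h y) = \<phi> x - \<phi> y"
    if "h \<in> H" "\<forall>p\<in>P. h p = p" "x \<in> V" "y \<in> V" for h x y
    using *[rule_format, OF that(1) _ that(3,4)] that(2) by simp
  \<comment> \<open>Fixing v preserves the spheres around v, and fixing P makes \<open>fixP\<close>
    available.\<close>
  define N where "N = {h \<in> H. h v = v \<and> (\<forall>p\<in>P. h p = p)}"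
  define S where "S = (\<lambda>m. {x \<in> V. d v x = m})"
  define orb where "orb = (\<lambda>x. (\<lambda>n. n x) ` N)"
  have N_one: "\<exists>e\<in>N. \<forall>x\<in>V. e x = x"
  proof -
    obtain e where "e \<in> H" "\<forall>x\<in>V. e x = x" using oneH by blast
    then show ?thesis using P(2) assms by (intro bexI[of _ e]) (auto simp: N_def)
  qed
  have N_comp: "\<exists>k\<in>N. \<forall>x\<in>V. k x = g (h x)" if gh: "g \<in> N" "h \<in> N" for g h
  proof -
    obtain k where k: "k \<in> H" "\<forall>x\<in>V. k x = g (h x)" using compH[of g h] gh by (auto simp: N_def)
    then show ?thesis using P(2) assms gh by (intro bexI[of _ k]) (auto simp: N_def subset_iff)
  qed
  have N_inv: "\<exists>k\<in>N. \<forall>x\<in>V. k (g x) = x" if g: "g \<in> N" for g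
  proof -
    obtain k where k: "k \<in> H" "\<forall>x\<in>V. k (g x) = x \<and> g (k x) = x" using invH[of g] g by (auto simp: N_def)
    have "k p = p" if "p \<in> insert v P" for p
    proof -
      have "g p = p" "p \<in> V" using that g P(2) assms by (auto simp: N_def)
      then show ?thesis using k(2) by metis
    qed
    then show ?thesis using k by (intro bexI[of _ k]) (auto simp: N_def)
  qed
  have N_aut: "n \<in> aut_plus T" and Nv: "n v = v" if "n \<in> N" for n
    using that autH by (auto simp: N_def)
  have orb_eq: "orb (n x) = orb x" if n: "n \<in> N" "x \<in> V" for n x
  proof
    show "orb (n x) \<subseteq> orb x"
    proof
      fix z assume "z \<in> orb (n x)"
      then obtain n' where "n' \<in> N" "z = n' (n x)" by (auto simp: orb_def)
      moreover obtain k where "k \<in> N" "\<forall>x\<in>V. k x = n' (n x)" using N_comp[OF calculation(1) n(1)] by blast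
      ultimately show "z \<in> orb x" using n(2) by (auto simp: orb_def intro!: image_eqI[of _ _ k])
    qed
    obtain k where k: "k \<in> N" "\<forall>x\<in>V. k (n x) = x" using N_inv[OF n(1)] by blast
    show "orb x \<subseteq> orb (n x)"
    proof
      fix z assume "z \<in> orb x"
      then obtain n' where n': "n' \<in> N" "z = n' x" by (auto simp: orb_def)
      obtain l where "l \<in> N" "\<forall>x\<in>V. l x = n' (k x)" using N_comp[OF n'(1) k(1)] by blast
      then show "z \<in> orb (n x)" using k(2) n n' aut_verts[OF N_aut[OF n(1)] n(2)]
        by (auto simp: orb_def intro!: image_eqI[of _ _ l])
    qed
  qed
  obtain D :: nat where D: "\<forall>m. \<exists>\<kappa>. \<forall>u\<in>V. \<forall>w\<in>V. d u w = m \<longrightarrow> \<kappa> u w < D \<and>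
     (\<forall>u'\<in>V. \<forall>w'\<in>V. d u' w' = m \<longrightarrow> \<kappa> u' w' = \<kappa> u w \<longrightarrow> (\<exists>g\<in>H. g u = u' \<and> g w = w'))"
    using bounded_pair_orbits_dense by blast
  \<comment> \<open>It contains all possible positions of P under elements that fix v; local
    finiteness makes it finite.\<close>
  define Q where "Q = (\<Pi>\<^sub>E p\<in>P. {y \<in> V. d v y \<le> d v p})"
  have finQ: "finite Q" unfolding Q_def by (intro finite_PiE P(1) finite_ball assms)
  have finS: "finite (S m)" for m
    by (rule finite_subset[OF _ finite_ball[OF assms, of m]]) (auto simp: S_def)
  \<comment> \<open>\<open>hh x\<close> moves x to the representative of its label. If x and y have
    the same label and \<open>hh x\<close>, \<open>hh y\<close> agree on P, then the inverse of
    \<open>hh y\<close> after \<open>hh x\<close> lies in N and carries x to y. So an orbit of N is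
    determined by a label and an element of Q.\<close>
  have card_orb: "card (orb ` S m) \<le> D * card Q" for m
  proof -
    obtain \<kappa> where \<kappa>: "\<forall>u\<in>V. \<forall>w\<in>V. d u w = m \<longrightarrow> \<kappa> u w < D \<and>
      (\<forall>u'\<in>V. \<forall>w'\<in>V. d u' w' = m \<longrightarrow> \<kappa> u' w' = \<kappa> u w \<longrightarrow> (\<exists>g\<in>H. g u = u' \<and> g w = w'))"
      using D by blast
    define rep where "rep = (\<lambda>i. SOME x. x \<in> S m \<and> \<kappa> v x = i)"
    have rep: "rep (\<kappa> v x) \<in> S m \<and> \<kappa> v (rep (\<kappa> v x)) = \<kappa> v x" if "x \<in> S m" for x
      unfolding rep_def by (rule someI[of _ x]) (use that in simp)
    define hh where "hh = (\<lambda>x. SOME h. h \<in> H \<and> h v = v \<and> h x = rep (\<kappa> v x))"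
    have hh: "hh x \<in> H" "hh x v = v" "hh x x = rep (\<kappa> v x)" if "x \<in> S m" for x
    proof -
      have "\<exists>h. h \<in> H \<and> h v = v \<and> h x = rep (\<kappa> v x)"
        using \<kappa>[rule_format, OF assms, of x] that rep[OF that] assms by (auto simp: S_def)
      from someI_ex[OF this] show "hh x \<in> H" "hh x v = v" "hh x x = rep (\<kappa> v x)" by (auto simp: hh_def)
    qed
    define c where "c = (\<lambda>x. (\<kappa> v x, restrict (hh x) P))"
    have "c x \<in> {..<D} \<times> Q" if "x \<in> S m" for x
    proof -
      have "d v (hh x p) = d v p" if "p \<in> P" for p
        using aut_dist[OF autH[OF hh(1)[OF \<open>x \<in> S m\<close>]] assms, of p] hh(2)[OF \<open>x \<in> S m\<close>] P(2) that by auto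
      then show ?thesis using \<kappa> assms that P(2) aut_verts[OF autH[OF hh(1)[OF that]]]
        by (auto simp: c_def S_def Q_def)
    qed
    then have sub: "c ` S m \<subseteq> {..<D} \<times> Q" by blast
    have "card (orb ` S m) \<le> card (c ` S m)"
    proof (rule card_image_le_colours(2))
      show "finite (c ` S m)" using finS by blast
      fix x y assume xy: "x \<in> S m" "y \<in> S m" "c x = c y"
      have eqP: "hh x p = hh y p" if "p \<in> P" for p
      proof -
        have "restrict (hh x) P p = restrict (hh y) P p" using xy(3) by (simp add: c_def)
        then show ?thesis using that by simp
      qed
      obtain k where k: "k \<in> H" "\<forall>z\<in>V. k (hh y z) = z" using invH[OF hh(1)[OF xy(2)]] by blast
      obtain n where n: "n \<in> H" "\<forall>z\<in>V. n z = k (hh x z)" using compH[OF k(1) hh(1)[OF xy(1)]] by blast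
      have V: "x \<in> V" "y \<in> V" using xy by (auto simp: S_def)
      have "n v = v" using n(2) k(2)[rule_format, OF assms] assms hh(2)[OF xy(1)] hh(2)[OF xy(2)] by simp
      moreover have "n p = p" if p: "p \<in> P" for p
      proof -
        have "p \<in> V" using p P(2) by blast
        then show ?thesis using n(2) k(2)[rule_format, of p] eqP[OF p] by simp
      qed
      ultimately have "n \<in> N" using n(1) by (auto simp: N_def)
      moreover have "n x = y"
      proof -
        have "hh x x = hh y y" using hh(3)[OF xy(1)] hh(3)[OF xy(2)] xy(3) by (simp add: c_def)
        then show ?thesis using n(2)[rule_format, OF V(1)] k(2)[rule_format, OF V(2)] by simp
      qed
      ultimately show "orb x = orb y" using orb_eq[of n x] V by simp
    qed
    also have "\<dots> \<le> card ({..<D} \<times> Q)" by (rule card_mono[OF _ sub]) (use finQ in simp)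
    finally show ?thesis by (simp add: card_cartesian_product)
  qed
  define par where "par = (\<lambda>x. THE y. (x, y) \<in> E \<and> d v x = Suc (d v y))"
  have par_eq: "par x = y" if "(x, y) \<in> E" "d v x = Suc (d v y)" for x y
    unfolding par_def by (rule the_equality) (use that pred_unique[OF assms] in auto)
  have par_n: "par (n y) = n x" if "n \<in> N" "(x, y) \<in> E" "d v y = Suc (d v x)" for n x y
  proof (rule par_eq)
    note V = adj_verts[OF that(2)]
    show "(n y, n x) \<in> E" using aut_adj[OF N_aut[OF that(1)] V(2,1)] adj_sym[OF that(2)] by simp
    show "d v (n y) = Suc (d v (n x))"
      using aut_dist[OF N_aut[OF that(1)] assms V(1)] aut_dist[OF N_aut[OF that(1)] assms V(2)]
        Nv[OF that(1)] that(3) by simp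
  qed
  have par_orb: "par ` orb y = orb x" if "(x, y) \<in> E" "d v y = Suc (d v x)" for x y
    using par_n[OF _ that] by (auto simp: orb_def image_iff)
  \<comment> \<open>Passing to parents maps the orbits on a sphere onto those of the previous
    sphere, so the number of orbits does not decrease with the radius.\<close>
  have onto: "orb ` S m = (\<lambda>A. par ` A) ` orb ` S (Suc m)" for m
  proof
    show "orb ` S m \<subseteq> (\<lambda>A. par ` A) ` orb ` S (Suc m)"
    proof
      fix z assume "z \<in> orb ` S m"
      then obtain x where x: "x \<in> V" "d v x = m" "z = orb x" by (auto simp: S_def)
      obtain y where y: "(x, y) \<in> E" "d v y = Suc m"
      proof (cases m)
        case 0
        then obtain y where "(x, y) \<in> E" using exists_nbr_avoiding[OF x(1)] by blast
        then show ?thesis using that dist_step[OF assms] x(2) 0 by fastforce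
      next
        case (Suc k)
        then obtain w where w: "(x, w) \<in> E" "d v w = k" using exists_pred[OF assms x(1)] x(2) by blast
        obtain y where "(x, y) \<in> E" "y \<noteq> w" using exists_nbr_avoiding[OF x(1)] by blast
        then show ?thesis using that away_step[OF assms adj_sym[OF w(1)]] w(2) x(2) Suc by auto
      qed
      then show "z \<in> (\<lambda>A. par ` A) ` orb ` S (Suc m)"
        using par_orb[OF y(1)] x adj_verts[OF y(1)] by (auto simp: S_def image_iff)
    qed
    show "(\<lambda>A. par ` A) ` orb ` S (Suc m) \<subseteq> orb ` S m"
    proof
      fix z assume "z \<in> (\<lambda>A. par ` A) ` orb ` S (Suc m)"
      then obtain y where y: "y \<in> V" "d v y = Suc m" "z = par ` orb y" by (auto simp: S_def)
      then obtain x where x: "(y, x) \<in> E" "d v x = m" using exists_pred[OF assms] by blast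
      then show "z \<in> orb ` S m" using par_orb[OF adj_sym[OF x(1)]] y adj_verts[OF x(1)] by (auto simp: S_def)
    qed
  qed
  have "card (orb ` S m) \<le> card (orb ` S (Suc m))" for m
    unfolding onto[of m] by (intro card_image_le finite_imageI finS)
  then obtain m0 where m0: "\<forall>m\<ge>m0. card (orb ` S m) = card (orb ` S m0)"
    using bounded_mono_nat_eventually_const[of "\<lambda>m. card (orb ` S m)"] card_orb by blast
  have "\<phi> y = \<phi> y'" if x: "m0 \<le> d v x" "(x, y) \<in> E" "(x, y') \<in> E"
    "d v y = Suc (d v x)" "d v y' = Suc (d v x)" for x y y'
  proof -
    note V = adj_verts[OF x(2)] adj_verts[OF x(3)]
    \<comment> \<open>Beyond \<open>m0\<close> the two numbers of orbits agree, so the surjection on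
      orbits is injective. Siblings have the same parent orbit and therefore the same orbit.\<close>
    have "inj_on (\<lambda>A. par ` A) (orb ` S (Suc (d v x)))"
    proof (rule eq_card_imp_inj_on)
      show "card ((\<lambda>A. par ` A) ` orb ` S (Suc (d v x))) = card (orb ` S (Suc (d v x)))"
        using m0 x(1) unfolding onto[symmetric] by (metis le_SucI)
    qed (use finS in blast)
    moreover have "par ` orb y = par ` orb y'" using par_orb[OF x(2,4)] par_orb[OF x(3,5)] by simp
    ultimately have "orb y = orb y'" using x V by (auto simp: inj_on_def S_def)
    moreover have "y' \<in> orb y'"
    proof -
      obtain e where "e \<in> N" "e y' = y'" using N_one V(4) by blast
      then show ?thesis by (auto simp: orb_def intro!: image_eqI[of _ _ e])
    qed
    ultimately obtain n where n: "n \<in> N" "y' = n y" by (auto simp: orb_def)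
    \<comment> \<open>Since n respects parents, moving y to its sibling fixes x; so
      \<open>fixP\<close> compares the increments from x to y and to y'.\<close>
    have "n x = x" using par_n[OF n(1) x(2,4)] par_eq[OF adj_sym[OF x(3)] x(5)] n(2) by simp
    then have "\<phi> y' - \<phi> x = \<phi> y - \<phi> x"
      using fixP[of n y x] n V by (auto simp: N_def)
    then show ?thesis by simp
  qed
  then show ?thesis by blast
qed

lemma harmonic_constant:
  assumes harm: "\<And>v. v \<in> V \<Longrightarrow> (\<Sum>w\<in>E `` {v}. \<phi> w - \<phi> v) = 0"
    and "v \<in> V" "w \<in> V"
  shows "\<phi> w = \<phi> v"
proof -
  obtain m0 where sib: "\<And>x y y'. m0 \<le> d v x \<Longrightarrow> (x, y) \<in> E \<Longrightarrow> (x, y') \<in> E \<Longrightarrow>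
    d v y = Suc (d v x) \<Longrightarrow> d v y' = Suc (d v x) \<Longrightarrow> \<phi> y = \<phi> y'"
    using siblings_eventually_equal[OF assms(2)] by blast
  have split: "\<phi> x - \<phi> p = (\<Sum>y\<in>E `` {x} - {p}. \<phi> y - \<phi> x)"
    and child: "\<And>y. y \<in> E `` {x} - {p} \<Longrightarrow> d v y = Suc (d v x)"
    if "(p, x) \<in> E" "d v x = Suc (d v p)" for p x
  proof -
    have xV: "x \<in> V" and xp: "(x, p) \<in> E" using that adj_verts adj_sym by auto
    show "d v y = Suc (d v x)" if "y \<in> E `` {x} - {p}" for y
      using away_step[OF assms(2) \<open>(p, x) \<in> E\<close>] that \<open>d v x = Suc (d v p)\<close> by auto
    have "0 = (\<phi> p - \<phi> x) + (\<Sum>y\<in>E `` {x} - {p}. \<phi> y - \<phi> x)"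
      using sum.remove[OF finite_nbrs[OF xV], of p "\<lambda>y. \<phi> y - \<phi> x"] xp harm[OF xV] by auto
    then show "\<phi> x - \<phi> p = (\<Sum>y\<in>E `` {x} - {p}. \<phi> y - \<phi> x)" by (simp add: algebra_simps)
  qed
  \<comment> \<open>Radial edges far out along which \<phi> changes. Only finitely many norms occur,
    so one of them has a shortest increment.\<close>
  define A where "A = {(p, x) \<in> E. d v x = Suc (d v p) \<and> m0 \<le> d v x \<and> \<phi> x \<noteq> \<phi> p}"
  have "A = {}"
  proof (rule ccontr)
    assume ne: "A \<noteq> {}"
    let ?f = "\<lambda>(p, x). norm (\<phi> p - \<phi> x)"
    have fin: "finite (?f ` A)" by (rule finite_subset[OF _ finite_edge_norms]) (auto simp: A_def)
    with ne have "Min (?f ` A) \<in> ?f ` A" by (intro Min_in) auto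
    then obtain p x where px: "(p, x) \<in> A" "Min (?f ` A) = norm (\<phi> p - \<phi> x)" by auto
    then have e: "(p, x) \<in> E" "d v x = Suc (d v p)" "m0 \<le> d v x" "\<phi> x \<noteq> \<phi> p" by (auto simp: A_def)
    have xV: "x \<in> V" using adj_verts e by auto
    obtain y where y: "(x, y) \<in> E" "y \<noteq> p" using exists_nbr_avoiding[OF xV] by blast
    have dy: "d v y = Suc (d v x)" using child[OF e(1,2), of y] y by blast
    have "\<phi> z = \<phi> y" if "z \<in> E `` {x} - {p}" for z
      by (rule sib[OF e(3) _ y(1) child[OF e(1,2) that] dy]) (use that in auto)
    then have "(\<Sum>z\<in>E `` {x} - {p}. \<phi> z - \<phi> x) = (\<Sum>z\<in>E `` {x} - {p}. \<phi> y - \<phi> x)"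
      by (intro sum.cong) auto
    \<comment> \<open>All children of x carry the same value, so the increment into x is the
      outgoing increment times the number of children, which is at least 2. The outgoing increment
      would be shorter than the minimum.\<close>
    with split[OF e(1,2)] have eq: "\<phi> x - \<phi> p = real (card (E `` {x} - {p})) *\<^sub>R (\<phi> y - \<phi> x)"
      by (simp add: scaleR_conv_of_real sum_constant_scaleR)
    have c2: "2 \<le> real (card (E `` {x} - {p}))"
      using degree_ge[OF xV] adj_sym[OF e(1)] by (simp add: card_Diff_singleton)
    have ne': "\<phi> y \<noteq> \<phi> x" using eq e(4) by auto
    then have "norm (\<phi> x - \<phi> p) \<ge> 2 * norm (\<phi> y - \<phi> x)"
      unfolding eq norm_scaleR using c2 by (intro mult_right_mono) auto
    moreover have "(x, y) \<in> A" using y dy e ne' by (auto simp: A_def)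
    then have "norm (\<phi> p - \<phi> x) \<le> norm (\<phi> x - \<phi> y)"
      using fin px(2) Min_le[OF fin, of "norm (\<phi> x - \<phi> y)"] by force
    moreover have "0 < norm (\<phi> y - \<phi> x)" using ne' by simp
    ultimately show False
      using norm_minus_commute[of "\<phi> p" "\<phi> x"] norm_minus_commute[of "\<phi> y" "\<phi> x"] by linarith
  qed
  then have far: "\<phi> x = \<phi> p" if "(p, x) \<in> E" "d v x = Suc (d v p)" "m0 \<le> d v x" for p x
    using that unfolding A_def by blast
  \<comment> \<open>Induction inwards: if all increments out of x vanish, harmonicity at x makes the
    increment into x vanish as well.\<close>
  have near: "\<forall>p x. (p, x) \<in> E \<longrightarrow> d v x = Suc (d v p) \<longrightarrow> m0 \<le> d v x + j \<longrightarrow> \<phi> x = \<phi> p" for j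
  proof (induction j)
    case 0
    then show ?case using far by simp
  next
    case (Suc j)
    show ?case
    proof (intro allI impI)
      fix p x assume e: "(p, x) \<in> E" "d v x = Suc (d v p)" "m0 \<le> d v x + Suc j"
      have "(\<Sum>y\<in>E `` {x} - {p}. \<phi> y - \<phi> x) = 0"
      proof (rule sum.neutral, rule ballI)
        fix y assume y: "y \<in> E `` {x} - {p}"
        then show "\<phi> y - \<phi> x = 0"
          using Suc[rule_format, of x y] child[OF e(1,2) y] e(3) y by simp
      qed
      then show "\<phi> x = \<phi> p" using split[OF e(1,2)] by simp
    qed
  qed
  have "\<phi> x = \<phi> v" if "x \<in> V" for x
    using that
  proof (induction "d v x" arbitrary: x)
    case 0
    then show ?case using dist_0_iff[OF assms(2)] by simp
  next
    case (Suc n)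
    obtain p where p: "(x, p) \<in> E" "d v p = n" using exists_pred[OF assms(2) Suc.prems] Suc.hyps(2) by metis
    have "\<phi> p = \<phi> v" using Suc.hyps(1)[of p] adj_verts(2)[OF p(1)] p(2) by simp
    moreover have "d v x = Suc (d v p)" using p(2) Suc.hyps(2) by simp
    then have "\<phi> x = \<phi> p" using near[of m0, rule_format, OF adj_sym[OF p(1)]] by simp
    ultimately show ?case by simp
  qed
  then show ?thesis using assms(3) by blast
qed

end
end

section \<open>Mass transport\<close>

text \<open>\<open>finite_transporter\<close> is properness of the action on the discrete set X, and
  \<open>orbits_meet_R\<close> is its cocompactness.\<close>

locale cocompact_action =
  fixes \<Gamma> :: "('g, 'm) monoid_scheme" (structure)
    and X :: "'x set" and act :: "'g \<Rightarrow> 'x \<Rightarrow> 'x" and R :: "'x set"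
  assumes group: "group \<Gamma>"
    and act_closed: "g \<in> carrier \<Gamma> \<Longrightarrow> x \<in> X \<Longrightarrow> act g x \<in> X"
    and act_one: "x \<in> X \<Longrightarrow> act \<one> x = x"
    and act_mult: "g \<in> carrier \<Gamma> \<Longrightarrow> h \<in> carrier \<Gamma> \<Longrightarrow> x \<in> X \<Longrightarrow> act (g \<otimes> h) x = act g (act h x)"
    and finite_R: "finite R" and R_subset: "R \<subseteq> X"
    and finite_transporter: "x \<in> X \<Longrightarrow> finite {g \<in> carrier \<Gamma>. x \<in> act g ` R}"
    and orbits_meet_R: "x \<in> X \<Longrightarrow> \<exists>g\<in>carrier \<Gamma>. x \<in> act g ` R"
begin

sublocale group \<Gamma> by (rule group)

lemma act_inv: "g \<in> carrier \<Gamma> \<Longrightarrow> x \<in> X \<Longrightarrow> act (inv g) (act g x) = x"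
  "g \<in> carrier \<Gamma> \<Longrightarrow> x \<in> X \<Longrightarrow> act g (act (inv g) x) = x"
  by (simp_all add: act_mult[symmetric] act_one)

definition transporter :: "'x \<Rightarrow> 'g set" where
  "transporter x = {g \<in> carrier \<Gamma>. x \<in> act g ` R}"

text \<open>
  The set \<open>R\<close> may meet an orbit several times; this weight, together with summation over
  \<open>R\<close>, nevertheless gives the integral over the quotient.
\<close>

definition wt :: "'x \<Rightarrow> real" where
  "wt x = 1 / real (card (transporter x))"

lemma transporter: "x \<in> X \<Longrightarrow> finite (transporter x)" "x \<in> X \<Longrightarrow> transporter x \<noteq> {}"
  using finite_transporter[of x] orbits_meet_R[of x] unfolding transporter_def by blast+

lemma wt_pos: "x \<in> X \<Longrightarrow> 0 < wt x"
  using transporter by (simp add: wt_def card_gt_0_iff)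

lemma transporter_act:
  assumes "g \<in> carrier \<Gamma>" "x \<in> X"
  shows "transporter (act g x) = (\<lambda>k. g \<otimes> k) ` transporter x"
proof
  show "(\<lambda>k. g \<otimes> k) ` transporter x \<subseteq> transporter (act g x)"
    using assms R_subset by (auto simp: transporter_def act_mult subset_iff)
  show "transporter (act g x) \<subseteq> (\<lambda>k. g \<otimes> k) ` transporter x"
  proof
    fix k assume "k \<in> transporter (act g x)"
    then obtain r where k: "k \<in> carrier \<Gamma>" "r \<in> R" "act k r = act g x" by (auto simp: transporter_def)
    then have r: "r \<in> X" using R_subset by blast
    have "act (inv g \<otimes> k) r = x" using k(1,3) assms r by (simp add: act_mult act_inv)
    then have "inv g \<otimes> k \<in> transporter x" using k assms by (auto simp: transporter_def)
    moreover have "k = g \<otimes> (inv g \<otimes> k)" using assms k by (simp add: m_assoc[symmetric])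
    ultimately show "k \<in> (\<lambda>k. g \<otimes> k) ` transporter x" by (rule rev_image_eqI)
  qed
qed

lemma wt_act:
  assumes "g \<in> carrier \<Gamma>" "x \<in> X" shows "wt (act g x) = wt x"
proof -
  have "inj_on (\<lambda>k. g \<otimes> k) (transporter x)"
    using assms by (auto simp: inj_on_def transporter_def)
  then show ?thesis by (simp add: wt_def transporter_act[OF assms] card_image)
qed

lemma sum_transporter: "x \<in> X \<Longrightarrow> (\<Sum>g\<in>transporter x. wt x * c) = c"
  using transporter[of x] by (simp add: wt_def)

text \<open>Each neighbour y is distributed over all ways of writing it as \<open>act g z\<close>
  with z in R; the weight of z compensates for their number.\<close>

lemma sum_edges_unfold:
  fixes F :: "'x \<Rightarrow> real"
  assumes "finite (E `` {x})" "E `` {x} \<subseteq> X"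
  shows "(\<Sum>y\<in>E `` {x}. F y) =
    (\<Sum>z\<in>R. \<Sum>g\<in>{g \<in> carrier \<Gamma>. (x, act g z) \<in> E}. wt z * F (act g z))"
    and "\<And>z. z \<in> R \<Longrightarrow> finite {g \<in> carrier \<Gamma>. (x, act g z) \<in> E}"
proof -
  show fin: "finite {g \<in> carrier \<Gamma>. (x, act g z) \<in> E}" if "z \<in> R" for z
  proof (rule finite_subset)
    show "{g \<in> carrier \<Gamma>. (x, act g z) \<in> E} \<subseteq> (\<Union>y\<in>E `` {x}. transporter y)"
      using that by (auto simp: transporter_def)
    show "finite (\<Union>y\<in>E `` {x}. transporter y)" using assms transporter(1) by blast
  qed
  have "(\<Sum>y\<in>E `` {x}. F y) = (\<Sum>y\<in>E `` {x}. \<Sum>g\<in>transporter y. wt y * F y)"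
    using assms(2) by (intro sum.cong[OF refl] sum_transporter[symmetric]) blast
  also have "\<dots> = (\<Sum>(y, g)\<in>Sigma (E `` {x}) transporter. wt y * F y)"
    using assms transporter(1) by (intro sum.Sigma) blast+
  also have "\<dots> = (\<Sum>(z, g)\<in>Sigma R (\<lambda>z. {g \<in> carrier \<Gamma>. (x, act g z) \<in> E}). wt z * F (act g z))"
  proof (rule sum.reindex_bij_witness[of _ "\<lambda>(z, g). (act g z, g)" "\<lambda>(y, g). (act (inv g) y, g)"])
    fix p assume "p \<in> Sigma (E `` {x}) transporter"
    then obtain g r where p: "p = (act g r, g)" "(x, act g r) \<in> E" "g \<in> carrier \<Gamma>" "r \<in> R"
      by (auto simp: transporter_def)
    then have r: "r \<in> X" using R_subset by blast
    show "(case case p of (y, g) \<Rightarrow> (act (inv g) y, g) of (z, g) \<Rightarrow> (act g z, g)) = p"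
      using p r by (simp add: act_inv)
    show "(case p of (y, g) \<Rightarrow> (act (inv g) y, g)) \<in> Sigma R (\<lambda>z. {g \<in> carrier \<Gamma>. (x, act g z) \<in> E})"
      using p r by (simp add: act_inv)
    show "(case case p of (y, g) \<Rightarrow> (act (inv g) y, g) of (z, g) \<Rightarrow> wt z * F (act g z)) =
        (case p of (y, g) \<Rightarrow> wt y * F y)"
      using p r by (simp add: act_inv wt_act)
  next
    fix p assume "p \<in> Sigma R (\<lambda>z. {g \<in> carrier \<Gamma>. (x, act g z) \<in> E})"
    then obtain g z where p: "p = (z, g)" "(x, act g z) \<in> E" "g \<in> carrier \<Gamma>" "z \<in> R" by auto
    then have z: "z \<in> X" using R_subset by blast
    show "(case case p of (z, g) \<Rightarrow> (act g z, g) of (y, g) \<Rightarrow> (act (inv g) y, g)) = p"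
      using p z by (simp add: act_inv)
    show "(case p of (z, g) \<Rightarrow> (act g z, g)) \<in> Sigma (E `` {x}) transporter"
      using p by (auto simp: transporter_def)
  qed
  also have "\<dots> = (\<Sum>z\<in>R. \<Sum>g\<in>{g \<in> carrier \<Gamma>. (x, act g z) \<in> E}. wt z * F (act g z))"
    using fin by (intro sum.Sigma[symmetric] finite_R) auto
  finally show "(\<Sum>y\<in>E `` {x}. F y) =
    (\<Sum>z\<in>R. \<Sum>g\<in>{g \<in> carrier \<Gamma>. (x, act g z) \<in> E}. wt z * F (act g z))" .
qed

text \<open>After unfolding, both sides are sums over pairs x, z in R and group elements g.
  Replacing g by its inverse and using invariance of F exchanges them.\<close>

lemma mass_transport:
  fixes F :: "'x \<Rightarrow> 'x \<Rightarrow> real"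
  assumes E: "E \<subseteq> X \<times> X" "\<And>x y. (x, y) \<in> E \<Longrightarrow> (y, x) \<in> E" "\<And>x. x \<in> X \<Longrightarrow> finite (E `` {x})"
    "\<And>g x y. g \<in> carrier \<Gamma> \<Longrightarrow> (x, y) \<in> E \<Longrightarrow> (act g x, act g y) \<in> E"
    and F: "\<And>g x y. g \<in> carrier \<Gamma> \<Longrightarrow> (x, y) \<in> E \<Longrightarrow> F (act g x) (act g y) = F x y"
  shows "(\<Sum>x\<in>R. wt x * (\<Sum>y\<in>E `` {x}. F x y)) = (\<Sum>x\<in>R. wt x * (\<Sum>y\<in>E `` {x}. F y x))"
proof -
  define K where "K = (\<lambda>x z. {g \<in> carrier \<Gamma>. (x, act g z) \<in> E})"
  have RX: "x \<in> X" if "x \<in> R" for x using that R_subset by blast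
  have fin: "finite (E `` {x})" "E `` {x} \<subseteq> X" if "x \<in> R" for x
    using E(1) E(3)[OF RX[OF that]] by auto
  have swap: "(\<Sum>g\<in>K z x. F (act g x) z) = (\<Sum>g\<in>K x z. F x (act g z))" if xz: "x \<in> R" "z \<in> R" for x z
  proof (rule sum.reindex_bij_witness[of _ "\<lambda>g. inv g" "\<lambda>g. inv g"])
    have flip: "inv g \<in> K a b \<and> F (act g a) b = F a (act (inv g) b)"
      if g: "g \<in> K b a" and ab: "a \<in> X" "b \<in> X" for g a b
    proof -
      have gc: "g \<in> carrier \<Gamma>" "(b, act g a) \<in> E" using g by (auto simp: K_def)
      have "(act (inv g) b, act (inv g) (act g a)) \<in> E" using E(4)[of "inv g", OF _ gc(2)] gc(1) by simp
      then have "(act (inv g) b, a) \<in> E" using act_inv(1) gc ab by simp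
      moreover have "F (act g a) b = F a (act (inv g) b)"
        using F[of "inv g", OF _ E(2)[OF gc(2)]] gc(1) ab by (simp add: act_inv)
      ultimately show ?thesis using E(2) gc(1) by (simp add: K_def)
    qed
    fix g
    show "inv (inv g) = g" "inv g \<in> K x z" if "g \<in> K z x" using that flip xz RX by (auto simp: K_def)
    show "inv (inv g) = g" "inv g \<in> K z x" if "g \<in> K x z" using that flip xz RX by (auto simp: K_def)
    show "F x (act (inv g) z) = F (act g x) z" if "g \<in> K z x"
      using that flip xz RX by simp
  qed
  have "(\<Sum>x\<in>R. wt x * (\<Sum>y\<in>E `` {x}. F x y)) =
      (\<Sum>x\<in>R. wt x * (\<Sum>z\<in>R. \<Sum>g\<in>K x z. wt z * F x (act g z)))"
    unfolding K_def using sum_edges_unfold(1)[OF fin] by (intro sum.cong refl) simp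
  also have "\<dots> = (\<Sum>x\<in>R. \<Sum>z\<in>R. wt x * (wt z * (\<Sum>g\<in>K x z. F x (act g z))))"
    by (simp add: sum_distrib_left)
  also have "\<dots> = (\<Sum>x\<in>R. \<Sum>z\<in>R. wt x * (wt z * (\<Sum>g\<in>K z x. F (act g x) z)))"
    by (rule sum.cong[OF refl], rule sum.cong[OF refl]) (simp add: swap)
  also have "\<dots> = (\<Sum>z\<in>R. \<Sum>x\<in>R. wt x * (wt z * (\<Sum>g\<in>K z x. F (act g x) z)))"
    by (rule sum.swap)
  also have "\<dots> = (\<Sum>z\<in>R. wt z * (\<Sum>x\<in>R. \<Sum>g\<in>K z x. wt x * F (act g x) z))"
    by (simp add: sum_distrib_left mult.left_commute)
  also have "\<dots> = (\<Sum>x\<in>R. wt x * (\<Sum>y\<in>E `` {x}. F y x))"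
    unfolding K_def using sum_edges_unfold(1)[OF fin] by (intro sum.cong refl) simp
  finally show ?thesis .
qed

end

section \<open>Actions that preserve the factors of a product\<close>

locale product_action =
  cocompact_action \<Gamma> "\<Pi>\<^sub>E i\<in>I. V i" "\<lambda>g x. \<lambda>i\<in>I. \<alpha> g i (x i)" R
  for \<Gamma> :: "('g, 'm) monoid_scheme" (structure)
    and I :: "'i set" and V :: "'i \<Rightarrow> 'v set" and \<alpha> :: "'g \<Rightarrow> 'i \<Rightarrow> 'v \<Rightarrow> 'v" and R :: "('i \<Rightarrow> 'v) set" +
  fixes E :: "'i \<Rightarrow> ('v \<times> 'v) set"
  assumes finite_I: "finite I"
    and E_verts: "i \<in> I \<Longrightarrow> E i \<subseteq> V i \<times> V i"
    and E_sym: "i \<in> I \<Longrightarrow> (a, b) \<in> E i \<Longrightarrow> (b, a) \<in> E i"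
    and E_finite: "i \<in> I \<Longrightarrow> a \<in> V i \<Longrightarrow> finite (E i `` {a})"
    and E_connected: "i \<in> I \<Longrightarrow> a \<in> V i \<Longrightarrow> b \<in> V i \<Longrightarrow> (a, b) \<in> (E i)\<^sup>*"
    and \<alpha>_verts: "g \<in> carrier \<Gamma> \<Longrightarrow> i \<in> I \<Longrightarrow> a \<in> V i \<Longrightarrow> \<alpha> g i a \<in> V i"
    and \<alpha>_inj: "g \<in> carrier \<Gamma> \<Longrightarrow> i \<in> I \<Longrightarrow> inj_on (\<alpha> g i) (V i)"
    and \<alpha>_nbrs: "g \<in> carrier \<Gamma> \<Longrightarrow> i \<in> I \<Longrightarrow> a \<in> V i \<Longrightarrow> E i `` {\<alpha> g i a} = \<alpha> g i ` (E i `` {a})"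
begin

abbreviation "X \<equiv> \<Pi>\<^sub>E i\<in>I. V i"
abbreviation "act \<equiv> \<lambda>g x. \<lambda>i\<in>I. \<alpha> g i (x i)"

lemma X_upd: "x \<in> X \<Longrightarrow> i \<in> I \<Longrightarrow> a \<in> V i \<Longrightarrow> x(i := a) \<in> X"
  by (auto simp: PiE_def Pi_def extensional_def)

lemma X_nth: "x \<in> X \<Longrightarrow> i \<in> I \<Longrightarrow> x i \<in> V i"
  by auto

lemma E_in: "i \<in> I \<Longrightarrow> (a, b) \<in> E i \<Longrightarrow> b \<in> V i"
  using E_verts by blast

lemma act_upd: "i \<in> I \<Longrightarrow> act g (x(i := a)) = (act g x)(i := \<alpha> g i a)"
  by (auto simp: fun_eq_iff)

lemma sum_nbrs_act:
  assumes "g \<in> carrier \<Gamma>" "i \<in> I" "x \<in> X"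
  shows "(\<Sum>b\<in>E i `` {act g x i}. f b) = (\<Sum>b\<in>E i `` {x i}. f (\<alpha> g i b))"
proof -
  have "E i `` {act g x i} = \<alpha> g i ` (E i `` {x i})"
    using \<alpha>_nbrs[OF assms(1,2) X_nth[OF assms(3,2)]] assms(2) by simp
  moreover have "inj_on (\<alpha> g i) (E i `` {x i})"
    using \<alpha>_inj[OF assms(1,2)] by (rule inj_on_subset) (use E_in[OF assms(2)] in blast)
  ultimately show ?thesis by (simp add: sum.reindex)
qed

text \<open>Mass transport on the graph whose edges change the coordinate j only. Distinct b give
  distinct vertices, so its edges at x can be summed over b.\<close>

lemma mass_transport_coordinate:
  fixes F :: "('i \<Rightarrow> 'v) \<Rightarrow> ('i \<Rightarrow> 'v) \<Rightarrow> real"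
  assumes "j \<in> I"
    and F: "\<And>g x b. g \<in> carrier \<Gamma> \<Longrightarrow> x \<in> X \<Longrightarrow> b \<in> E j `` {x j} \<Longrightarrow>
      F (act g x) (act g (x(j := b))) = F x (x(j := b))"
  shows "(\<Sum>x\<in>R. wt x * (\<Sum>b\<in>E j `` {x j}. F x (x(j := b)))) =
    (\<Sum>x\<in>R. wt x * (\<Sum>b\<in>E j `` {x j}. F (x(j := b)) x))"
proof -
  define D where "D = {(x, x(j := b)) | x b. x \<in> X \<and> (x j, b) \<in> E j}"
  have im: "D `` {x} = (\<lambda>b. x(j := b)) ` (E j `` {x j})" if "x \<in> X" for x
    using that by (auto simp: D_def)
  have inj: "inj_on (\<lambda>b. x(j := b)) A" for x :: "'i \<Rightarrow> 'v" and A
    by (auto simp: inj_on_def dest: fun_upd_eqD)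
  have sums: "(\<Sum>y\<in>D `` {x}. f y) = (\<Sum>b\<in>E j `` {x j}. f (x(j := b)))" if "x \<in> R" for x and f :: "_ \<Rightarrow> real"
    using that R_subset im[of x] inj by (auto simp: sum.reindex)
  have "(\<Sum>x\<in>R. wt x * (\<Sum>y\<in>D `` {x}. F x y)) = (\<Sum>x\<in>R. wt x * (\<Sum>y\<in>D `` {x}. F y x))"
  proof (rule mass_transport)
    show "D \<subseteq> X \<times> X" using X_upd[OF _ assms(1)] E_in[OF assms(1)] unfolding D_def by blast
    show "(y, x) \<in> D" if xy: "(x, y) \<in> D" for x y
    proof -
      obtain b where b: "y = x(j := b)" "x \<in> X" "(x j, b) \<in> E j" using xy unfolding D_def by blast
      have "y \<in> X" "(y j, x j) \<in> E j" "x = y(j := x j)"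
        using b X_upd[OF b(2) assms(1) E_in[OF assms(1) b(3)]] E_sym[OF assms(1) b(3)] by auto
      then show ?thesis unfolding D_def by blast
    qed
    show "finite (D `` {x})" if "x \<in> X" for x
      unfolding im[OF that] using E_finite[OF assms(1) X_nth[OF that assms(1)]] by (rule finite_imageI)
    fix g x y assume g: "g \<in> carrier \<Gamma>" and xy: "(x, y) \<in> D"
    obtain b where b: "y = x(j := b)" "x \<in> X" "(x j, b) \<in> E j" using xy unfolding D_def by blast
    have "(act g x j, \<alpha> g j b) \<in> E j"
      using \<alpha>_nbrs[OF g assms(1) X_nth[OF b(2) assms(1)]] b(3) assms(1) by auto
    moreover have "act g y = (act g x)(j := \<alpha> g j b)" unfolding b(1) by (rule act_upd[OF assms(1)])
    ultimately show "(act g x, act g y) \<in> D"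
      using act_closed[OF g b(2)] unfolding D_def by blast
    show "F (act g x) (act g y) = F x y" unfolding b(1) using F[OF g b(2)] b(3) by blast
  qed
  moreover have "(\<Sum>x\<in>R. wt x * (\<Sum>y\<in>D `` {x}. F x y)) = (\<Sum>x\<in>R. wt x * (\<Sum>b\<in>E j `` {x j}. F x (x(j := b))))"
    by (intro sum.cong refl) (simp add: sums)
  moreover have "(\<Sum>x\<in>R. wt x * (\<Sum>y\<in>D `` {x}. F y x)) = (\<Sum>x\<in>R. wt x * (\<Sum>b\<in>E j `` {x j}. F (x(j := b)) x))"
    by (intro sum.cong refl) (simp add: sums)
  ultimately show ?thesis by simp
qed

end

section \<open>Splitting of harmonic functions on a product\<close>

context product_action
begin

context
  fixes h :: "('i \<Rightarrow> 'v) \<Rightarrow> 'w :: real_inner"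
  assumes gram: "\<And>g x y x' y'. g \<in> carrier \<Gamma> \<Longrightarrow> x \<in> X \<Longrightarrow> y \<in> X \<Longrightarrow> x' \<in> X \<Longrightarrow> y' \<in> X \<Longrightarrow>
      inner (h (act g x) - h (act g y)) (h (act g x') - h (act g y')) = inner (h x - h y) (h x' - h y')"
    and harmonic: "\<And>x. x \<in> X \<Longrightarrow> (\<Sum>j\<in>I. \<Sum>a\<in>E j `` {x j}. h (x(j := a)) - h x) = 0"
begin

lemma norm_lin_comb_act:
  assumes "g \<in> carrier \<Gamma>" "p \<in> X" "q \<in> X" "r \<in> X" "s \<in> X"
  shows "norm ((h (act g p) - h (act g q)) - (h (act g r) - h (act g s))) = norm ((h p - h q) - (h r - h s))"
  using gram[OF assms(1,2,3,2,3)] gram[OF assms(1,2,3,4,5)] gram[OF assms(1,4,5,4,5)] gram[OF assms(1,4,5,2,3)]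
  by (simp only: norm_eq_sqrt_inner inner_diff_left[of "_ - _"] inner_diff_right[of _ "_ - _"])

text \<open>
  The two Laplacians, in the coordinate \<open>i\<close> and in the remaining ones, are orthogonal up to
  a non-negative term: applying mass transport in both directions, their pairing becomes
  a quarter of the energy of the mixed second differences of \<open>h\<close>.
\<close>

lemma laplacian_pairing:
  assumes "i \<in> I"
  shows "4 * (\<Sum>x\<in>R. wt x * inner (\<Sum>a\<in>E i `` {x i}. h (x(i := a)) - h x)
      (\<Sum>j\<in>I - {i}. \<Sum>b\<in>E j `` {x j}. h (x(j := b)) - h x)) =
    (\<Sum>x\<in>R. wt x * (\<Sum>a\<in>E i `` {x i}. \<Sum>j\<in>I - {i}. \<Sum>b\<in>E j `` {x j}.
      (norm ((h (x(i := a, j := b)) - h (x(j := b))) - (h (x(i := a)) - h x)))\<^sup>2))"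
proof -
  define S where "S = (\<lambda>\<Phi>. \<Sum>x\<in>R. wt x * (\<Sum>a\<in>E i `` {x i}. \<Sum>j\<in>I - {i}. \<Sum>b\<in>E j `` {x j}. (\<Phi> x a j b :: real)))"
  define invariant where "invariant = (\<lambda>\<Phi>. \<forall>g\<in>carrier \<Gamma>. \<forall>x\<in>X. \<forall>a\<in>E i `` {x i}. \<forall>j\<in>I - {i}. \<forall>b\<in>E j `` {x j}.
      (\<Phi> (act g x) (\<alpha> g i a) j (\<alpha> g j b) :: real) = \<Phi> x a j b)"
  \<comment> \<open>\<open>TA\<close> and \<open>TB\<close> evaluate the same expression from the
    other end of the i-edge and of the j-edge. Mass transport says that neither changes the sum S of
    an invariant expression.\<close>
  define TA where "TA = (\<lambda>(\<Phi> :: ('i \<Rightarrow> 'v) \<Rightarrow> 'v \<Rightarrow> 'i \<Rightarrow> 'v \<Rightarrow> real) x a j b. \<Phi> (x(i := a)) (x i) j b)"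
  define TB where "TB = (\<lambda>(\<Phi> :: ('i \<Rightarrow> 'v) \<Rightarrow> 'v \<Rightarrow> 'i \<Rightarrow> 'v \<Rightarrow> real) x a j b. \<Phi> (x(j := b)) a j (x j))"
  have STA: "S (TA \<Phi>) = S \<Phi>" if inv: "invariant \<Phi>" for \<Phi>
  proof -
    define F where "F = (\<lambda>x y. \<Sum>j\<in>I - {i}. \<Sum>b\<in>E j `` {x j}. \<Phi> x (y i) j b)"
    have "(\<Sum>x\<in>R. wt x * (\<Sum>a\<in>E i `` {x i}. F x (x(i := a)))) = (\<Sum>x\<in>R. wt x * (\<Sum>a\<in>E i `` {x i}. F (x(i := a)) x))"
    proof (rule mass_transport_coordinate[OF assms])
      fix g x a assume g: "g \<in> carrier \<Gamma>" and x: "x \<in> X" and a: "a \<in> E i `` {x i}"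
      have "F (act g x) (act g (x(i := a))) = (\<Sum>j\<in>I - {i}. \<Sum>b\<in>E j `` {x j}. \<Phi> (act g x) (\<alpha> g i a) j (\<alpha> g j b))"
        unfolding F_def act_upd[OF assms]
        by (rule sum.cong[OF refl]) (simp only: sum_nbrs_act[OF g _ x] fun_upd_same DiffD1)
      also have "\<dots> = F x (x(i := a))"
        unfolding F_def
        by (rule sum.cong[OF refl], rule sum.cong[OF refl])
          (use inv g x a in \<open>simp only: invariant_def fun_upd_same\<close>)
      finally show "F (act g x) (act g (x(i := a))) = F x (x(i := a))" .
    qed
    moreover have "(\<Sum>x\<in>R. wt x * (\<Sum>a\<in>E i `` {x i}. F x (x(i := a)))) = S \<Phi>"
      by (simp add: S_def F_def)
    moreover have "(\<Sum>x\<in>R. wt x * (\<Sum>a\<in>E i `` {x i}. F (x(i := a)) x)) = S (TA \<Phi>)"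
      by (simp add: S_def F_def TA_def)
    ultimately show ?thesis by simp
  qed
  have STB: "S (TB \<Phi>) = S \<Phi>" if inv: "invariant \<Phi>" for \<Phi>
  proof -
    define F where "F = (\<lambda>j x y. \<Sum>a\<in>E i `` {x i}. \<Phi> x a j (y j))"
    have F: "(\<Sum>x\<in>R. wt x * (\<Sum>b\<in>E j `` {x j}. F j x (x(j := b)))) = (\<Sum>x\<in>R. wt x * (\<Sum>b\<in>E j `` {x j}. F j (x(j := b)) x))"
      if j: "j \<in> I - {i}" for j
    proof (rule mass_transport_coordinate)
      show jI: "j \<in> I" using j by simp
      fix g x b assume g: "g \<in> carrier \<Gamma>" and x: "x \<in> X" and b: "b \<in> E j `` {x j}"
      have "F j (act g x) (act g (x(j := b))) = (\<Sum>a\<in>E i `` {x i}. \<Phi> (act g x) (\<alpha> g i a) j (\<alpha> g j b))"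
        unfolding F_def act_upd[OF jI] by (simp only: sum_nbrs_act[OF g assms x] fun_upd_same)
      also have "\<dots> = F j x (x(j := b))"
        unfolding F_def
        by (rule sum.cong[OF refl]) (use inv g x b j in \<open>simp only: invariant_def fun_upd_same\<close>)
      finally show "F j (act g x) (act g (x(j := b))) = F j x (x(j := b))" .
    qed
    have sw: "(\<Sum>a\<in>A. \<Sum>j\<in>J. \<Sum>b\<in>B j. f a j b) = (\<Sum>j\<in>J. \<Sum>b\<in>B j. \<Sum>a\<in>A. f a j b)"
      for A and J :: "'i set" and B :: "'i \<Rightarrow> 'v set" and f :: "'v \<Rightarrow> 'i \<Rightarrow> 'v \<Rightarrow> real"
      by (subst sum.swap) (rule sum.cong[OF refl], rule sum.swap)
    have "S \<Phi> = (\<Sum>x\<in>R. wt x * (\<Sum>j\<in>I - {i}. \<Sum>b\<in>E j `` {x j}. F j x (x(j := b))))"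
      unfolding S_def sw F_def by simp
    also have "\<dots> = (\<Sum>j\<in>I - {i}. \<Sum>x\<in>R. wt x * (\<Sum>b\<in>E j `` {x j}. F j x (x(j := b))))"
      unfolding sum_distrib_left[of _ _ "I - {i}"] by (rule sum.swap)
    also have "\<dots> = (\<Sum>j\<in>I - {i}. \<Sum>x\<in>R. wt x * (\<Sum>b\<in>E j `` {x j}. F j (x(j := b)) x))"
      by (rule sum.cong[OF refl F])
    also have "\<dots> = (\<Sum>x\<in>R. wt x * (\<Sum>j\<in>I - {i}. \<Sum>b\<in>E j `` {x j}. F j (x(j := b)) x))"
      unfolding sum_distrib_left[of _ _ "I - {i}"] by (rule sum.swap)
    also have "\<dots> = S (TB \<Phi>)"
    proof -
      have "F j (x(j := b)) x = (\<Sum>a\<in>E i `` {x i}. TB \<Phi> x a j b)" if "j \<in> I - {i}" for j x b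
        using that by (auto simp: F_def TB_def)
      then show ?thesis unfolding S_def sw by simp
    qed
    finally show ?thesis by simp
  qed
  define \<Phi> where "\<Phi> = (\<lambda>x a j b. inner (h (x(i := a)) - h x) (h (x(j := b)) - h x))"
  have upd: "x(i := a) \<in> X" "x(j := b) \<in> X" "x(i := a, j := b) \<in> X" "x(j := b, i := a) \<in> X"
    if "x \<in> X" "a \<in> E i `` {x i}" "j \<in> I - {i}" "b \<in> E j `` {x j}" for x a j b
  proof -
    have *: "a \<in> V i" "j \<in> I" "b \<in> V j" using that E_in[OF assms, of "x i" a] E_in[of j "x j" b] by simp_all
    show 1: "x(i := a) \<in> X" and 2: "x(j := b) \<in> X"
      using X_upd[OF that(1)] * assms by blast+
    show "x(i := a, j := b) \<in> X" "x(j := b, i := a) \<in> X"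
      using X_upd[OF 1 *(2,3)] X_upd[OF 2 assms *(1)] .
  qed
  have inv1: "invariant \<Phi>" unfolding invariant_def
  proof (intro ballI)
    fix g x a j b assume *: "g \<in> carrier \<Gamma>" "x \<in> X" "a \<in> E i `` {x i}" "j \<in> I - {i}" "b \<in> E j `` {x j}"
    have jI: "j \<in> I" using * by simp
    show "\<Phi> (act g x) (\<alpha> g i a) j (\<alpha> g j b) = \<Phi> x a j b"
      unfolding \<Phi>_def act_upd[OF assms, symmetric] act_upd[OF jI, symmetric]
      using *(1,2) upd[OF *(2-5)] by - (rule gram)
  qed
  have inv2: "invariant (TA \<Phi>)" unfolding invariant_def
  proof (intro ballI)
    fix g x a j b assume *: "g \<in> carrier \<Gamma>" "x \<in> X" "a \<in> E i `` {x i}" "j \<in> I - {i}" "b \<in> E j `` {x j}"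
    have jI: "j \<in> I" "act g x i = \<alpha> g i (x i)" using * assms by simp_all
    show "TA \<Phi> (act g x) (\<alpha> g i a) j (\<alpha> g j b) = TA \<Phi> x a j b"
      unfolding \<Phi>_def TA_def jI(2) act_upd[OF assms, symmetric] act_upd[OF jI(1), symmetric] fun_upd_upd fun_upd_triv
      using *(1,2) upd[OF *(2-5)] by - (rule gram)
  qed
  have inv3: "invariant (TB \<Phi>)" unfolding invariant_def
  proof (intro ballI)
    fix g x a j b assume *: "g \<in> carrier \<Gamma>" "x \<in> X" "a \<in> E i `` {x i}" "j \<in> I - {i}" "b \<in> E j `` {x j}"
    have jI: "j \<in> I" "act g x j = \<alpha> g j (x j)" using * assms by simp_all
    show "TB \<Phi> (act g x) (\<alpha> g i a) j (\<alpha> g j b) = TB \<Phi> x a j b"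
      unfolding \<Phi>_def TB_def jI(2) act_upd[OF assms, symmetric] act_upd[OF jI(1), symmetric] fun_upd_upd fun_upd_triv
      using *(1,2) upd[OF *(2-5)] by - (rule gram)
  qed
  \<comment> \<open>The four terms are the inner products of the two sides meeting at each corner of
    the square spanned by a and b. Opposite sides differ by the mixed difference m, in both
    directions, and the terms add up to the inner product of m with itself.\<close>
  have sum4: "\<Phi> x a j b + TA \<Phi> x a j b + TB \<Phi> x a j b + TA (TB \<Phi>) x a j b =
      (norm ((h (x(i := a, j := b)) - h (x(j := b))) - (h (x(i := a)) - h x)))\<^sup>2"
    if "j \<in> I - {i}" for x a j b
  proof -
    have ij: "x(j := b, i := a) = x(i := a, j := b)" using that by (intro fun_upd_twist) auto
    have "TA \<Phi> x a j b = inner (h x - h (x(i := a))) (h (x(i := a, j := b)) - h (x(i := a)))"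
      by (simp add: TA_def \<Phi>_def)
    moreover have "TB \<Phi> x a j b = inner (h (x(i := a, j := b)) - h (x(j := b))) (h x - h (x(j := b)))"
      using ij by (simp add: TB_def \<Phi>_def)
    moreover have "TA (TB \<Phi>) x a j b = inner (h (x(j := b)) - h (x(i := a, j := b))) (h (x(i := a)) - h (x(i := a, j := b)))"
    proof -
      have "x(i := a, j := b, i := x i) = x(j := b)" "x(i := a, j := b, j := (x(i := a)) j) = x(i := a)"
        using that by (auto simp: fun_eq_iff)
      then show ?thesis by (simp only: TA_def TB_def \<Phi>_def)
    qed
    ultimately show ?thesis
      unfolding \<Phi>_def power2_norm_eq_inner by (simp add: algebra_simps inner_commute)
  qed
  have "S \<Phi> + S (TA \<Phi>) + S (TB \<Phi>) + S (TA (TB \<Phi>)) =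
      (\<Sum>x\<in>R. wt x * (\<Sum>a\<in>E i `` {x i}. \<Sum>j\<in>I - {i}. \<Sum>b\<in>E j `` {x j}.
        \<Phi> x a j b + TA \<Phi> x a j b + TB \<Phi> x a j b + TA (TB \<Phi>) x a j b))"
    unfolding S_def by (simp only: sum.distrib distrib_left)
  also have "\<dots> = (\<Sum>x\<in>R. wt x * (\<Sum>a\<in>E i `` {x i}. \<Sum>j\<in>I - {i}. \<Sum>b\<in>E j `` {x j}.
      (norm ((h (x(i := a, j := b)) - h (x(j := b))) - (h (x(i := a)) - h x)))\<^sup>2))"
    by (simp add: sum4)
  finally have "4 * S \<Phi> = \<dots>"
    using STA[OF inv1] STB[OF inv1] STA[OF inv3] by simp
  moreover have "S \<Phi> = (\<Sum>x\<in>R. wt x * inner (\<Sum>a\<in>E i `` {x i}. h (x(i := a)) - h x)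
      (\<Sum>j\<in>I - {i}. \<Sum>b\<in>E j `` {x j}. h (x(j := b)) - h x))"
    unfolding S_def \<Phi>_def by (simp only: inner_sum_left) (simp only: inner_sum_right)
  ultimately show ?thesis by simp
qed

text \<open>By harmonicity the second Laplacian is minus the first, so their pairing is at most 0;
  by \<open>laplacian_pairing\<close> it is at least 0. Hence the coordinate Laplacian and all mixed
  differences vanish over R, and the invariance of Gram matrices spreads this to X.\<close>

lemma splitting:
  assumes "i \<in> I" "x \<in> X"
  shows "(\<Sum>a\<in>E i `` {x i}. h (x(i := a)) - h x) = 0"
    and "a \<in> E i `` {x i} \<Longrightarrow> j \<in> I - {i} \<Longrightarrow> b \<in> E j `` {x j} \<Longrightarrow>
      h (x(i := a, j := b)) - h (x(j := b)) = h (x(i := a)) - h x"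
proof -
  define gA where "gA = (\<lambda>x. \<Sum>a\<in>E i `` {x i}. h (x(i := a)) - h x)"
  define gB where "gB = (\<lambda>x. \<Sum>j\<in>I - {i}. \<Sum>b\<in>E j `` {x j}. h (x(j := b)) - h x)"
  define m where "m = (\<lambda>x a j b. (h (x(i := a, j := b)) - h (x(j := b))) - (h (x(i := a)) - h x))"
  define M where "M = (\<lambda>x. \<Sum>a\<in>E i `` {x i}. \<Sum>j\<in>I - {i}. \<Sum>b\<in>E j `` {x j}. (norm (m x a j b))\<^sup>2)"
  have RX: "x \<in> X" if "x \<in> R" for x using that R_subset by blast
  have M_pos: "0 \<le> M x" for x unfolding M_def by (intro sum_nonneg) simp
  have gAB: "gA x + gB x = 0" if "x \<in> X" for x
    using harmonic[OF that] sum.remove[OF finite_I assms(1), of "\<lambda>j. \<Sum>a\<in>E j `` {x j}. h (x(j := a)) - h x"]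
    by (simp add: gA_def gB_def)
  \<comment> \<open>The coefficients are chosen so that the pairing identity turns the left side, a
    sum of nonnegative terms, into a sum whose terms cancel by \<open>gB = - gA\<close>.\<close>
  have "(\<Sum>x\<in>R. wt x * (2 * (norm (gA x))\<^sup>2 + M x / 2)) =
      (\<Sum>x\<in>R. wt x * (2 * (norm (gA x))\<^sup>2 + 2 * inner (gA x) (gB x)))"
  proof -
    have "4 * (\<Sum>x\<in>R. wt x * inner (gA x) (gB x)) = (\<Sum>x\<in>R. wt x * M x)"
      using laplacian_pairing[OF assms(1)] by (simp only: gA_def gB_def M_def m_def)
    then have "(\<Sum>x\<in>R. wt x * (M x / 2)) = (\<Sum>x\<in>R. wt x * (2 * inner (gA x) (gB x)))"
      by (simp add: sum_divide_distrib[symmetric] sum_distrib_left[symmetric] mult.left_commute)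
    then show ?thesis by (simp add: distrib_left sum.distrib)
  qed
  also have "\<dots> = 0"
  proof (intro sum.neutral ballI)
    fix x assume "x \<in> R"
    then have "gB x = - gA x" using gAB[OF RX] by (simp add: eq_neg_iff_add_eq_0 add.commute)
    then show "wt x * (2 * (norm (gA x))\<^sup>2 + 2 * inner (gA x) (gB x)) = 0"
      by (simp add: power2_norm_eq_inner)
  qed
  finally have *: "\<forall>x\<in>R. wt x * (2 * (norm (gA x))\<^sup>2 + M x / 2) = 0"
    using RX wt_pos M_pos
    by (subst (asm) sum_nonneg_eq_0_iff) (auto intro!: mult_nonneg_nonneg add_nonneg_nonneg simp: finite_R less_imp_le)
  have zero: "gA x = 0 \<and> M x = 0" if "x \<in> R" for x
  proof -
    have "2 * (norm (gA x))\<^sup>2 + M x / 2 = 0" using * that wt_pos[OF RX[OF that]] by auto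
    then have "(norm (gA x))\<^sup>2 = 0" "M x = 0"
      using M_pos[of x] zero_le_power2[of "norm (gA x)"] by linarith+
    then show ?thesis by simp
  qed
  obtain g r where gr: "g \<in> carrier \<Gamma>" "r \<in> R" "x = act g r" using orbits_meet_R[OF assms(2)] by blast
  note rX = RX[OF gr(2)]
  have xi: "x i = \<alpha> g i (r i)" using gr(3) assms(1) by simp
  show "(\<Sum>a\<in>E i `` {x i}. h (x(i := a)) - h x) = 0"
  proof -
    have upd: "r(i := a) \<in> X" if "a \<in> E i `` {r i}" for a
      using that E_in[OF assms(1)] X_upd[OF rX assms(1)] by blast
    have gA_x: "gA x = (\<Sum>a\<in>E i `` {r i}. h (act g (r(i := a))) - h (act g r))"
      unfolding gA_def gr(3) sum_nbrs_act[OF gr(1) assms(1) rX] act_upd[OF assms(1)] ..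
    have expand: "inner (\<Sum>a\<in>A. f a) (\<Sum>b\<in>A. f b) = (\<Sum>a\<in>A. \<Sum>b\<in>A. inner (f a) (f b))"
      for A and f :: "'v \<Rightarrow> 'w"
      by (simp only: inner_sum_left) (simp only: inner_sum_right)
    have "inner (gA x) (gA x) = (\<Sum>a\<in>E i `` {r i}. \<Sum>b\<in>E i `` {r i}. inner (h (r(i := a)) - h r) (h (r(i := b)) - h r))"
      unfolding gA_x expand
      by (intro sum.cong[OF refl] gram gr(1) rX upd)
    also have "\<dots> = inner (gA r) (gA r)" by (simp only: gA_def expand)
    finally show ?thesis using zero[OF gr(2)] by (simp add: gA_def)
  qed
  assume a: "a \<in> E i `` {x i}" and j: "j \<in> I - {i}" and b: "b \<in> E j `` {x j}"
  have jI: "j \<in> I" using j by simp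
  obtain a' where a': "a' \<in> E i `` {r i}" "a = \<alpha> g i a'"
    using a \<alpha>_nbrs[OF gr(1) assms(1) X_nth[OF rX assms(1)]] xi by auto
  obtain b' where b': "b' \<in> E j `` {r j}" "b = \<alpha> g j b'"
    using b \<alpha>_nbrs[OF gr(1) jI X_nth[OF rX jI]] gr(3) jI by auto
  have "a' \<in> V i" "b' \<in> V j" using a'(1) b'(1) E_in[OF assms(1)] E_in[OF jI] by auto
  then have X4: "r(i := a', j := b') \<in> X" "r(j := b') \<in> X" "r(i := a') \<in> X"
    using rX X_upd assms(1) jI by auto
  have "norm (m x a j b) = norm (m r a' j b')"
    using norm_lin_comb_act[OF gr(1) X4 rX] unfolding m_def gr(3) a'(2) b'(2)
    by (simp only: act_upd[OF assms(1)] act_upd[OF jI])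
  moreover have "(norm (m r a' j b'))\<^sup>2 = 0"
  proof -
    have f: "finite (E i `` {r i})" "finite (E j `` {r j})"
      using E_finite[OF assms(1) X_nth[OF rX assms(1)]] E_finite[OF jI X_nth[OF rX jI]] by auto
    have "(\<Sum>j\<in>I - {i}. \<Sum>b\<in>E j `` {r j}. (norm (m r a' j b))\<^sup>2) = 0"
      using zero[OF gr(2)] a'(1) f(1) unfolding M_def
      by (subst (asm) sum_nonneg_eq_0_iff) (auto intro!: sum_nonneg)
    then have "(\<Sum>b\<in>E j `` {r j}. (norm (m r a' j b))\<^sup>2) = 0"
      using j finite_I by (subst (asm) sum_nonneg_eq_0_iff) (auto intro!: sum_nonneg)
    then show ?thesis
      using b'(1) f(2) by (subst (asm) sum_nonneg_eq_0_iff) auto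
  qed
  ultimately have "m x a j b = 0" by simp
  then show "h (x(i := a, j := b)) - h (x(j := b)) = h (x(i := a)) - h x" by (simp add: m_def)
qed

text \<open>A vanishing mixed difference says that an i-increment along an edge is unaffected by one
  step in another coordinate. Connectedness passes from steps to arbitrary x, y, and then from edges
  to arbitrary v, w.\<close>

lemma difference_independent:
  assumes "i \<in> I" "x \<in> X" "y \<in> X" "v \<in> V i" "w \<in> V i"
  shows "h (x(i := w)) - h (x(i := v)) = h (y(i := w)) - h (y(i := v))"
proof -
  define same where "same = (\<lambda>x y. \<forall>v w. v \<in> V i \<longrightarrow> (v, w) \<in> E i \<longrightarrow> h (x(i := w)) - h (x(i := v)) = h (y(i := w)) - h (y(i := v)))"
  have same_trans: "same a c" if "same a b" "same b c" for a b c
    using that unfolding same_def by metis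
  have single: "same x (x(j := b))" if "x \<in> X" "j \<in> I" "b \<in> E j `` {x j}" for x j b
    unfolding same_def
  proof (intro allI impI)
    fix v w assume vw: "v \<in> V i" "(v, w) \<in> E i"
    show "h (x(i := w)) - h (x(i := v)) = h (x(j := b, i := w)) - h (x(j := b, i := v))"
    proof (cases "j = i")
      case False
      then show ?thesis
        using splitting(2)[OF assms(1) X_upd[OF that(1) assms(1) vw(1)], of w j b] vw that
        by (simp add: fun_upd_twist[OF False])
    qed simp
  qed
  have coord: "same x (x(j := b))" if "x \<in> X" "j \<in> I" "b \<in> V j" for x j b
  proof -
    have "(x j, b) \<in> (E j)\<^sup>*" using E_connected[OF that(2) X_nth[OF that(1,2)] that(3)] .
    then show ?thesis
    proof (induction rule: rtrancl_induct)
      case base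
      then show ?case by (simp add: same_def)
    next
      case (step y z)
      have "y \<in> V j" using step(2) E_verts[OF that(2)] by blast
      then have "same (x(j := y)) (x(j := y, j := z))"
        using single[of "x(j := y)" j z]
          X_upd[OF that(1,2)] step(2) that(2) by simp
      then have "same (x(j := y)) (x(j := z))" by (simp only: fun_upd_upd)
      with step(3) show ?case by (rule same_trans)
    qed
  qed
  have "same x (\<lambda>k. if k \<in> J then y k else x k)" if "finite J" "J \<subseteq> I" for J
    using that
  proof (induction J rule: finite_induct)
    case empty
    then show ?case by (simp add: same_def)
  next
    case (insert j J)
    let ?z = "\<lambda>k. if k \<in> J then y k else x k"
    have "?z \<in> X" using assms(2,3) insert.prems by (auto simp: PiE_def Pi_def extensional_def)
    then have "same ?z (?z(j := y j))" using coord[of ?z j "y j"] insert.prems assms(3) by auto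
    moreover have "?z(j := y j) = (\<lambda>k. if k \<in> insert j J then y k else x k)" by auto
    ultimately show ?case using same_trans[of x ?z] insert.IH insert.prems by simp
  qed
  from this[OF finite_I order_refl] have "same x y"
  proof -
    have "(\<lambda>k. if k \<in> I then y k else x k) = y"
      using assms(2,3) by (auto simp: fun_eq_iff PiE_def extensional_def)
    then show ?thesis using \<open>same x (\<lambda>k. if k \<in> I then y k else x k)\<close> by simp
  qed
  have "(v, w) \<in> (E i)\<^sup>*" using E_connected[OF assms(1,4,5)] .
  then show ?thesis
  proof (induction rule: rtrancl_induct)
    case (step u w)
    have "u \<in> V i" using step(2) E_verts[OF assms(1)] by blast
    then have "h (x(i := w)) - h (x(i := u)) = h (y(i := w)) - h (y(i := u))"
      using \<open>same x y\<close> step(2) by (simp add: same_def)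
    from arg_cong2[where f = "(+)", OF this step(3)] show ?case
      by (simp only: add_diff_eq diff_add_cancel)
  qed simp
qed

end

end

section \<open>Rigidity of harmonic maps on products of trees\<close>

locale product_of_trees =
  product_action \<Gamma> I "\<lambda>i. verts (T i)" \<alpha> R "\<lambda>i. adj (T i)"
  for \<Gamma> :: "('g, 'm) monoid_scheme" (structure)
    and I :: "'i set" and T :: "'i \<Rightarrow> ('v, 'x) coloured_graph_scheme"
    and \<alpha> :: "'g \<Rightarrow> 'i \<Rightarrow> 'v \<Rightarrow> 'v" and R :: "('i \<Rightarrow> 'v) set" +
  fixes G :: "'i \<Rightarrow> ('v \<Rightarrow> 'v) set"
  assumes dense: "i \<in> I \<Longrightarrow> dense_action (T i) (G i) ((\<lambda>g. \<alpha> g i) ` carrier \<Gamma>)"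
begin

text \<open>By \<open>splitting\<close> each restriction of h to one coordinate is harmonic on a
  tree, so \<open>harmonic_constant\<close> applies to it; the coordinates of x are then replaced by
  those of y one at a time.\<close>

theorem rigidity:
  fixes h :: "('i \<Rightarrow> 'v) \<Rightarrow> 'w :: real_inner"
  assumes gram: "\<And>g x y x' y'. g \<in> carrier \<Gamma> \<Longrightarrow> x \<in> X \<Longrightarrow> y \<in> X \<Longrightarrow> x' \<in> X \<Longrightarrow> y' \<in> X \<Longrightarrow>
      inner (h (act g x) - h (act g y)) (h (act g x') - h (act g y')) = inner (h x - h y) (h x' - h y')"
    and harmonic: "\<And>x. x \<in> X \<Longrightarrow> (\<Sum>j\<in>I. \<Sum>a\<in>adj (T j) `` {x j}. h (x(j := a)) - h x) = 0"
    and finite_dim: "finite B" "h ` X \<subseteq> span B"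
    and "x \<in> X" "y \<in> X"
  shows "h y = h x"
proof -
  have coord: "h (x(i := w)) = h x" if xi: "x \<in> X" "i \<in> I" "w \<in> verts (T i)" for x i w
  proof -
    interpret dense_action "T i" "G i" "(\<lambda>g. \<alpha> g i) ` carrier \<Gamma>" by (rule dense[OF xi(2)])
    define \<phi> where "\<phi> = (\<lambda>v. h (x(i := v)))"
    have "\<phi> w = \<phi> (x i)"
    proof (rule harmonic_constant)
      fix f a b a' b'
      assume "f \<in> (\<lambda>g. \<alpha> g i) ` carrier \<Gamma>" and ab: "a \<in> verts (T i)" "b \<in> verts (T i)" "a' \<in> verts (T i)" "b' \<in> verts (T i)"
      then obtain g where g: "g \<in> carrier \<Gamma>" "f = \<alpha> g i" by blast
      \<comment> \<open>The element g also moves the other coordinates of x, but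
        \<open>difference_independent\<close> shows that increments in coordinate i do not notice
        this. So the one-variable Gram matrix inherits its invariance from
        \<open>gram\<close>.\<close>
      have move: "\<phi> (f a) - \<phi> (f b) = h (act g (x(i := a))) - h (act g (x(i := b)))"
        if "a \<in> verts (T i)" "b \<in> verts (T i)" for a b
        unfolding \<phi>_def g(2) act_upd[OF xi(2)]
        by (rule difference_independent[OF gram harmonic xi(2) xi(1) act_closed[OF g(1) xi(1)]])
          (use \<alpha>_verts[OF g(1) xi(2)] that in blast)+
      show "inner (\<phi> (f a) - \<phi> (f b)) (\<phi> (f a') - \<phi> (f b')) = inner (\<phi> a - \<phi> b) (\<phi> a' - \<phi> b')"
        unfolding move[OF ab(1,2)] move[OF ab(3,4)] unfolding \<phi>_def
        by (rule gram) (use g ab X_upd[OF xi(1,2)] in blast)+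
    next
      show "finite B" by (rule finite_dim)
      show "\<phi> ` verts (T i) \<subseteq> span B"
      proof (rule image_subsetI)
        fix v assume "v \<in> verts (T i)"
        from X_upd[OF xi(1,2) this] show "\<phi> v \<in> span B" unfolding \<phi>_def using finite_dim(2) by blast
      qed
      show "(\<Sum>w\<in>adj (T i) `` {v}. \<phi> w - \<phi> v) = 0" if v: "v \<in> verts (T i)" for v
      proof -
        have "(\<Sum>a\<in>adj (T i) `` {(x(i := v)) i}. h (x(i := v, i := a)) - h (x(i := v))) = 0"
          by (rule splitting(1)[OF _ _ xi(2) X_upd[OF xi(1,2) v]]) (erule (4) gram, erule harmonic)
        then show ?thesis unfolding \<phi>_def fun_upd_same fun_upd_upd .
      qed
      show "x i \<in> verts (T i)" "w \<in> verts (T i)" using xi by auto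
    qed
    then show ?thesis by (simp only: \<phi>_def fun_upd_triv)
  qed
  have "h (\<lambda>k. if k \<in> J then y k else x k) = h x" if "finite J" "J \<subseteq> I" for J
    using that
  proof (induction J rule: finite_induct)
    case (insert j J)
    let ?z = "\<lambda>k. if k \<in> J then y k else x k"
    have "?z \<in> X" using assms(5,6) insert.prems by (auto simp: PiE_def Pi_def extensional_def)
    then have "h (?z(j := y j)) = h ?z" using coord[of ?z j "y j"] insert.prems assms(6) by auto
    moreover have "?z(j := y j) = (\<lambda>k. if k \<in> insert j J then y k else x k)" by auto
    ultimately show ?case using insert by simp
  qed simp
  from this[OF finite_I order_refl] show ?thesis
  proof -
    have "(\<lambda>k. if k \<in> I then y k else x k) = y"
      using assms(5,6) by (auto simp: fun_eq_iff PiE_def extensional_def)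
    then show ?thesis using \<open>h (\<lambda>k. if k \<in> I then y k else x k) = h x\<close> by simp
  qed
qed

end

section \<open>Finitely supported functions as an inner product space\<close>

abbreviation "lookup \<equiv> Poly_Mapping.lookup"
abbreviation "keys \<equiv> Poly_Mapping.keys"

text \<open>The dimension is a variable of the theorem and cannot be part of a type. Finitely
  supported functions form one inner product space in which the condition
  \<open>keys v \<subseteq> J\<close> cuts out the finite-dimensional spaces that are
  needed.\<close>

instantiation poly_mapping :: (type, real_inner) real_inner
begin

definition scaleR_poly_mapping :: "real \<Rightarrow> ('a, 'b) poly_mapping \<Rightarrow> ('a, 'b) poly_mapping" where
  "scaleR_poly_mapping c f = Poly_Mapping.map (scaleR c) f"

definition inner_poly_mapping :: "('a, 'b) poly_mapping \<Rightarrow> ('a, 'b) poly_mapping \<Rightarrow> real" where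
  "inner_poly_mapping f g = (\<Sum>k\<in>keys f. inner (lookup f k) (lookup g k))"

definition norm_poly_mapping :: "('a, 'b) poly_mapping \<Rightarrow> real" where
  "norm_poly_mapping f = sqrt (inner f f)"

definition dist_poly_mapping :: "('a, 'b) poly_mapping \<Rightarrow> ('a, 'b) poly_mapping \<Rightarrow> real" where
  "dist_poly_mapping f g = norm (f - g)"

definition sgn_poly_mapping :: "('a, 'b) poly_mapping \<Rightarrow> ('a, 'b) poly_mapping" where
  "sgn_poly_mapping f = scaleR (inverse (norm f)) f"

definition uniformity_poly_mapping :: "(('a, 'b) poly_mapping \<times> ('a, 'b) poly_mapping) filter" where
  "uniformity_poly_mapping = (INF e\<in>{0<..}. principal {(f, g). dist f g < e})"

definition open_poly_mapping :: "('a, 'b) poly_mapping set \<Rightarrow> bool" where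
  "open_poly_mapping U \<longleftrightarrow> (\<forall>f\<in>U. \<forall>\<^sub>F (f', g) in uniformity. f' = f \<longrightarrow> g \<in> U)"

lemma lookup_scaleR [simp]: "lookup (c *\<^sub>R f) k = c *\<^sub>R lookup f k"
  by (simp add: scaleR_poly_mapping_def Poly_Mapping.map.rep_eq when_def)

lemma inner_poly_mapping_superset:
  assumes "finite J" "keys f \<subseteq> J"
  shows "inner f g = (\<Sum>k\<in>J. inner (lookup f k) (lookup g k))"
  unfolding inner_poly_mapping_def using assms
  by (intro sum.mono_neutral_left) (auto simp: in_keys_iff)

instance
proof
  fix f g h :: "('a, 'b) poly_mapping" and a b :: real
  show "a *\<^sub>R (f + g) = a *\<^sub>R f + a *\<^sub>R g" "(a + b) *\<^sub>R f = a *\<^sub>R f + b *\<^sub>R f"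
    "a *\<^sub>R b *\<^sub>R f = (a * b) *\<^sub>R f" "1 *\<^sub>R f = f"
    by (auto intro!: poly_mapping_eqI simp: lookup_add scaleR_add_left scaleR_add_right)
  show "dist f g = norm (f - g)" by (rule dist_poly_mapping_def)
  show "sgn f = inverse (norm f) *\<^sub>R f" by (simp add: sgn_poly_mapping_def)
  show "uniformity = (INF e\<in>{0<..}. principal {(f :: ('a, 'b) poly_mapping, g). dist f g < e})"
    by (rule uniformity_poly_mapping_def)
  show "open U \<longleftrightarrow> (\<forall>f\<in>U. \<forall>\<^sub>F (f', g) in uniformity. f' = f \<longrightarrow> g \<in> U)" for U :: "('a, 'b) poly_mapping set"
    by (rule open_poly_mapping_def)
  define J where "J = keys f \<union> keys g \<union> keys h \<union> keys (f + g) \<union> keys (a *\<^sub>R f)"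
  have J: "finite J" "keys f \<subseteq> J" "keys g \<subseteq> J" "keys h \<subseteq> J" "keys (f + g) \<subseteq> J" "keys (a *\<^sub>R f) \<subseteq> J"
    by (auto simp: J_def)
  show "inner f g = inner g f"
    by (simp add: inner_poly_mapping_superset[OF J(1,2)] inner_poly_mapping_superset[OF J(1,3)] inner_commute)
  show "inner (f + g) h = inner f h + inner g h"
    by (simp add: inner_poly_mapping_superset[OF J(1,2)] inner_poly_mapping_superset[OF J(1,3)]
        inner_poly_mapping_superset[OF J(1,5)] lookup_add inner_add_left sum.distrib)
  show "inner (a *\<^sub>R f) g = a * inner f g"
    by (simp add: inner_poly_mapping_superset[OF J(1,2)] inner_poly_mapping_superset[OF J(1,6)] sum_distrib_left)
  show "0 \<le> inner f f" by (simp add: inner_poly_mapping_def sum_nonneg)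
  show "inner f f = 0 \<longleftrightarrow> f = 0"
    by (auto simp: inner_poly_mapping_def sum_nonneg_eq_0_iff intro!: poly_mapping_eqI)
      (metis in_keys_iff inner_eq_zero_iff)
  show "norm f = sqrt (inner f f)" by (rule norm_poly_mapping_def)
qed

end

lemma norm_lookup_le: "norm (lookup f k) \<le> norm (f :: ('a, 'b :: real_inner) poly_mapping)"
proof (cases "k \<in> keys f")
  case True
  have "inner (lookup f k) (lookup f k) \<le> inner f f"
    unfolding inner_poly_mapping_def using True by (intro member_le_sum) auto
  then show ?thesis by (simp add: norm_eq_sqrt_inner)
qed (simp add: in_keys_iff)

lemma norm_le_sum_lookup:
  fixes f :: "('a, 'b :: real_inner) poly_mapping"
  assumes "finite J" "keys f \<subseteq> J"
  shows "norm f \<le> (\<Sum>k\<in>J. norm (lookup f k))"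
proof -
  have "(norm f)\<^sup>2 = (\<Sum>k\<in>J. (norm (lookup f k))\<^sup>2)"
    by (simp add: power2_norm_eq_inner inner_poly_mapping_superset[OF assms])
  also have "\<dots> \<le> (\<Sum>k\<in>J. norm (lookup f k))\<^sup>2"
    using assms(1)
  proof (induction J rule: finite_induct)
    case (insert k J)
    have "0 \<le> norm (lookup f k) * (\<Sum>k\<in>J. norm (lookup f k))" by (intro mult_nonneg_nonneg sum_nonneg) auto
    then show ?case using insert by (simp add: power2_sum)
  qed simp
  finally show ?thesis by (rule power2_le_imp_le) (simp add: sum_nonneg)
qed

lemma tendsto_poly_mapping:
  fixes f :: "nat \<Rightarrow> ('a, 'b :: real_inner) poly_mapping"
  assumes "finite J" "\<And>n. keys (f n) \<subseteq> J" "keys l \<subseteq> J" "\<And>k. k \<in> J \<Longrightarrow> (\<lambda>n. lookup (f n) k) \<longlonglongrightarrow> lookup l k"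
  shows "f \<longlonglongrightarrow> l"
proof -
  have lim: "(\<lambda>n. \<Sum>k\<in>J. norm (lookup (f n) k - lookup l k)) \<longlonglongrightarrow> (\<Sum>k\<in>J. norm (lookup l k - lookup l k))"
    by (intro tendsto_sum tendsto_norm tendsto_diff assms(4) tendsto_const)
  have "norm (f n - l) \<le> (\<Sum>k\<in>J. norm (lookup (f n) k - lookup l k))" for n
  proof -
    have "keys (f n - l) \<subseteq> keys (f n) \<union> keys l" by (auto simp: in_keys_iff lookup_minus)
    then have "keys (f n - l) \<subseteq> J" using assms(2)[of n] assms(3) by blast
    from norm_le_sum_lookup[OF assms(1) this] show ?thesis by (simp add: lookup_minus)
  qed
  note bound = this
  have "(\<lambda>n. \<Sum>k\<in>J. norm (lookup (f n) k - lookup l k)) \<longlonglongrightarrow> 0" using lim by simp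
  from Lim_null_comparison[OF always_eventually[OF allI[OF bound]] this]
  have "(\<lambda>n. f n - l) \<longlonglongrightarrow> 0" .
  then show ?thesis by (rule LIM_zero_cancel)
qed

text \<open>A diagonal argument over the countably many coordinates in X \<times> J, each scaled
  into the unit disc.\<close>

lemma pointwise_convergent_subsequence:
  fixes f :: "nat \<Rightarrow> 'x \<Rightarrow> ('j, complex) poly_mapping"
  assumes "finite J" "countable X" "\<And>n x. x \<in> X \<Longrightarrow> keys (f n x) \<subseteq> J" "\<And>n x. x \<in> X \<Longrightarrow> norm (f n x) \<le> B x"
  obtains r l where "strict_mono (r :: nat \<Rightarrow> nat)" "\<And>x. x \<in> X \<Longrightarrow> keys (l x) \<subseteq> J"
    "\<And>x. x \<in> X \<Longrightarrow> (\<lambda>n. f (r n) x) \<longlonglongrightarrow> l x"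
proof -
  have Bpos: "0 < 1 + B x" if "x \<in> X" for x using assms(4)[OF that, of 0] norm_ge_zero[of "f 0 x"] by linarith
  \<comment> \<open>B x bounds a norm, hence is nonnegative; adding 1 makes the divisor
    positive.\<close>
  define F where "F = (\<lambda>n (x, j). lookup (f n x) j / of_real (1 + B x))"
  have F_bound: "norm (F n p) \<le> 1" if pXJ: "p \<in> X \<times> J" for n p
  proof -
    obtain x j where p: "p = (x, j)" "x \<in> X" using pXJ by auto
    have "norm (lookup (f n x) j) \<le> 1 + B x"
      using norm_lookup_le[of "f n x" j] assms(4)[OF p(2), of n] by linarith
    moreover have "norm (F n p) = norm (lookup (f n x) j) / (1 + B x)"
      using Bpos[OF p(2)] by (simp add: F_def p(1) norm_divide del: of_real_add)
    ultimately show ?thesis using Bpos[OF p(2)] by simp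
  qed
  obtain r where r: "strict_mono (r :: nat \<Rightarrow> nat)" "\<And>p. p \<in> X \<times> J \<Longrightarrow> \<exists>l. (\<lambda>n. F (r n) p) \<longlonglongrightarrow> l"
  proof (rule function_convergent_subsequence[OF countable_SIGMA[OF assms(2) countable_finite[OF assms(1)]] F_bound])
    fix k :: "nat \<Rightarrow> nat"
    assume "strict_mono k" "\<And>p. p \<in> X \<times> J \<Longrightarrow> \<exists>l. (\<lambda>n. F (k n) p) \<longlonglongrightarrow> l"
    then show thesis by (rule that)
  qed
  define L where "L = (\<lambda>x j. if j \<in> J then of_real (1 + B x) * lim (\<lambda>n. F (r n) (x, j)) else 0)"
  define l where "l = (\<lambda>x. Abs_poly_mapping (L x))"
  have "finite {j. L x j \<noteq> 0}" for x by (rule finite_subset[OF _ assms(1)]) (auto simp: L_def)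
  then have ll: "lookup (l x) = L x" for x by (simp add: l_def)
  have kl: "keys (l x) \<subseteq> J" for x by (auto simp: in_keys_iff ll L_def split: if_splits)
  have "(\<lambda>n. f (r n) x) \<longlonglongrightarrow> l x" if x: "x \<in> X" for x
  proof (rule tendsto_poly_mapping[OF assms(1) assms(3)[OF x] kl])
    fix j assume j: "j \<in> J"
    have "(\<lambda>n. F (r n) (x, j)) \<longlonglongrightarrow> lim (\<lambda>n. F (r n) (x, j))"
      using r(2)[of "(x, j)"] x j by (simp add: convergent_LIMSEQ_iff[symmetric] convergent_def)
    then have "(\<lambda>n. of_real (1 + B x) * F (r n) (x, j)) \<longlonglongrightarrow> L x j"
      using j by (auto simp: L_def intro: tendsto_mult_left)
    moreover have "of_real (1 + B x) * F n (x, j) = lookup (f n x) j" for n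
      using Bpos[OF x] by (simp add: F_def del: of_real_add)
    ultimately show "(\<lambda>n. lookup (f (r n) x) j) \<longlonglongrightarrow> lookup (l x) j" by (simp add: ll)
  qed
  then show ?thesis using r(1) kl by (intro that[of r l]) auto
qed

text \<open>\<open>span\<close> is over the reals, so every index contributes two vectors, with
  entries 1 and \<open>\<i>\<close>.\<close>

lemma finite_dim_poly_mapping:
  assumes "finite J"
  shows "\<exists>B. finite B \<and> {f :: ('j, complex) poly_mapping. keys f \<subseteq> J} \<subseteq> span B"
proof -
  let ?s = "\<lambda>j c. Poly_Mapping.single j (c :: complex)"
  define B where "B = (\<lambda>j. ?s j 1) ` J \<union> (\<lambda>j. ?s j \<i>) ` J"
  have "f \<in> span B" if "keys f \<subseteq> J" for f :: "('j, complex) poly_mapping"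
  proof -
    have "f = (\<Sum>j\<in>J. Re (lookup f j) *\<^sub>R ?s j 1 + Im (lookup f j) *\<^sub>R ?s j \<i>)"
    proof (rule poly_mapping_eqI)
      fix k
      have "lookup (\<Sum>j\<in>J. Re (lookup f j) *\<^sub>R ?s j 1 + Im (lookup f j) *\<^sub>R ?s j \<i>) k =
        (\<Sum>j\<in>J. if k = j then lookup f j else 0)"
        by (auto simp: lookup_sum lookup_add lookup_single when_def complex_eq_iff intro!: sum.cong)
      also have "\<dots> = lookup f k" using that assms by (auto simp: in_keys_iff)
      finally show "lookup f k = lookup (\<Sum>j\<in>J. Re (lookup f j) *\<^sub>R ?s j 1 + Im (lookup f j) *\<^sub>R ?s j \<i>) k" ..
    qed
    also have "\<dots> \<in> span B"
      by (intro span_sum span_add span_scale span_base) (auto simp: B_def)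
    finally show ?thesis .
  qed
  then show ?thesis using assms by (intro exI[of _ B]) (auto simp: B_def)
qed

section \<open>A uniform spectral gap\<close>

lemma quadratic_nonneg_imp_linear_zero:
  fixes b c :: real
  assumes "\<And>t. 0 \<le> 2 * t * b + t\<^sup>2 * c" "0 \<le> c"
  shows "b = 0"
proof (rule ccontr)
  assume "b \<noteq> 0"
  \<comment> \<open>The minimum is near t = -b / c; c + 1 in the denominator also covers c =
    0.\<close>
  define s where "s = b / (c + 1)"
  have b: "b = s * (c + 1)" using assms(2) by (simp add: s_def)
  have "2 * (- s) * b + (- s)\<^sup>2 * c = - (s\<^sup>2 * (c + 2))"
    unfolding b by (simp add: power2_eq_square algebra_simps)
  also have "\<dots> < 0" using \<open>b \<noteq> 0\<close> b assms(2) by auto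
  finally show False using assms(1)[of "- s"] by simp
qed

text \<open>The sum over R stands in for a maximum and gives one bound valid for all r.\<close>

lemma norm_sum_inv_weight:
  fixes c :: "'x \<Rightarrow> real" and v :: "'w :: real_inner"
  assumes "finite R" "r \<in> R" "\<And>x. x \<in> R \<Longrightarrow> 0 < c x" "c r * (norm v)\<^sup>2 \<le> 1"
  shows "norm v \<le> (\<Sum>x\<in>R. sqrt (1 / c x))"
proof -
  have "(norm v)\<^sup>2 \<le> 1 / c r" using assms(3)[OF assms(2)] assms(4) by (simp add: field_simps)
  then have "norm v \<le> sqrt (1 / c r)" by (rule real_le_rsqrt)
  also have "\<dots> \<le> (\<Sum>x\<in>R. sqrt (1 / c x))"
    using assms(3) by (intro member_le_sum[OF assms(2) _ assms(1)]) (simp add: less_imp_le)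
  finally show ?thesis .
qed

section \<open>Laplacian and energy for a cocompact action on a graph\<close>

locale graph_action = cocompact_action \<Gamma> X act R
  for \<Gamma> :: "('g, 'm) monoid_scheme" (structure)
    and X :: "'x set" and act :: "'g \<Rightarrow> 'x \<Rightarrow> 'x" and R :: "'x set" +
  fixes E :: "('x \<times> 'x) set"
  assumes E_X: "E \<subseteq> X \<times> X"
    and E_sym: "(x, y) \<in> E \<Longrightarrow> (y, x) \<in> E"
    and E_finite: "x \<in> X \<Longrightarrow> finite (E `` {x})"
    and E_act: "g \<in> carrier \<Gamma> \<Longrightarrow> (x, y) \<in> E \<Longrightarrow> (act g x, act g y) \<in> E"
    and E_connected: "x \<in> X \<Longrightarrow> y \<in> X \<Longrightarrow> (x, y) \<in> E\<^sup>*"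
    and X_nonempty: "X \<noteq> {}"
begin

lemma E_in: "(x, y) \<in> E \<Longrightarrow> x \<in> X" "(x, y) \<in> E \<Longrightarrow> y \<in> X"
  using E_X by auto

lemma R_in: "x \<in> R \<Longrightarrow> x \<in> X"
  using R_subset by blast

lemma R_nonempty: "R \<noteq> {}"
  using X_nonempty orbits_meet_R by blast

text \<open>Balls of a locally finite connected graph are finite. Countability is what the diagonal
  argument for subsequences requires.\<close>

lemma countable_X: "countable X"
proof -
  obtain x where x: "x \<in> X" using X_nonempty by blast
  have fin: "finite {y. (x, y) \<in> E ^^ n} \<and> {y. (x, y) \<in> E ^^ n} \<subseteq> X" for n
  proof (induction n)
    case (Suc n)
    have "{y. (x, y) \<in> E ^^ Suc n} = (\<Union>z\<in>{z. (x, z) \<in> E ^^ n}. E `` {z})" by auto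
    moreover have "finite \<dots>" using Suc E_finite by (intro finite_UN_I) blast+
    moreover have "\<dots> \<subseteq> X" using E_in by blast
    ultimately show ?case by simp
  qed (use x in simp)
  have "X \<subseteq> (\<Union>n. {y. (x, y) \<in> E ^^ n})"
    using E_connected[OF x] rtrancl_imp_relpow by blast
  moreover have "countable (\<Union>n. {y. (x, y) \<in> E ^^ n})"
    using fin by (intro countable_UN) (auto intro: countable_finite)
  ultimately show ?thesis by (rule countable_subset)
qed

lemma nbrs_act:
  assumes "g \<in> carrier \<Gamma>" "x \<in> X"
  shows "(\<Sum>y\<in>E `` {act g x}. f y) = (\<Sum>y\<in>E `` {x}. f (act g y))"
proof (rule sum.reindex_bij_witness[of _ "act g" "act (inv g)"])
  fix y assume "y \<in> E `` {act g x}"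
  then have y: "(act g x, y) \<in> E" "y \<in> X" using E_in by auto
  show "act g (act (inv g) y) = y" using act_inv(2)[OF assms(1) y(2)] .
  show "act (inv g) y \<in> E `` {x}" using E_act[of "inv g", OF _ y(1)] act_inv(1)[OF assms] assms(1) by simp
  show "f (act g (act (inv g) y)) = f y" using act_inv(2)[OF assms(1) y(2)] by simp
next
  fix y assume "y \<in> E `` {x}"
  then have y: "(x, y) \<in> E" "y \<in> X" using E_in by auto
  show "act (inv g) (act g y) = y" using act_inv(1)[OF assms(1) y(2)] .
  show "act g y \<in> E `` {act g x}" using E_act[OF assms(1) y(1)] by simp
qed

definition lap :: "('x \<Rightarrow> 'w :: real_inner) \<Rightarrow> 'x \<Rightarrow> 'w" where
  "lap f x = (\<Sum>y\<in>E `` {x}. f y - f x)"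

definition ip :: "('x \<Rightarrow> 'w :: real_inner) \<Rightarrow> ('x \<Rightarrow> 'w) \<Rightarrow> real" where
  "ip f g = (\<Sum>x\<in>R. wt x * inner (f x) (g x))"

text \<open>The Dirichlet form over the quotient. Every edge is counted from both ends, which
  accounts for the factor 2 in \<open>green\<close>.\<close>

definition en :: "('x \<Rightarrow> 'w :: real_inner) \<Rightarrow> ('x \<Rightarrow> 'w) \<Rightarrow> real" where
  "en f g = (\<Sum>x\<in>R. wt x * (\<Sum>y\<in>E `` {x}. inner (f y - f x) (g y - g x)))"

lemma inner_lincomb:
  "inner (a *\<^sub>R p + b *\<^sub>R q) (a *\<^sub>R p + b *\<^sub>R q) = a\<^sup>2 * inner p p + 2 * a * b * inner p q + b\<^sup>2 * inner q q"
  by (simp add: inner_add_left inner_add_right inner_commute power2_eq_square algebra_simps)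

lemma ip_bilinear:
  "ip (\<lambda>x. a *\<^sub>R f x + b *\<^sub>R g x) (\<lambda>x. a *\<^sub>R f x + b *\<^sub>R g x) = a\<^sup>2 * ip f f + 2 * a * b * ip f g + b\<^sup>2 * ip g g"
  unfolding ip_def sum_distrib_left sum.distrib[symmetric] inner_lincomb
  by (rule sum.cong[OF refl]) (simp add: algebra_simps)

lemma en_bilinear:
  "en (\<lambda>x. a *\<^sub>R f x + b *\<^sub>R g x) (\<lambda>x. a *\<^sub>R f x + b *\<^sub>R g x) = a\<^sup>2 * en f f + 2 * a * b * en f g + b\<^sup>2 * en g g"
proof -
  have eq: "(a *\<^sub>R f y + b *\<^sub>R g y) - (a *\<^sub>R f x + b *\<^sub>R g x) = a *\<^sub>R (f y - f x) + b *\<^sub>R (g y - g x)" for x y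
    by (simp add: algebra_simps)
  show ?thesis
    unfolding en_def eq inner_lincomb sum.distrib sum_distrib_left[symmetric]
    by (simp only: sum.distrib[symmetric] sum_distrib_left distrib_left) (simp only: mult_ac)
qed

lemma ip_nonneg: "0 \<le> ip f f"
  unfolding ip_def using R_in wt_pos by (intro sum_nonneg mult_nonneg_nonneg) (auto simp: less_imp_le)

lemma en_nonneg: "0 \<le> en f f"
  unfolding en_def using R_in wt_pos by (intro sum_nonneg mult_nonneg_nonneg) (auto simp: less_imp_le)

lemma ip_zeroD: assumes "ip f f = 0" "x \<in> R" shows "f x = 0"
proof -
  have "wt x * inner (f x) (f x) = 0"
    using assms R_in wt_pos unfolding ip_def
    by (subst (asm) sum_nonneg_eq_0_iff) (auto simp: finite_R less_imp_le)
  then show ?thesis using wt_pos[OF R_in[OF assms(2)]] by simp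
qed

lemma ip_ge: assumes "x \<in> R" shows "wt x * (norm (f x))\<^sup>2 \<le> ip f f"
  unfolding ip_def power2_norm_eq_inner
  using R_in wt_pos by (intro member_le_sum assms finite_R) (auto simp: less_imp_le)

lemma en_ge: assumes "x \<in> R" "(x, y) \<in> E" shows "wt x * (norm (f y - f x))\<^sup>2 \<le> en f f"
proof -
  have "(norm (f y - f x))\<^sup>2 \<le> (\<Sum>y\<in>E `` {x}. inner (f y - f x) (f y - f x))"
    unfolding power2_norm_eq_inner
    by (rule member_le_sum[of y]) (use assms E_finite[OF R_in] in auto)
  then have "wt x * (norm (f y - f x))\<^sup>2 \<le> wt x * (\<Sum>y\<in>E `` {x}. inner (f y - f x) (f y - f x))"
    using wt_pos[OF R_in[OF assms(1)]] by (intro mult_left_mono) auto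
  also have "\<dots> \<le> en f f"
    unfolding en_def using R_in wt_pos
    by (intro member_le_sum[of x] assms finite_R mult_nonneg_nonneg sum_nonneg) (auto simp: less_imp_le)
  finally show ?thesis .
qed

definition weight_bound :: real where
  "weight_bound = (\<Sum>x\<in>R. sqrt (1 / wt x))"

lemma ip_bound: assumes "x \<in> R" "ip f f \<le> 1" shows "norm (f x) \<le> weight_bound"
  unfolding weight_bound_def using wt_pos R_in ip_ge[OF assms(1), of f] assms
  by (intro norm_sum_inv_weight[OF finite_R assms(1)]) auto

lemma en_bound: assumes "x \<in> R" "(x, y) \<in> E" "en f f \<le> 1" shows "norm (f y - f x) \<le> weight_bound"
  unfolding weight_bound_def using wt_pos R_in en_ge[OF assms(1,2), of f] assms
  by (intro norm_sum_inv_weight[OF finite_R assms(1)]) auto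

lemma tendsto_ip:
  assumes "\<And>x. x \<in> X \<Longrightarrow> (\<lambda>n. f n x) \<longlonglongrightarrow> l x"
  shows "(\<lambda>n. ip (f n) (f n)) \<longlonglongrightarrow> ip l l"
  unfolding ip_def by (intro tendsto_sum tendsto_mult tendsto_const tendsto_inner assms R_in)

lemma tendsto_en:
  assumes "\<And>x. x \<in> X \<Longrightarrow> (\<lambda>n. f n x) \<longlonglongrightarrow> l x"
  shows "(\<lambda>n. en (f n) (f n)) \<longlonglongrightarrow> en l l"
  unfolding en_def
proof (intro tendsto_sum tendsto_mult tendsto_const)
  fix x y assume "x \<in> R" "y \<in> E `` {x}"
  then have "x \<in> X" "y \<in> X" using E_in by auto
  then show "(\<lambda>n. inner (f n y - f n x) (f n y - f n x)) \<longlonglongrightarrow> inner (l y - l x) (l y - l x)"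
    by (intro tendsto_inner tendsto_diff assms)
qed

end

section \<open>Isometric representations, equivariant maps and eigensections\<close>

locale graph_action_dim = graph_action \<Gamma> X act R E
  for \<Gamma> :: "('g, 'm) monoid_scheme" (structure)
    and X :: "'x set" and act :: "'g \<Rightarrow> 'x \<Rightarrow> 'x" and R :: "'x set" and E :: "('x \<times> 'x) set" +
  fixes J :: "'j set"
  assumes finite_J: "finite J"
begin

definition W :: "('j \<Rightarrow>\<^sub>0 complex) set" where
  "W = {v. keys v \<subseteq> J}"

text \<open>Only the underlying real structure is recorded: real linearity and the real inner
  product suffice for the variational argument.\<close>

definition isometric_rep :: "('g \<Rightarrow> ('j \<Rightarrow>\<^sub>0 complex) \<Rightarrow> ('j \<Rightarrow>\<^sub>0 complex)) \<Rightarrow> bool" where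
  "isometric_rep \<pi> \<longleftrightarrow> (\<forall>g\<in>carrier \<Gamma>. linear (\<pi> g) \<and> \<pi> g ` W \<subseteq> W \<and>
     (\<forall>v\<in>W. \<forall>w\<in>W. inner (\<pi> g v) (\<pi> g w) = inner v w) \<and>
     (\<forall>h\<in>carrier \<Gamma>. \<forall>v\<in>W. \<pi> (g \<otimes> h) v = \<pi> g (\<pi> h v)))"

definition invariants :: "('g \<Rightarrow> ('j \<Rightarrow>\<^sub>0 complex) \<Rightarrow> ('j \<Rightarrow>\<^sub>0 complex)) \<Rightarrow> ('j \<Rightarrow>\<^sub>0 complex) set" where
  "invariants \<pi> = {v \<in> W. \<forall>g\<in>carrier \<Gamma>. \<pi> g v = v}"

text \<open>The orthogonality condition removes the constant equivariant maps.\<close>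

definition sections :: "('g \<Rightarrow> ('j \<Rightarrow>\<^sub>0 complex) \<Rightarrow> ('j \<Rightarrow>\<^sub>0 complex)) \<Rightarrow> ('x \<Rightarrow> 'j \<Rightarrow>\<^sub>0 complex) set" where
  "sections \<pi> = {f. \<forall>x\<in>X. f x \<in> W \<and> (\<forall>v\<in>invariants \<pi>. inner (f x) v = 0) \<and>
     (\<forall>g\<in>carrier \<Gamma>. f (act g x) = \<pi> g (f x))}"

lemma W_subspace: "Real_Vector_Spaces.subspace W"
proof -
  have "keys (v + w) \<subseteq> keys v \<union> keys w" "keys (c *\<^sub>R v) \<subseteq> keys v" for v w :: "'j \<Rightarrow>\<^sub>0 complex" and c :: real
    by (auto simp: in_keys_iff lookup_add)
  then show ?thesis unfolding real_vector.subspace_def W_def by (auto; blast)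
qed

lemma W_diff: "v \<in> W \<Longrightarrow> w \<in> W \<Longrightarrow> v - w \<in> W"
  using W_subspace by (rule real_vector.subspace_diff)

context
  fixes \<pi> assumes \<pi>: "isometric_rep \<pi>"
begin

lemma rep:
  assumes "g \<in> carrier \<Gamma>"
  shows "linear (\<pi> g)" "v \<in> W \<Longrightarrow> \<pi> g v \<in> W"
    "v \<in> W \<Longrightarrow> w \<in> W \<Longrightarrow> inner (\<pi> g v) (\<pi> g w) = inner v w"
    "h \<in> carrier \<Gamma> \<Longrightarrow> v \<in> W \<Longrightarrow> \<pi> (g \<otimes> h) v = \<pi> g (\<pi> h v)"
    "v \<in> W \<Longrightarrow> norm (\<pi> g v) = norm v"
  using \<pi> assms unfolding isometric_rep_def norm_eq_sqrt_inner by (blast, blast, blast, blast, metis)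

lemma sectionsD:
  assumes "f \<in> sections \<pi>" "x \<in> X"
  shows "f x \<in> W" "v \<in> invariants \<pi> \<Longrightarrow> inner (f x) v = 0"
    "g \<in> carrier \<Gamma> \<Longrightarrow> f (act g x) = \<pi> g (f x)"
  using assms unfolding sections_def by blast+

lemma sections_lincomb:
  assumes "f \<in> sections \<pi>" "g \<in> sections \<pi>"
  shows "(\<lambda>x. a *\<^sub>R f x + b *\<^sub>R g x) \<in> sections \<pi>"
  unfolding sections_def
proof (intro CollectI ballI conjI)
  fix x assume x: "x \<in> X"
  note f = sectionsD[OF assms(1) x] and g = sectionsD[OF assms(2) x]
  show "a *\<^sub>R f x + b *\<^sub>R g x \<in> W" using f(1) g(1) by (intro real_vector.subspace_add real_vector.subspace_scale W_subspace)
  show "inner (a *\<^sub>R f x + b *\<^sub>R g x) v = 0" if "v \<in> invariants \<pi>" for v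
    using f(2)[OF that] g(2)[OF that] by (simp add: inner_add_left)
  show "a *\<^sub>R f (act k x) + b *\<^sub>R g (act k x) = \<pi> k (a *\<^sub>R f x + b *\<^sub>R g x)" if "k \<in> carrier \<Gamma>" for k
    using f(3)[OF that] g(3)[OF that] rep(1)[OF that] by (simp add: linear_add linear_scale)
qed

lemma gram_sections:
  assumes "f \<in> sections \<pi>" "g \<in> sections \<pi>" "k \<in> carrier \<Gamma>" "x \<in> X" "y \<in> X" "x' \<in> X" "y' \<in> X"
  shows "inner (f (act k x) - f (act k y)) (g (act k x') - g (act k y')) = inner (f x - f y) (g x' - g y')"
proof -
  have "f (act k x) - f (act k y) = \<pi> k (f x - f y)" "g (act k x') - g (act k y') = \<pi> k (g x' - g y')"
    using sectionsD(3)[OF assms(1) _ assms(3)] sectionsD(3)[OF assms(2) _ assms(3)] assms(4-7) rep(1)[OF assms(3)]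
    by (simp_all add: linear_diff)
  then show ?thesis
    using rep(3)[OF assms(3)] sectionsD(1)[OF assms(1)] sectionsD(1)[OF assms(2)] assms(4-7) W_diff by simp
qed

lemma lap_section:
  assumes "f \<in> sections \<pi>" shows "lap f \<in> sections \<pi>"
  unfolding sections_def
proof (intro CollectI ballI conjI)
  fix x assume x: "x \<in> X"
  note f = sectionsD[OF assms x]
  have y: "y \<in> X" if "y \<in> E `` {x}" for y using that E_in by blast
  show "lap f x \<in> W" unfolding lap_def
    by (intro real_vector.subspace_sum[OF W_subspace] W_diff f(1) sectionsD(1)[OF assms y])
  show "inner (lap f x) v = 0" if "v \<in> invariants \<pi>" for v
    unfolding lap_def inner_sum_left
    by (intro sum.neutral ballI) (simp add: inner_diff_left f(2)[OF that] sectionsD(2)[OF assms y that])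
  show "lap f (act k x) = \<pi> k (lap f x)" if k: "k \<in> carrier \<Gamma>" for k
  proof -
    have "lap f (act k x) = (\<Sum>y\<in>E `` {x}. f (act k y) - f (act k x))"
      unfolding lap_def nbrs_act[OF k x] ..
    also have "\<dots> = (\<Sum>y\<in>E `` {x}. \<pi> k (f y - f x))"
      using f(3)[OF k] sectionsD(3)[OF assms y k] rep(1)[OF k] by (intro sum.cong refl) (simp add: linear_diff)
    also have "\<dots> = \<pi> k (lap f x)" unfolding lap_def by (rule linear_sum[OF rep(1)[OF k], symmetric])
    finally show ?thesis .
  qed
qed

text \<open>Summation by parts: mass transport exchanges x and y in the sum of
  \<open>inner (f y - f x) (g y)\<close>, which turns it into minus the pairing of
  \<open>lap f\<close> with g. The part with \<open>g x\<close> contributes the same amount once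
  more.\<close>

lemma green:
  assumes "f \<in> sections \<pi>" "g \<in> sections \<pi>"
  shows "en f g = - 2 * ip (lap f) g"
proof -
  define F where "F = (\<lambda>x y. inner (f y - f x) (g y))"
  have "(\<Sum>x\<in>R. wt x * (\<Sum>y\<in>E `` {x}. F x y)) = (\<Sum>x\<in>R. wt x * (\<Sum>y\<in>E `` {x}. F y x))"
  proof (rule mass_transport)
    fix k x y assume k: "k \<in> carrier \<Gamma>" and xy: "(x, y) \<in> E"
    have V: "x \<in> X" "y \<in> X" using E_in xy by auto
    have "f (act k y) - f (act k x) = \<pi> k (f y - f x)"
      using sectionsD(3)[OF assms(1) _ k] V rep(1)[OF k] by (simp add: linear_diff)
    then show "F (act k x) (act k y) = F x y"
      unfolding F_def using sectionsD(3)[OF assms(2) V(2) k] rep(3)[OF k] sectionsD(1)[OF assms(1)] sectionsD(1)[OF assms(2)] V W_diff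
      by simp
  qed (use E_X E_sym E_finite E_act in blast)+
  also have "\<dots> = - (\<Sum>x\<in>R. wt x * (\<Sum>y\<in>E `` {x}. inner (f y - f x) (g x)))"
    unfolding sum_negf[symmetric]
    by (rule sum.cong[OF refl]) (simp add: F_def sum_negf[symmetric] inner_diff_left flip: mult_minus_right)
  also have "(\<Sum>x\<in>R. wt x * (\<Sum>y\<in>E `` {x}. inner (f y - f x) (g x))) = ip (lap f) g"
    by (simp add: ip_def lap_def inner_sum_left)
  finally have *: "(\<Sum>x\<in>R. wt x * (\<Sum>y\<in>E `` {x}. F x y)) = - ip (lap f) g" .
  have "(\<Sum>y\<in>E `` {x}. inner (f y - f x) (g y - g x)) = (\<Sum>y\<in>E `` {x}. F x y) - inner (lap f x) (g x)" for x
    unfolding F_def lap_def inner_sum_left sum_subtractf[symmetric] inner_diff_right ..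
  then have "en f g = (\<Sum>x\<in>R. wt x * (\<Sum>y\<in>E `` {x}. F x y)) - ip (lap f) g"
    by (simp only: en_def ip_def right_diff_distrib sum_subtractf)
  then show ?thesis using * by simp
qed

lemma section_bound:
  assumes "f \<in> sections \<pi>" "ip f f \<le> 1" "x \<in> X"
  shows "norm (f x) \<le> weight_bound"
proof -
  obtain g r where g: "g \<in> carrier \<Gamma>" "r \<in> R" "x = act g r" using orbits_meet_R[OF assms(3)] by blast
  have "norm (f x) = norm (f r)"
    unfolding g(3) sectionsD(3)[OF assms(1) R_in[OF g(2)] g(1)]
    by (rule rep(5)[OF g(1) sectionsD(1)[OF assms(1) R_in[OF g(2)]]])
  then show ?thesis using ip_bound[OF g(2) assms(2)] by simp
qed

text \<open>The direct method: unit sections are uniformly bounded by \<open>section_bound\<close>,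
  so a minimising sequence has a pointwise limit, and \<open>ip\<close> and \<open>en\<close>, being
  finite sums, pass to it.\<close>

lemma minimizer:
  assumes "u \<in> sections \<pi>" "0 < ip u u"
  shows "\<exists>f\<in>sections \<pi>. ip f f = 1 \<and> (\<forall>g\<in>sections \<pi>. en f f * ip g g \<le> en g g)"
proof -
  define S where "S = {en f f | f. f \<in> sections \<pi> \<and> ip f f = 1}"
  have normalize: "\<exists>f. f \<in> sections \<pi> \<and> ip f f = 1 \<and> en f f = en g g / ip g g" if g: "g \<in> sections \<pi>" "0 < ip g g" for g
  proof -
    \<comment> \<open>The zero summand brings f into the shape of \<open>sections_lincomb\<close>
      and of the quadratic expansions.\<close>
    define f where "f = (\<lambda>x. (1 / sqrt (ip g g)) *\<^sub>R g x + 0 *\<^sub>R g x)"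
    have "ip f f = 1" unfolding f_def ip_bilinear using g(2) by (simp add: power_divide)
    moreover have "en f f = en g g / ip g g" unfolding f_def en_bilinear using g(2) by (simp add: power_divide)
    moreover have "f \<in> sections \<pi>" unfolding f_def by (rule sections_lincomb[OF g(1) g(1)])
    ultimately show ?thesis by blast
  qed
  have Sne: "S \<noteq> {}" using normalize[OF assms] unfolding S_def by blast
  have Sbdd: "bdd_below S" unfolding S_def by (rule bdd_belowI[of _ 0]) (auto simp: en_nonneg)
  define \<mu> where "\<mu> = Inf S"
  have "\<exists>f. f \<in> sections \<pi> \<and> ip f f = 1 \<and> en f f < \<mu> + 1 / real (Suc n)" for n
  proof -
    have "Inf S < \<mu> + 1 / real (Suc n)" by (simp add: \<mu>_def)
    then obtain s where "s \<in> S" "s < \<mu> + 1 / real (Suc n)" using cInf_lessD[OF Sne] by blast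
    then show ?thesis unfolding S_def by blast
  qed
  then obtain f where f: "\<And>n. f n \<in> sections \<pi>" "\<And>n. ip (f n) (f n) = 1" "\<And>n. en (f n) (f n) < \<mu> + 1 / real (Suc n)"
    by metis
  have lower: "\<mu> \<le> en g g" if "g \<in> sections \<pi>" "ip g g = 1" for g
    unfolding \<mu>_def by (rule cInf_lower[OF _ Sbdd]) (use that in \<open>auto simp: S_def\<close>)
  obtain r l where r: "strict_mono r" "\<And>x. x \<in> X \<Longrightarrow> keys (l x) \<subseteq> J" "\<And>x. x \<in> X \<Longrightarrow> (\<lambda>n. f (r n) x) \<longlonglongrightarrow> l x"
  proof (rule pointwise_convergent_subsequence[OF finite_J countable_X, of f "\<lambda>_. weight_bound"])
    show "keys (f n x) \<subseteq> J" if "x \<in> X" for n x using sectionsD(1)[OF f(1) that] by (simp add: W_def)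
    show "norm (f n x) \<le> weight_bound" if "x \<in> X" for n x using section_bound[OF f(1) _ that] f(2) by simp
  qed (rule that)
  have "l \<in> sections \<pi>"
    unfolding sections_def
  proof (intro CollectI ballI conjI)
    fix x assume x: "x \<in> X"
    show lW: "l x \<in> W" using r(2)[OF x] by (simp add: W_def)
    show "inner (l x) v = 0" if "v \<in> invariants \<pi>" for v
    proof -
      have "(\<lambda>n. inner (f (r n) x) v) \<longlonglongrightarrow> inner (l x) v" by (intro tendsto_inner r(3)[OF x] tendsto_const)
      moreover have "inner (f (r n) x) v = 0" for n using sectionsD(2)[OF f(1) x that] .
      ultimately show ?thesis using LIMSEQ_unique[OF _ tendsto_const[of 0]] by simp
    qed
    show "l (act g x) = \<pi> g (l x)" if g: "g \<in> carrier \<Gamma>" for g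
    proof -
      \<comment> \<open>\<open>\<pi> g\<close> is isometric only on W and need not be continuous on
        the whole type; its isometry on differences in W replaces continuity.\<close>
      have "norm (f (r n) (act g x) - \<pi> g (l x)) = norm (f (r n) x - l x)" for n
        using sectionsD(3)[OF f(1) x g] rep(1)[OF g] rep(5)[OF g W_diff[OF sectionsD(1)[OF f(1) x] lW]]
        by (simp add: linear_diff)
      moreover have "(\<lambda>n. norm (f (r n) x - l x)) \<longlonglongrightarrow> 0"
        by (rule tendsto_norm_zero[OF LIM_zero[OF r(3)[OF x]]])
      ultimately have "(\<lambda>n. norm (f (r n) (act g x) - \<pi> g (l x))) \<longlonglongrightarrow> 0" by simp
      then have "(\<lambda>n. f (r n) (act g x) - \<pi> g (l x)) \<longlonglongrightarrow> 0" by (rule tendsto_norm_zero_cancel)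
      then have "(\<lambda>n. f (r n) (act g x)) \<longlonglongrightarrow> \<pi> g (l x)" by (rule LIM_zero_cancel)
      then show ?thesis using r(3)[OF act_closed[OF g x]] by (rule LIMSEQ_unique[rotated])
    qed
  qed
  moreover have ipl: "ip l l = 1"
    using tendsto_ip[of "\<lambda>n. f (r n)" l, OF r(3)] by (simp add: f(2) LIMSEQ_const_iff)
  moreover have "en l l \<le> \<mu>"
  proof (rule LIMSEQ_le[OF tendsto_en[of "\<lambda>n. f (r n)" l, OF r(3)]])
    have "(\<lambda>n. \<mu> + 1 / real (Suc n)) \<longlonglongrightarrow> \<mu>"
      using LIMSEQ_inverse_real_of_nat_add[of \<mu>] by (simp only: inverse_eq_divide)
    from LIMSEQ_subseq_LIMSEQ[OF this r(1)] show "(\<lambda>n. \<mu> + 1 / real (Suc (r n))) \<longlonglongrightarrow> \<mu>"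
      unfolding o_def .
    show "\<exists>N. \<forall>n\<ge>N. en (f (r n)) (f (r n)) \<le> \<mu> + 1 / real (Suc (r n))"
      using f(3) less_imp_le by blast
  qed
  moreover have "\<mu> * ip g g \<le> en g g" if g: "g \<in> sections \<pi>" for g
  proof (cases "ip g g = 0")
    case False
    then have pos: "0 < ip g g" using ip_nonneg[of g] by linarith
    obtain f where f: "f \<in> sections \<pi>" "ip f f = 1" "en f f = en g g / ip g g" using normalize[OF g pos] by blast
    have "\<mu> \<le> en g g / ip g g" using lower[OF f(1,2)] f(3) by simp
    then show ?thesis using pos by (simp add: field_simps)
  qed (simp add: en_nonneg)
  moreover from this have "en l l * ip g g \<le> en g g" if "g \<in> sections \<pi>" for g
    using mult_right_mono[OF calculation(3) ip_nonneg[of g]] calculation(4)[OF that] by linarith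
  ultimately show ?thesis by blast
qed

lemma eigensection:
  assumes "u \<in> sections \<pi>" "0 < ip u u"
  shows "\<exists>f\<in>sections \<pi>. ip f f = 1 \<and> 0 < en f f \<and> en f f \<le> en u u / ip u u \<and>
    (\<forall>x\<in>X. lap f x = - (en f f / 2) *\<^sub>R f x)"
proof -
  obtain f where f: "f \<in> sections \<pi>" "ip f f = 1" and min: "\<forall>g\<in>sections \<pi>. en f f * ip g g \<le> en g g"
    using minimizer[OF assms] by blast
  define \<mu> where "\<mu> = en f f"
  \<comment> \<open>The Euler-Lagrange equation: \<open>f + t g\<close> does not beat f, so the
    coefficient linear in t vanishes.\<close>
  have EL: "en f g = \<mu> * ip f g" if g: "g \<in> sections \<pi>" for g
  proof -
    have "0 \<le> 2 * t * (en f g - \<mu> * ip f g) + t\<^sup>2 * (en g g - \<mu> * ip g g)" for t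
      using min[rule_format, OF sections_lincomb[OF f(1) g, of 1 t]]
      unfolding ip_bilinear en_bilinear f(2) \<mu>_def by (simp add: algebra_simps)
    moreover have "0 \<le> en g g - \<mu> * ip g g" using min g by (simp add: \<mu>_def)
    ultimately have "en f g - \<mu> * ip f g = 0" by (rule quadratic_nonneg_imp_linear_zero)
    then show ?thesis by simp
  qed
  \<comment> \<open>The residual of the eigenvalue equation is itself a section. Testing the
    Euler-Lagrange equation and \<open>green\<close> against it shows that its norm is 0.\<close>
  define g where "g = (\<lambda>x. 1 *\<^sub>R lap f x + (\<mu> / 2) *\<^sub>R f x)"
  have g: "g \<in> sections \<pi>" unfolding g_def by (rule sections_lincomb[OF lap_section[OF f(1)] f(1)])
  have "ip (lap f) g = - (\<mu> / 2) * ip f g" using EL[OF g] green[OF f(1) g] by simp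
  moreover have "ip g g = ip (lap f) g + (\<mu> / 2) * ip f g"
    unfolding ip_def sum_distrib_left sum.distrib[symmetric]
    by (rule sum.cong[OF refl]) (simp add: g_def inner_add_left algebra_simps)
  ultimately have "ip g g = 0" by simp
  then have g0: "g r = 0" if "r \<in> R" for r using ip_zeroD that by blast
  have lap: "lap f x = - (\<mu> / 2) *\<^sub>R f x" if x: "x \<in> X" for x
  proof -
    obtain k r where k: "k \<in> carrier \<Gamma>" "r \<in> R" "x = act k r" using orbits_meet_R[OF x] by blast
    have "g x = \<pi> k (g r)" unfolding k(3) by (rule sectionsD(3)[OF g R_in[OF k(2)] k(1)])
    then have "g x = 0" using g0[OF k(2)] linear_0[OF rep(1)[OF k(1)]] by simp
    then show ?thesis by (simp add: g_def eq_neg_iff_add_eq_0)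
  qed
  \<comment> \<open>With energy 0, f would be constant; equivariance makes the constant invariant,
    and orthogonality to the invariants makes it 0, against \<open>ip f f = 1\<close>.\<close>
  have "\<mu> \<noteq> 0"
  proof
    assume "\<mu> = 0"
    have edge: "f y = f x" if xy: "(x, y) \<in> E" for x y
    proof -
      have V: "x \<in> X" "y \<in> X" using E_in xy by auto
      obtain k r where k: "k \<in> carrier \<Gamma>" "r \<in> R" "x = act k r" using orbits_meet_R[OF V(1)] by blast
      define z where "z = act (inv k) y"
      have z: "y = act k z" "z \<in> X" using act_inv(2)[OF k(1) V(2)] act_closed[of "inv k", OF _ V(2)] k(1) by (auto simp: z_def)
      have "(r, z) \<in> E"
        using E_act[of "inv k", OF _ xy] k act_inv(1)[OF k(1) R_in[OF k(2)]] by (simp add: z_def)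
      then have "wt r * (norm (f z - f r))\<^sup>2 \<le> 0" using en_ge[OF k(2), of z f] \<open>\<mu> = 0\<close> by (simp add: \<mu>_def)
      then have "(norm (f z - f r))\<^sup>2 \<le> 0" using wt_pos[OF R_in[OF k(2)]] by (simp add: mult_le_0_iff)
      then have "f z = f r" by simp
      then show ?thesis using sectionsD(3)[OF f(1) _ k(1)] z R_in[OF k(2)] k(3) by simp
    qed
    obtain r where r: "r \<in> R" using R_nonempty by blast
    have const: "f x = f r" if "x \<in> X" for x
      using E_connected[OF R_in[OF r] that] by (induction rule: rtrancl_induct) (simp_all add: edge)
    have "f r \<in> invariants \<pi>"
      unfolding invariants_def
      using sectionsD(1)[OF f(1) R_in[OF r]] sectionsD(3)[OF f(1) R_in[OF r]] const[OF act_closed[OF _ R_in[OF r]]]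
      by simp
    then have "f x = 0" if "x \<in> X" for x
      using sectionsD(2)[OF f(1) that] const[OF that] by (metis inner_eq_zero_iff)
    then have "ip f f = 0" by (simp add: ip_def R_in)
    then show False using f(2) by simp
  qed
  then have "0 < \<mu>" using en_nonneg[of f] by (simp add: \<mu>_def)
  moreover have "\<mu> \<le> en u u / ip u u"
    using min assms by (simp add: \<mu>_def pos_le_divide_eq)
  ultimately show ?thesis using f lap unfolding \<mu>_def by blast
qed

end
end

section \<open>From almost invariant vectors to sections of small energy\<close>

context graph_action_dim
begin

text \<open>The elements that occur in the averages over R and over the neighbours of R, which are
  all the points that \<open>ip\<close> and \<open>en\<close> look at.\<close>

definition test_set :: "'g set" where
  "test_set = (\<Union>x\<in>R \<union> E `` R. transporter x)"

lemma finite_test_set: "finite test_set"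
proof -
  have "E `` R = (\<Union>x\<in>R. E `` {x})" by auto
  then have "finite (E `` R)" using finite_R E_finite[OF R_in] by simp
  moreover have "x \<in> X" if "x \<in> R \<union> E `` R" for x using that R_in E_in by blast
  ultimately show ?thesis unfolding test_set_def using finite_R transporter(1) by (intro finite_UN_I) auto
qed

lemma test_set_carrier: "test_set \<subseteq> carrier \<Gamma>"
  by (auto simp: test_set_def transporter_def)

definition mass :: real where "mass = (\<Sum>x\<in>R. wt x)"

definition edge_mass :: real where "edge_mass = (\<Sum>x\<in>R. wt x * real (card (E `` {x})))"

lemma mass_pos: "0 < mass"
  unfolding mass_def using R_nonempty finite_R wt_pos R_in by (intro sum_pos) auto

text \<open>Averaging the translates of w over the transporter of x gives an equivariant map u,
  which on R and its neighbours stays within \<epsilon> |w| of w. There |u| is at least |w| / 2 and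
  increments are at most 2 \<epsilon> |w|, so the quotient of energy and norm carries the factor 4 /
  (1 / 4) = 16.\<close>

lemma averaged_section:
  assumes \<pi>: "isometric_rep \<pi>" and w: "w \<in> W" "w \<noteq> 0" "\<And>v. v \<in> invariants \<pi> \<Longrightarrow> inner w v = 0"
    and \<epsilon>: "\<And>g. g \<in> test_set \<Longrightarrow> norm (\<pi> g w - w) \<le> \<epsilon> * norm w" "0 \<le> \<epsilon>" "\<epsilon> \<le> 1 / 2"
  shows "\<exists>u\<in>sections \<pi>. 0 < ip u u \<and> en u u / ip u u \<le> 16 * edge_mass / mass * \<epsilon>\<^sup>2"
proof -
  note rep = rep[OF \<pi>]
  define u where "u = (\<lambda>x. wt x *\<^sub>R (\<Sum>g\<in>transporter x. \<pi> g w))"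
  have tc: "g \<in> carrier \<Gamma>" if "g \<in> transporter x" for g x using that by (simp add: transporter_def)
  have u: "u \<in> sections \<pi>"
    unfolding sections_def
  proof (intro CollectI ballI conjI)
    fix x assume x: "x \<in> X"
    show "u x \<in> W" unfolding u_def
      by (intro real_vector.subspace_scale real_vector.subspace_sum W_subspace rep(2)[OF tc w(1)])
    show "inner (u x) v = 0" if v: "v \<in> invariants \<pi>" for v
    proof -
      have "inner (\<pi> g w) v = 0" if g: "g \<in> transporter x" for g
      proof -
        have "v \<in> W" "\<pi> g v = v" using v tc[OF g] by (auto simp: invariants_def)
        then show ?thesis using rep(3)[OF tc[OF g] w(1), of v] w(3)[OF v] by simp
      qed
      then show ?thesis by (simp add: u_def inner_sum_left)
    qed
    show "u (act k x) = \<pi> k (u x)" if k: "k \<in> carrier \<Gamma>" for k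
    proof -
      have inj: "inj_on (\<lambda>g. k \<otimes> g) (transporter x)" using k tc by (auto simp: inj_on_def)
      have "u (act k x) = wt x *\<^sub>R (\<Sum>g\<in>transporter x. \<pi> (k \<otimes> g) w)"
        unfolding u_def wt_act[OF k x] transporter_act[OF k x] sum.reindex[OF inj] by simp
      also have "\<dots> = wt x *\<^sub>R (\<Sum>g\<in>transporter x. \<pi> k (\<pi> g w))"
        using rep(4)[OF k tc w(1)] by simp
      also have "\<dots> = \<pi> k (u x)"
        unfolding u_def linear_scale[OF rep(1)[OF k]] linear_sum[OF rep(1)[OF k]] ..
      finally show ?thesis .
    qed
  qed
  have near: "norm (u x - w) \<le> \<epsilon> * norm w" if x: "x \<in> R \<union> E `` R" for x
  proof -
    have xX: "x \<in> X" using x R_in E_in by blast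
    note tr = transporter[OF xX]
    have wt1: "wt x * real (card (transporter x)) = 1" using tr by (simp add: wt_def)
    have "u x - w = wt x *\<^sub>R (\<Sum>g\<in>transporter x. \<pi> g w - w)"
      using wt1 by (simp add: u_def sum_subtractf scaleR_diff_right sum_constant_scaleR)
    then have "norm (u x - w) = wt x * norm (\<Sum>g\<in>transporter x. \<pi> g w - w)"
      using wt_pos[OF xX] by simp
    also have "\<dots> \<le> wt x * (\<Sum>g\<in>transporter x. \<epsilon> * norm w)"
      using \<epsilon>(1) x wt_pos[OF xX] by (intro mult_left_mono sum_norm_le) (auto simp: test_set_def)
    also have "\<dots> = (wt x * real (card (transporter x))) * (\<epsilon> * norm w)" by simp
    finally show ?thesis unfolding wt1 by simp
  qed
  have wpos: "0 < norm w" using w(2) by simp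
  have low: "wt x * ((norm w)\<^sup>2 / 4) \<le> wt x * inner (u x) (u x)" if x: "x \<in> R" for x
  proof -
    have "norm w \<le> norm (u x) + norm (u x - w)"
      using norm_triangle_ineq4[of "u x" "u x - w"] by simp
    moreover have "\<epsilon> * norm w \<le> 1 / 2 * norm w" using \<epsilon>(3) by (intro mult_right_mono) auto
    ultimately have "norm w / 2 \<le> norm (u x)" using near[of x] x by simp
    then have "(norm w / 2)\<^sup>2 \<le> (norm (u x))\<^sup>2" by (intro power_mono) auto
    then show ?thesis using wt_pos[OF R_in[OF x]] by (simp add: power2_norm_eq_inner power_divide)
  qed
  have ip: "mass * ((norm w)\<^sup>2 / 4) \<le> ip u u"
    unfolding mass_def ip_def sum_distrib_right by (rule sum_mono) (rule low)
  have ip_pos: "0 < ip u u"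
    using ip mass_pos wpos by (smt (verit) divide_pos_pos mult_pos_pos zero_less_power)
  have "en u u \<le> edge_mass * (4 * \<epsilon>\<^sup>2 * (norm w)\<^sup>2)"
    unfolding edge_mass_def en_def sum_distrib_right
  proof (rule sum_mono)
    fix x assume x: "x \<in> R"
    have "inner (u y - u x) (u y - u x) \<le> 4 * \<epsilon>\<^sup>2 * (norm w)\<^sup>2" if y: "y \<in> E `` {x}" for y
    proof -
      have "norm (u y - u x) \<le> norm (u y - w) + norm (u x - w)"
        using norm_triangle_ineq4[of "u y - w" "u x - w"] by simp
      also have "y \<in> R \<union> E `` R" using x y by blast
      then have "norm (u y - w) + norm (u x - w) \<le> 2 * \<epsilon> * norm w" using near[of x] near[of y] x by simp
      finally have "(norm (u y - u x))\<^sup>2 \<le> (2 * \<epsilon> * norm w)\<^sup>2" by (intro power_mono) auto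
      then show ?thesis by (simp add: power2_norm_eq_inner power_mult_distrib)
    qed
    then have "(\<Sum>y\<in>E `` {x}. inner (u y - u x) (u y - u x)) \<le> real (card (E `` {x})) * (4 * \<epsilon>\<^sup>2 * (norm w)\<^sup>2)"
      by (rule sum_bounded_above)
    then show "wt x * (\<Sum>y\<in>E `` {x}. inner (u y - u x) (u y - u x)) \<le>
        wt x * real (card (E `` {x})) * (4 * \<epsilon>\<^sup>2 * (norm w)\<^sup>2)"
      using wt_pos[OF R_in[OF x]] by (simp add: mult.assoc)
  qed
  also have "\<dots> = (16 * edge_mass / mass * \<epsilon>\<^sup>2) * (mass * ((norm w)\<^sup>2 / 4))"
    using mass_pos by simp
  also have "\<dots> \<le> (16 * edge_mass / mass * \<epsilon>\<^sup>2) * ip u u"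
  proof (rule mult_left_mono[OF ip])
    have "0 \<le> edge_mass" unfolding edge_mass_def using wt_pos[OF R_in]
      by (intro sum_nonneg mult_nonneg_nonneg) (auto simp: less_imp_le)
    then show "0 \<le> 16 * edge_mass / mass * \<epsilon>\<^sup>2" using mass_pos by simp
  qed
  finally have "en u u / ip u u \<le> 16 * edge_mass / mass * \<epsilon>\<^sup>2"
    using ip_pos by (simp add: pos_divide_le_eq)
  with u ip_pos show ?thesis by blast
qed

text \<open>
  If the spectral gap failed, renormalized eigensections for eigenvalues tending to \<open>0\<close> would
  converge to a non-constant harmonic map.
\<close>

theorem spectral_gap:
  assumes rigid: "\<And>h :: 'x \<Rightarrow> 'j \<Rightarrow>\<^sub>0 complex. (\<And>x. x \<in> X \<Longrightarrow> h x \<in> W) \<Longrightarrow>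
      (\<And>g x y x' y'. g \<in> carrier \<Gamma> \<Longrightarrow> x \<in> X \<Longrightarrow> y \<in> X \<Longrightarrow> x' \<in> X \<Longrightarrow> y' \<in> X \<Longrightarrow>
        inner (h (act g x) - h (act g y)) (h (act g x') - h (act g y')) = inner (h x - h y) (h x' - h y')) \<Longrightarrow>
      (\<And>x. x \<in> X \<Longrightarrow> lap h x = 0) \<Longrightarrow> (\<And>x y. x \<in> X \<Longrightarrow> y \<in> X \<Longrightarrow> h x = h y)"
  shows "\<exists>\<epsilon>>0. \<forall>\<pi> w. isometric_rep \<pi> \<longrightarrow> w \<in> W \<longrightarrow> (\<forall>v\<in>invariants \<pi>. inner w v = 0) \<longrightarrow>
    (\<forall>g\<in>test_set. norm (\<pi> g w - w) \<le> \<epsilon> * norm w) \<longrightarrow> w = 0"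
proof (rule ccontr)
  assume neg: "\<not> ?thesis"
  define K where "K = 16 * edge_mass / mass"
  define B where "B = weight_bound"
  define P where "P = (\<lambda>\<epsilon> \<pi> w. isometric_rep \<pi> \<and> w \<in> W \<and> (\<forall>v\<in>invariants \<pi>. inner w v = 0) \<and>
    (\<forall>g\<in>test_set. norm (\<pi> g w - w) \<le> \<epsilon> * norm w) \<and> w \<noteq> 0)"
  have P: "\<exists>\<pi> w. P \<epsilon> \<pi> w" if "0 < \<epsilon>" for \<epsilon>
    using neg that unfolding P_def by blast
  define Q where "Q = (\<lambda>n p. isometric_rep (fst p) \<and> snd p \<in> sections (fst p) \<and> ip (snd p) (snd p) = 1 \<and>
    0 < en (snd p) (snd p) \<and> en (snd p) (snd p) \<le> K * (1 / real (Suc (Suc n)))\<^sup>2 \<and>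
    (\<forall>x\<in>X. lap (snd p) x = - (en (snd p) (snd p) / 2) *\<^sub>R snd p x))"
  have "\<exists>p. Q n p" for n
  proof -
    \<comment> \<open>The index starts at 2 because \<open>averaged_section\<close> requires
      \<epsilon> to be at most 1 / 2.\<close>
    have small: "0 < 1 / real (Suc (Suc n))" "1 / real (Suc (Suc n)) \<le> 1 / 2" by simp_all
    obtain \<pi> w where Pw: "P (1 / real (Suc (Suc n))) \<pi> w" using P[OF small(1)] by blast
    then have \<pi>: "isometric_rep \<pi>" and w: "w \<in> W" "w \<noteq> 0" "\<And>v. v \<in> invariants \<pi> \<Longrightarrow> inner w v = 0"
      "\<And>g. g \<in> test_set \<Longrightarrow> norm (\<pi> g w - w) \<le> 1 / real (Suc (Suc n)) * norm w"
      unfolding P_def by blast+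
    obtain u where u: "u \<in> sections \<pi>" "0 < ip u u" "en u u / ip u u \<le> K * (1 / real (Suc (Suc n)))\<^sup>2"
      using averaged_section[OF \<pi> w less_imp_le[OF small(1)] small(2)] unfolding K_def by blast
    obtain f where f: "f \<in> sections \<pi>" "ip f f = 1" "0 < en f f" "en f f \<le> en u u / ip u u"
      "\<forall>x\<in>X. lap f x = - (en f f / 2) *\<^sub>R f x"
      using eigensection[OF \<pi> u(1,2)] by blast
    have "Q n (\<pi>, f)" unfolding Q_def fst_conv snd_conv
      using \<pi> f(1,2,3,5) order_trans[OF f(4) u(3)] by blast
    then show ?thesis by blast
  qed
  then have "\<forall>n. \<exists>p. Q n p" by blast
  from choice[OF this] obtain p where p: "\<And>n. Q n (p n)" by blast
  define \<pi> where "\<pi> = (\<lambda>n. fst (p n))"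
  define f where "f = (\<lambda>n. snd (p n))"
  have \<pi>: "isometric_rep (\<pi> n)" and f: "f n \<in> sections (\<pi> n)" "ip (f n) (f n) = 1"
    "0 < en (f n) (f n)" "en (f n) (f n) \<le> K * (1 / real (Suc (Suc n)))\<^sup>2"
    and lap: "\<forall>x\<in>X. lap (f n) x = - (en (f n) (f n) / 2) *\<^sub>R f n x" for n
    using p[of n] unfolding Q_def \<pi>_def f_def by blast+
  define e where "e = (\<lambda>n. sqrt (en (f n) (f n)))"
  have epos: "0 < e n" for n using f(3) by (simp add: e_def)
  have e2: "(e n)\<^sup>2 = en (f n) (f n)" for n using f(3)[of n] by (simp add: e_def)
  have e0: "e \<longlonglongrightarrow> 0"
  proof -
    have "(\<lambda>n. K * (1 / real (Suc (Suc n)))\<^sup>2) \<longlonglongrightarrow> K * 0\<^sup>2"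
      by (rule tendsto_mult[OF tendsto_const tendsto_power[OF LIMSEQ_Suc[OF LIMSEQ_Suc[OF lim_1_over_n]]]])
    then have "(\<lambda>n. K * (1 / real (Suc (Suc n)))\<^sup>2) \<longlonglongrightarrow> 0" by simp
    note lim = this
    have "norm (en (f n) (f n)) \<le> K * (1 / real (Suc (Suc n)))\<^sup>2" for n using f(3,4)[of n] by simp
    from Lim_null_comparison[OF always_eventually[OF allI[OF this]] lim]
    have "(\<lambda>n. en (f n) (f n)) \<longlonglongrightarrow> 0" .
    from tendsto_real_sqrt[OF this] show ?thesis by (simp add: e_def)
  qed
  obtain x0 where x0: "x0 \<in> X" using X_nonempty by blast
  \<comment> \<open>Dividing by the root of the energy normalises the energy to 1. The values of f
    divided by e may be unbounded, hence the subtraction of the value at x0.\<close>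
  define h where "h = (\<lambda>n x. (1 / e n) *\<^sub>R (f n x - f n x0))"
  have h_diff: "h n x - h n y = (1 / e n) *\<^sub>R (f n x - f n y)" for n x y
    by (simp add: h_def scaleR_diff_right)
  have fW: "f n x \<in> W" if "x \<in> X" for n x using sectionsD(1)[OF \<pi> f(1) that] .
  have hW: "h n x \<in> W" if "x \<in> X" for n x
    unfolding h_def by (intro real_vector.subspace_scale W_subspace W_diff fW that x0)
  have h_gram: "inner (h n (act g x) - h n (act g y)) (h n (act g x') - h n (act g y')) = inner (h n x - h n y) (h n x' - h n y')"
    if "g \<in> carrier \<Gamma>" "x \<in> X" "y \<in> X" "x' \<in> X" "y' \<in> X" for n g x y x' y'
    unfolding h_diff using gram_sections[OF \<pi> f(1) f(1) that] by simp
  have h_en: "en (h n) (h n) = 1" for n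
  proof -
    have "en (h n) (h n) = (1 / e n)\<^sup>2 * en (f n) (f n)"
      unfolding en_def h_diff sum_distrib_left
      by (rule sum.cong[OF refl], rule sum.cong[OF refl]) (simp add: power2_eq_square)
    then show ?thesis using epos[of n] by (simp add: e2[symmetric] power_divide)
  qed
  \<comment> \<open>The eigenvalue is of order e^2 and the rescaling costs only 1 / e, so the
    Laplacian of \<open>h n\<close> is of order \<open>e n\<close> and the limit is
    harmonic.\<close>
  have h_lap: "norm (lap (h n) x) \<le> e n * (B / 2)" if x: "x \<in> X" for n x
  proof -
    have "lap (h n) x = (1 / e n) *\<^sub>R lap (f n) x"
      unfolding lap_def h_diff scaleR_sum_right ..
    also have "\<dots> = - ((1 / e n) * ((e n)\<^sup>2 / 2)) *\<^sub>R f n x" using lap[of n] x by (simp add: e2)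
    also have "(1 / e n) * ((e n)\<^sup>2 / 2) = e n / 2" using epos[of n] by (simp add: power2_eq_square)
    finally have "norm (lap (h n) x) = e n / 2 * norm (f n x)" using epos[of n] by simp
    also have "\<dots> \<le> e n / 2 * B"
      unfolding B_def using section_bound[OF \<pi> f(1) _ x] f(2) epos[of n] by (intro mult_left_mono) auto
    finally show ?thesis by simp
  qed
  have h_edge: "norm (h n y - h n x) \<le> B" if xy: "(x, y) \<in> E" for n x y
  proof -
    have V: "x \<in> X" "y \<in> X" using E_in xy by auto
    obtain k r where k: "k \<in> carrier \<Gamma>" "r \<in> R" "x = act k r" using orbits_meet_R[OF V(1)] by blast
    define z where "z = act (inv k) y"
    have z: "y = act k z" "z \<in> X" using act_inv(2)[OF k(1) V(2)] act_closed[of "inv k", OF _ V(2)] k(1) by (auto simp: z_def)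
    have "(r, z) \<in> E"
      using E_act[of "inv k", OF _ xy] k act_inv(1)[OF k(1) R_in[OF k(2)]] by (simp add: z_def)
    then have "norm (h n z - h n r) \<le> B" unfolding B_def using en_bound[OF k(2), of z "h n"] h_en by simp
    moreover have "norm (h n y - h n x) = norm (h n z - h n r)"
      using h_gram[OF k(1) z(2) R_in[OF k(2)] z(2) R_in[OF k(2)], of n] z(1) k(3) by (simp add: norm_eq_sqrt_inner)
    ultimately show ?thesis by simp
  qed
  \<comment> \<open>Edge increments are at most B, so a path from x0, where \<open>h n\<close>
    vanishes, bounds each value independently of n.\<close>
  have "\<exists>b. \<forall>n. norm (h n x) \<le> b" if "x \<in> X" for x
    using E_connected[OF x0 that]
  proof (induction rule: rtrancl_induct)
    case base
    show ?case by (intro exI[of _ 0]) (simp add: h_def)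
  next
    case (step y z)
    then obtain b where b: "\<forall>n. norm (h n y) \<le> b" by blast
    have "norm (h n z) \<le> b + B" for n
      using norm_triangle_ineq[of "h n y" "h n z - h n y"] b[rule_format, of n] h_edge[OF step(2), of n] by simp
    then show ?case by blast
  qed
  then obtain b where b: "\<And>x n. x \<in> X \<Longrightarrow> norm (h n x) \<le> b x" by metis
  obtain r l where r: "strict_mono r" "\<And>x. x \<in> X \<Longrightarrow> keys (l x) \<subseteq> J" "\<And>x. x \<in> X \<Longrightarrow> (\<lambda>n. h (r n) x) \<longlonglongrightarrow> l x"
  proof (rule pointwise_convergent_subsequence[OF finite_J countable_X, of h b])
    show "keys (h n x) \<subseteq> J" if "x \<in> X" for n x using hW[OF that] by (simp add: W_def)
  qed (use b that in blast)+
  have "l x = l y" if xy: "x \<in> X" "y \<in> X" for x y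
  proof (rule rigid[OF _ _ _ xy])
    show "l x \<in> W" if "x \<in> X" for x using r(2)[OF that] by (simp add: W_def)
    show "lap l x = 0" if x: "x \<in> X" for x
    proof -
      have "(\<lambda>n. lap (h (r n)) x) \<longlonglongrightarrow> lap l x"
        unfolding lap_def
      proof (intro tendsto_sum tendsto_diff)
        show "(\<lambda>n. h (r n) y) \<longlonglongrightarrow> l y" if "y \<in> E `` {x}" for y by (rule r(3)) (use that E_in in blast)
      qed (rule r(3)[OF x])
      moreover have "(\<lambda>n. lap (h (r n)) x) \<longlonglongrightarrow> 0"
      proof (rule Lim_null_comparison[OF always_eventually[OF allI[OF h_lap[OF x]]]])
        have "(\<lambda>n. e (r n) * (B / 2)) \<longlonglongrightarrow> 0 * (B / 2)"
          using LIMSEQ_subseq_LIMSEQ[OF e0 r(1)] unfolding o_def by (intro tendsto_mult tendsto_const)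
        then show "(\<lambda>n. e (r n) * (B / 2)) \<longlonglongrightarrow> 0" by simp
      qed
      ultimately show ?thesis by (rule LIMSEQ_unique)
    qed
    fix g x y x' y' assume g: "g \<in> carrier \<Gamma>" "x \<in> X" "y \<in> X" "x' \<in> X" "y' \<in> X"
    have "(\<lambda>n. inner (h (r n) x - h (r n) y) (h (r n) x' - h (r n) y')) \<longlonglongrightarrow> inner (l x - l y) (l x' - l y')"
      by (intro tendsto_inner tendsto_diff r(3) g)
    moreover have "(\<lambda>n. inner (h (r n) x - h (r n) y) (h (r n) x' - h (r n) y')) \<longlonglongrightarrow>
        inner (l (act g x) - l (act g y)) (l (act g x') - l (act g y'))"
      unfolding h_gram[OF g, symmetric] by (intro tendsto_inner tendsto_diff r(3) act_closed g)
    ultimately show "inner (l (act g x) - l (act g y)) (l (act g x') - l (act g y')) = inner (l x - l y) (l x' - l y')"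
      by (rule LIMSEQ_unique[rotated])
  qed
  \<comment> \<open>A constant limit has energy 0, whereas the energy 1 of \<open>h n\<close>, a
    finite sum, passes to the limit.\<close>
  then have "l y - l x = 0" if "x \<in> R" "y \<in> E `` {x}" for x y
    using that E_in R_in by (metis Image_singleton_iff right_minus_eq)
  then have "en l l = 0" by (simp add: en_def)
  moreover have "en l l = 1"
    using tendsto_en[of "\<lambda>n. h (r n)" l, OF r(3)] by (simp add: h_en LIMSEQ_const_iff)
  ultimately show False by simp
qed

end

section \<open>Unitary intertwiners\<close>

text \<open>The ambient space need not be complete, so the projection is built by Gram-Schmidt: a
  new vector c is made orthogonal to the old span, and the projection onto the remainder e is added
  to p.\<close>

lemma orthogonal_projection_exists:
  fixes S :: "'w :: real_inner set"
  assumes "Real_Vector_Spaces.subspace S" "finite B" "S \<subseteq> Real_Vector_Spaces.span B"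
  shows "\<exists>p\<in>S. \<forall>v\<in>S. inner (x - p) v = 0"
proof -
  have perp: "inner z v = 0" if "v \<in> Real_Vector_Spaces.span C" "\<And>c. c \<in> C \<Longrightarrow> inner z c = 0" for z v :: 'w and C
    using that(1) by (induction rule: real_vector.span_induct_alt) (simp_all add: inner_add_right that(2))
  have fin: "\<exists>p\<in>Real_Vector_Spaces.span C. \<forall>v\<in>C. inner (x - p) v = 0" if "finite C" for C and x :: 'w
    using that
  proof (induction C arbitrary: x rule: finite_induct)
    case empty
    show ?case by (intro bexI[of _ 0]) (simp_all add: real_vector.span_zero)
  next
    case (insert c C)
    have mono: "v \<in> Real_Vector_Spaces.span (insert c C)" if "v \<in> Real_Vector_Spaces.span C" for v
      using that real_vector.span_mono[OF subset_insertI[of C c]] by blast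
    obtain p where p: "p \<in> Real_Vector_Spaces.span C" "\<forall>v\<in>C. inner (x - p) v = 0" using insert.IH by blast
    obtain q where q: "q \<in> Real_Vector_Spaces.span C" "\<forall>v\<in>C. inner (c - q) v = 0" using insert.IH by blast
    define e where "e = c - q"
    have xq: "inner (x - p) q = 0" and eq: "inner e q = 0"
      using perp[OF q(1)] p(2) q(2) by (auto simp: e_def)
    \<comment> \<open>If e = 0, the quotient is 0 by the convention for division by zero, and
      \<open>te\<close> still holds.\<close>
    define t where "t = inner (x - p) e / inner e e"
    have "e \<in> Real_Vector_Spaces.span (insert c C)"
      unfolding e_def by (intro real_vector.span_diff mono[OF q(1)] real_vector.span_base) simp
    then have mem: "p + t *\<^sub>R e \<in> Real_Vector_Spaces.span (insert c C)"
      by (intro real_vector.span_add mono[OF p(1)] real_vector.span_scale)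
    have te: "t * inner e e = inner (x - p) e" by (cases "e = 0") (simp_all add: t_def)
    have "inner (x - (p + t *\<^sub>R e)) v = 0" if "v \<in> insert c C" for v
    proof (cases "v = c")
      case True
      have c: "c = q + e" by (simp add: e_def)
      have "inner (x - (p + t *\<^sub>R e)) v = inner (x - p) v - t * inner e v"
        by (simp add: inner_diff_left inner_add_left)
      also have "\<dots> = 0" unfolding True c inner_add_right using xq eq te by simp
      finally show ?thesis .
    next
      case False
      then have "v \<in> C" using that by simp
      then show ?thesis using p(2) q(2) by (simp add: e_def[symmetric] inner_diff_left inner_add_left)
    qed
    then show ?case using mem by blast
  qed
  obtain C where C: "C \<subseteq> S" "\<not> Real_Vector_Spaces.dependent C" "S \<subseteq> Real_Vector_Spaces.span C"
    using real_vector.maximal_independent_subset[of S] by blast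
  have "finite C" using real_vector.independent_span_bound[OF assms(2) C(2)] C(1) assms(3) by blast
  from fin[OF this, of x] obtain p where p: "p \<in> Real_Vector_Spaces.span C" "\<forall>v\<in>C. inner (x - p) v = 0" by blast
  have "p \<in> S" using real_vector.span_minimal[OF C(1) assms(1)] p(1) by blast
  moreover have "inner (x - p) v = 0" if "v \<in> S" for v using perp[of v C "x - p"] C(3) p(2) that by blast
  ultimately show ?thesis by blast
qed

section \<open>Matrices as vectors: adjoint, trace and the Hilbert-Schmidt norm\<close>

lemma mult_entry:
  fixes A B :: "complex mat"
  assumes "A \<in> carrier_mat d d" "B \<in> carrier_mat d d" "i < d" "j < d"
  shows "(A * B) $$ (i, j) = (\<Sum>k<d. A $$ (i, k) * B $$ (k, j))"
  using assms by (simp add: scalar_prod_def lessThan_atLeast0)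

lemma adjoint_carrier [simp]: "A \<in> carrier_mat d d \<Longrightarrow> mat_adjoint A \<in> carrier_mat d d"
  unfolding mat_adjoint_def by (rule carrier_matI) auto

lemma adjoint_entry [simp]:
  fixes A :: "complex mat"
  assumes "A \<in> carrier_mat d d" "i < d" "j < d"
  shows "mat_adjoint A $$ (i, j) = cnj (A $$ (j, i))"
  using assms by (simp add: mat_adjoint_def mat_of_rows_index)

lemma adjoint_adjoint [simp]:
  fixes A :: "complex mat"
  assumes "A \<in> carrier_mat d d" shows "mat_adjoint (mat_adjoint A) = A"
proof (rule eq_matI)
  note c = adjoint_carrier[OF assms]
  show "dim_row (mat_adjoint (mat_adjoint A)) = dim_row A" "dim_col (mat_adjoint (mat_adjoint A)) = dim_col A"
    using carrier_matD[OF assms] carrier_matD[OF adjoint_carrier[OF c]] by simp_all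
  fix i j assume "i < dim_row A" "j < dim_col A"
  then have "i < d" "j < d" using carrier_matD[OF assms] by simp_all
  then show "mat_adjoint (mat_adjoint A) $$ (i, j) = A $$ (i, j)"
    using adjoint_entry[OF c, of i j] adjoint_entry[OF assms, of j i] by simp
qed

lemma adjoint_mult:
  fixes A B :: "complex mat"
  assumes "A \<in> carrier_mat d d" "B \<in> carrier_mat d d"
  shows "mat_adjoint (A * B) = mat_adjoint B * mat_adjoint A"
proof (rule eq_matI)
  have AB: "A * B \<in> carrier_mat d d" using assms by simp
  note c = adjoint_carrier[OF assms(1)] adjoint_carrier[OF assms(2)] adjoint_carrier[OF AB]
  show "dim_row (mat_adjoint (A * B)) = dim_row (mat_adjoint B * mat_adjoint A)"
    "dim_col (mat_adjoint (A * B)) = dim_col (mat_adjoint B * mat_adjoint A)"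
    using carrier_matD[OF c(1)] carrier_matD[OF c(2)] carrier_matD[OF c(3)] by simp_all
  fix i j assume "i < dim_row (mat_adjoint B * mat_adjoint A)" "j < dim_col (mat_adjoint B * mat_adjoint A)"
  then have ij: "i < d" "j < d" using carrier_matD[OF c(1)] carrier_matD[OF c(2)] by simp_all
  have "mat_adjoint (A * B) $$ (i, j) = (\<Sum>k<d. cnj (A $$ (j, k)) * cnj (B $$ (k, i)))"
    unfolding adjoint_entry[OF AB ij] mult_entry[OF assms ij(2,1)] by simp
  also have "\<dots> = (mat_adjoint B * mat_adjoint A) $$ (i, j)"
    unfolding mult_entry[OF c(2,1) ij] using ij assms by (intro sum.cong refl) simp
  finally show "mat_adjoint (A * B) $$ (i, j) = (mat_adjoint B * mat_adjoint A) $$ (i, j)" .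
qed

text \<open>Under this identification the inner product of finitely supported functions is the real
  part of the Hilbert-Schmidt product, see \<open>inner_coords\<close>.\<close>

definition coords :: "nat \<Rightarrow> complex mat \<Rightarrow> (nat \<times> nat) \<Rightarrow>\<^sub>0 complex" where
  "coords d A = Abs_poly_mapping (\<lambda>(i, j). if i < d \<and> j < d then A $$ (i, j) else 0)"

definition mat_of :: "nat \<Rightarrow> ((nat \<times> nat) \<Rightarrow>\<^sub>0 complex) \<Rightarrow> complex mat" where
  "mat_of d v = Matrix.mat d d (lookup v)"

abbreviation "sq d \<equiv> {..<d} \<times> {..<(d::nat)}"

lemma lookup_coords: "lookup (coords d A) (i, j) = (if i < d \<and> j < d then A $$ (i, j) else 0)"
proof -
  have "{p. (\<lambda>(i, j). if i < d \<and> j < d then A $$ (i, j) else 0) p \<noteq> 0} \<subseteq> sq d"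
    by (auto split: if_splits)
  then have "finite {p. (\<lambda>(i, j). if i < d \<and> j < d then A $$ (i, j) else 0) p \<noteq> 0}"
    by (rule finite_subset) simp
  then show ?thesis by (simp add: coords_def)
qed

lemma keys_coords: "keys (coords d A) \<subseteq> sq d"
  by (auto simp: in_keys_iff lookup_coords split: if_splits)

lemma mat_of_carrier [simp]: "mat_of d v \<in> carrier_mat d d"
  by (simp add: mat_of_def)

lemma mat_of_entry [simp]: "i < d \<Longrightarrow> j < d \<Longrightarrow> mat_of d v $$ (i, j) = lookup v (i, j)"
  by (simp add: mat_of_def)

lemma mat_of_coords: "A \<in> carrier_mat d d \<Longrightarrow> mat_of d (coords d A) = A"
  by (intro eq_matI) (auto simp: mat_of_def lookup_coords)

lemma coords_mat_of:
  assumes v: "keys v \<subseteq> sq d" shows "coords d (mat_of d v) = v"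
proof (rule poly_mapping_eqI)
  fix p :: "nat \<times> nat"
  obtain i j where p: "p = (i, j)" by force
  have "lookup v p = 0" if "p \<notin> sq d" using v that by (meson in_keys_iff subsetD)
  then show "lookup (coords d (mat_of d v)) p = lookup v p" by (auto simp: lookup_coords p)
qed

lemma mat_of_add: "mat_of d (v + w) = mat_of d v + mat_of d w"
  by (rule eq_matI) (auto simp: mat_of_def lookup_add)

lemma mat_of_diff: "mat_of d (v - w) = mat_of d v - mat_of d w"
  by (rule eq_matI) (auto simp: mat_of_def lookup_minus)

lemma mat_of_scaleR: "mat_of d (c *\<^sub>R v) = complex_of_real c \<cdot>\<^sub>m mat_of d v"
  by (rule eq_matI) (auto simp: mat_of_def scaleR_conv_of_real)

lemma coords_add:
  "A \<in> carrier_mat d d \<Longrightarrow> B \<in> carrier_mat d d \<Longrightarrow> coords d (A + B) = coords d A + coords d B"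
  by (rule poly_mapping_eqI) (auto simp: lookup_coords lookup_add split: prod.splits)

lemma coords_diff:
  "A \<in> carrier_mat d d \<Longrightarrow> B \<in> carrier_mat d d \<Longrightarrow> coords d (A - B) = coords d A - coords d B"
  by (rule poly_mapping_eqI) (auto simp: lookup_coords lookup_minus split: prod.splits)

lemma coords_smult:
  "A \<in> carrier_mat d d \<Longrightarrow> coords d (complex_of_real c \<cdot>\<^sub>m A) = c *\<^sub>R coords d A"
  by (rule poly_mapping_eqI) (auto simp: lookup_coords scaleR_conv_of_real split: prod.splits)

definition tr :: "nat \<Rightarrow> complex mat \<Rightarrow> complex" where
  "tr d A = (\<Sum>i<d. A $$ (i, i))"

lemma tr_comm:
  assumes "A \<in> carrier_mat d d" "B \<in> carrier_mat d d"
  shows "tr d (A * B) = tr d (B * A)"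
proof -
  have "tr d (A * B) = (\<Sum>i<d. \<Sum>k<d. A $$ (i, k) * B $$ (k, i))"
    unfolding tr_def by (rule sum.cong[OF refl]) (simp add: mult_entry[OF assms] del: index_mult_mat)
  also have "\<dots> = (\<Sum>k<d. \<Sum>i<d. A $$ (i, k) * B $$ (k, i))" by (rule sum.swap)
  also have "\<dots> = tr d (B * A)"
    unfolding tr_def by (rule sum.cong[OF refl]) (simp add: mult_entry[OF assms(2,1)] mult.commute del: index_mult_mat)
  finally show ?thesis .
qed

lemma inner_coords:
  assumes "A \<in> carrier_mat d d" "B \<in> carrier_mat d d"
  shows "inner (coords d A) (coords d B) = Re (tr d (A * mat_adjoint B))"
proof -
  have "inner (coords d A) (coords d B) = (\<Sum>p\<in>sq d. inner (lookup (coords d A) p) (lookup (coords d B) p))"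
    by (rule inner_poly_mapping_superset[OF _ keys_coords]) simp
  also have "\<dots> = (\<Sum>i<d. \<Sum>j<d. inner (A $$ (i, j)) (B $$ (i, j)))"
    unfolding sum.cartesian_product by (rule sum.cong[OF refl]) (auto simp: lookup_coords)
  also have "\<dots> = Re (tr d (A * mat_adjoint B))"
    unfolding tr_def Re_sum
  proof (rule sum.cong[OF refl])
    fix i assume "i \<in> {..<d}"
    then have i: "i < d" by simp
    show "(\<Sum>j<d. inner (A $$ (i, j)) (B $$ (i, j))) = Re ((A * mat_adjoint B) $$ (i, i))"
      unfolding mult_entry[OF assms(1) adjoint_carrier[OF assms(2)] i i] Re_sum
      by (rule sum.cong[OF refl]) (use i assms(2) in \<open>simp add: inner_complex_def\<close>)
  qed
  finally show ?thesis .
qed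

lemma norm_coords_sq:
  "(norm (coords d A))\<^sup>2 = (\<Sum>i<d. \<Sum>j<d. (cmod (A $$ (i, j)))\<^sup>2)"
proof -
  have "(norm (coords d A))\<^sup>2 = (\<Sum>p\<in>sq d. inner (lookup (coords d A) p) (lookup (coords d A) p))"
    unfolding power2_norm_eq_inner by (rule inner_poly_mapping_superset[OF _ keys_coords]) simp
  also have "\<dots> = (\<Sum>i<d. \<Sum>j<d. (cmod (A $$ (i, j)))\<^sup>2)"
    unfolding sum.cartesian_product by (rule sum.cong[OF refl]) (auto simp: lookup_coords power2_norm_eq_inner)
  finally show ?thesis .
qed

text \<open>Cauchy-Schwarz in each entry of the product; the resulting bound is a row sum times a
  column sum, so summing over the entries factors.\<close>

lemma norm_coords_mult_le:
  assumes "A \<in> carrier_mat d d" "B \<in> carrier_mat d d"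
  shows "norm (coords d (A * B)) \<le> norm (coords d A) * norm (coords d B)"
proof (rule power2_le_imp_le)
  have entry: "(cmod ((A * B) $$ (i, j)))\<^sup>2 \<le> (\<Sum>k<d. (cmod (A $$ (i, k)))\<^sup>2) * (\<Sum>k<d. (cmod (B $$ (k, j)))\<^sup>2)"
    if "i < d" "j < d" for i j
  proof -
    have "cmod ((A * B) $$ (i, j)) \<le> (\<Sum>k<d. cmod (A $$ (i, k)) * cmod (B $$ (k, j)))"
      unfolding mult_entry[OF assms that] by (rule order_trans[OF norm_sum]) (simp add: norm_mult)
    then have "(cmod ((A * B) $$ (i, j)))\<^sup>2 \<le> (\<Sum>k<d. cmod (A $$ (i, k)) * cmod (B $$ (k, j)))\<^sup>2"
      by (rule power_mono) simp
    also have "\<dots> \<le> (\<Sum>k<d. (cmod (A $$ (i, k)))\<^sup>2) * (\<Sum>k<d. (cmod (B $$ (k, j)))\<^sup>2)"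
      by (rule Cauchy_Schwarz_ineq_sum)
    finally show ?thesis .
  qed
  have "(norm (coords d (A * B)))\<^sup>2 \<le>
      (\<Sum>i<d. \<Sum>j<d. (\<Sum>k<d. (cmod (A $$ (i, k)))\<^sup>2) * (\<Sum>k<d. (cmod (B $$ (k, j)))\<^sup>2))"
    unfolding norm_coords_sq by (intro sum_mono entry) auto
  also have "\<dots> = (norm (coords d A))\<^sup>2 * (norm (coords d B))\<^sup>2"
    unfolding norm_coords_sq sum.swap[of "\<lambda>i j. (cmod (B $$ (i, j)))\<^sup>2"] by (simp add: sum_product)
  finally show "(norm (coords d (A * B)))\<^sup>2 \<le> (norm (coords d A) * norm (coords d B))\<^sup>2"
    by (simp add: power_mult_distrib)
qed simp

section \<open>Correcting an almost unitary intertwiner to a unitary one\<close>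

context
  fixes d :: nat
begin

abbreviation "Mats \<equiv> carrier_mat d d :: complex mat set"
abbreviation "nrm \<equiv> \<lambda>A. norm (coords d A)"

lemma Mats_closed:
  "A \<in> Mats \<Longrightarrow> B \<in> Mats \<Longrightarrow> A * B \<in> Mats" "A \<in> Mats \<Longrightarrow> B \<in> Mats \<Longrightarrow> A + B \<in> Mats"
  "A \<in> Mats \<Longrightarrow> B \<in> Mats \<Longrightarrow> A - B \<in> Mats" "A \<in> Mats \<Longrightarrow> c \<cdot>\<^sub>m A \<in> Mats" "1\<^sub>m d \<in> Mats"
  by auto

lemma Mats_assoc: "A \<in> Mats \<Longrightarrow> B \<in> Mats \<Longrightarrow> C \<in> Mats \<Longrightarrow> A * B * C = A * (B * C)"
  by (rule assoc_mult_mat)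

lemma Mats_distrib:
  "A \<in> Mats \<Longrightarrow> B \<in> Mats \<Longrightarrow> C \<in> Mats \<Longrightarrow> (A + B) * C = A * C + B * C"
  "A \<in> Mats \<Longrightarrow> B \<in> Mats \<Longrightarrow> C \<in> Mats \<Longrightarrow> A * (B + C) = A * B + A * C"
  "A \<in> Mats \<Longrightarrow> B \<in> Mats \<Longrightarrow> C \<in> Mats \<Longrightarrow> (A - B) * C = A * C - B * C"
  "A \<in> Mats \<Longrightarrow> B \<in> Mats \<Longrightarrow> C \<in> Mats \<Longrightarrow> A * (B - C) = A * B - A * C"
  by (rule add_mult_distrib_mat mult_add_distrib_mat minus_mult_distrib_mat mult_minus_distrib_mat; assumption)+

lemma Mats_one: "A \<in> Mats \<Longrightarrow> 1\<^sub>m d * A = A" "A \<in> Mats \<Longrightarrow> A * 1\<^sub>m d = A"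
  by auto

lemma adjoint_one: "mat_adjoint (1\<^sub>m d :: complex mat) = 1\<^sub>m d"
proof (rule eq_matI)
  note c = carrier_matD[OF adjoint_carrier[OF Mats_closed(5)]]
  show "dim_row (mat_adjoint (1\<^sub>m d :: complex mat)) = dim_row (1\<^sub>m d)"
    "dim_col (mat_adjoint (1\<^sub>m d :: complex mat)) = dim_col (1\<^sub>m d)" using c by simp_all
  fix i j assume "i < dim_row (1\<^sub>m d)" "j < dim_col (1\<^sub>m d)"
  then show "mat_adjoint (1\<^sub>m d :: complex mat) $$ (i, j) = 1\<^sub>m d $$ (i, j)"
    using adjoint_entry[OF Mats_closed(5), of i j] by simp
qed

lemma adjoint_diff:
  assumes "A \<in> Mats" "B \<in> Mats" shows "mat_adjoint (A - B) = mat_adjoint A - mat_adjoint B"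
proof (rule eq_matI)
  note AB = Mats_closed(3)[OF assms]
  note c = carrier_matD[OF assms(1)] carrier_matD[OF assms(2)] carrier_matD[OF adjoint_carrier[OF assms(1)]]
    carrier_matD[OF adjoint_carrier[OF assms(2)]] carrier_matD[OF adjoint_carrier[OF AB]]
  show "dim_row (mat_adjoint (A - B)) = dim_row (mat_adjoint A - mat_adjoint B)"
    "dim_col (mat_adjoint (A - B)) = dim_col (mat_adjoint A - mat_adjoint B)" using c by simp_all
  fix i j assume "i < dim_row (mat_adjoint A - mat_adjoint B)" "j < dim_col (mat_adjoint A - mat_adjoint B)"
  then have ij: "i < d" "j < d" using c by simp_all
  show "mat_adjoint (A - B) $$ (i, j) = (mat_adjoint A - mat_adjoint B) $$ (i, j)"
    unfolding adjoint_entry[OF AB ij] using ij c assms by simp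
qed

lemma adjoint_smult_real:
  assumes "A \<in> Mats" shows "mat_adjoint (complex_of_real c \<cdot>\<^sub>m A) = complex_of_real c \<cdot>\<^sub>m mat_adjoint A"
proof (rule eq_matI)
  note cA = Mats_closed(4)[OF assms, of "complex_of_real c"]
  note c = carrier_matD[OF assms] carrier_matD[OF adjoint_carrier[OF assms]] carrier_matD[OF adjoint_carrier[OF cA]]
  show "dim_row (mat_adjoint (complex_of_real c \<cdot>\<^sub>m A)) = dim_row (complex_of_real c \<cdot>\<^sub>m mat_adjoint A)"
    "dim_col (mat_adjoint (complex_of_real c \<cdot>\<^sub>m A)) = dim_col (complex_of_real c \<cdot>\<^sub>m mat_adjoint A)" using c by simp_all
  fix i j assume "i < dim_row (complex_of_real c \<cdot>\<^sub>m mat_adjoint A)" "j < dim_col (complex_of_real c \<cdot>\<^sub>m mat_adjoint A)"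
  then have ij: "i < d" "j < d" using c by simp_all
  show "mat_adjoint (complex_of_real c \<cdot>\<^sub>m A) $$ (i, j) = (complex_of_real c \<cdot>\<^sub>m mat_adjoint A) $$ (i, j)"
    unfolding adjoint_entry[OF cA ij] using ij c assms by simp
qed

text \<open>
  The Newton iteration \<open>M \<mapsto> M (3 - M\<^sup>* M) / 2\<close> for the polar decomposition improves
  \<open>M\<^sup>* M - 1\<close> quadratically.
\<close>

definition newton :: "complex mat \<Rightarrow> complex mat" where
  "newton M = complex_of_real (1 / 2) \<cdot>\<^sub>m (M * (1\<^sub>m d + 1\<^sub>m d - (mat_adjoint M * M - 1\<^sub>m d)))"

definition defect :: "complex mat \<Rightarrow> complex mat" where
  "defect M = mat_adjoint M * M - 1\<^sub>m d"

lemma newton_carrier: "M \<in> Mats \<Longrightarrow> newton M \<in> Mats"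
  unfolding newton_def by (intro Mats_closed adjoint_carrier)

lemma defect_carrier: "M \<in> Mats \<Longrightarrow> defect M \<in> Mats"
  unfolding defect_def by (intro Mats_closed adjoint_carrier)

text \<open>With C = 2 - B, \<open>newton M\<close> is half of M C, and the adjoint of M times M is
  1 + B. The formula is the expansion of (2 - B)^2 (1 + B) / 4 - 1 = (B^3 - 3 B^2) / 4.\<close>

lemma defect_newton:
  assumes M: "M \<in> Mats"
  defines "B \<equiv> defect M"
  shows "defect (newton M) = complex_of_real (1 / 4) \<cdot>\<^sub>m (B * (B * B) - (B * B + B * B + B * B))"
proof -
  have B: "B \<in> Mats" unfolding B_def by (rule defect_carrier[OF M])
  have adjM: "mat_adjoint M \<in> Mats" using M by (rule adjoint_carrier)
  have one: "1\<^sub>m d \<in> Mats" by simp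
  define C where "C = 1\<^sub>m d + 1\<^sub>m d - B"
  have C: "C \<in> Mats" unfolding C_def using B by (intro Mats_closed) auto
  have A: "mat_adjoint M * M = 1\<^sub>m d + B"
    unfolding B_def defect_def using Mats_closed(1)[OF adjM M] by (intro eq_matI) auto
  have adjB: "mat_adjoint B = B"
    unfolding B_def defect_def
    using M adjM by (simp add: adjoint_diff adjoint_mult[OF adjM M] adjoint_one Mats_closed)
  have adjC: "mat_adjoint C = C"
  proof -
    have "C = 1\<^sub>m d - (B - 1\<^sub>m d)" unfolding C_def using B by (intro eq_matI) auto
    then show ?thesis using B one
      by (simp add: adjoint_diff[OF one Mats_closed(3)[OF B one]] adjoint_diff[OF B one] adjoint_one adjB)
  qed
  have N: "newton M = complex_of_real (1 / 2) \<cdot>\<^sub>m (M * C)"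
    unfolding newton_def C_def B_def defect_def ..
  have MC: "M * C \<in> Mats" by (rule Mats_closed(1)[OF M C])
  have CAC: "C * ((1\<^sub>m d + B) * C) = 1\<^sub>m d + 1\<^sub>m d + 1\<^sub>m d + 1\<^sub>m d - (B * B + B * B + B * B) + B * (B * B)"
  proof -
    have BB: "B * B \<in> Mats" by (rule Mats_closed(1)[OF B B])
    have BBB: "B * (B * B) \<in> Mats" by (rule Mats_closed(1)[OF B BB])
    have 1: "(1\<^sub>m d + B) * C = 1\<^sub>m d + 1\<^sub>m d + B - B * B"
    proof -
      have "(1\<^sub>m d + B) * C = 1\<^sub>m d + B + (1\<^sub>m d + B) - (B + B * B)"
        unfolding C_def using B one by (simp only: Mats_distrib Mats_one Mats_closed)
      also have "\<dots> = 1\<^sub>m d + 1\<^sub>m d + B - B * B"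
        using carrier_matD[OF B] carrier_matD[OF BB]
        by (intro eq_matI) (simp_all del: index_mult_mat(1) assoc_mult_mat)
      finally show ?thesis .
    qed
    have X: "1\<^sub>m d + 1\<^sub>m d + B - B * B \<in> Mats" using B BB by (intro Mats_closed) auto
    have 2: "B * (1\<^sub>m d + 1\<^sub>m d + B - B * B) = B + B + B * B - B * (B * B)"
      using B one BB by (simp only: Mats_distrib Mats_one Mats_closed)
    have "C * (1\<^sub>m d + 1\<^sub>m d + B - B * B) = (1\<^sub>m d + 1\<^sub>m d + B - B * B) + (1\<^sub>m d + 1\<^sub>m d + B - B * B) - (B + B + B * B - B * (B * B))"
      unfolding C_def Mats_distrib(3)[OF Mats_closed(2)[OF one one] B X] Mats_distrib(1)[OF one one X] Mats_one(1)[OF X] 2 ..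
    also have "\<dots> = 1\<^sub>m d + 1\<^sub>m d + 1\<^sub>m d + 1\<^sub>m d - (B * B + B * B + B * B) + B * (B * B)"
      using carrier_matD[OF B] carrier_matD[OF BB] carrier_matD[OF BBB]
      by (intro eq_matI) (simp_all del: index_mult_mat(1) assoc_mult_mat)
    finally show ?thesis unfolding 1 .
  qed
  have "mat_adjoint (newton M) * newton M = (complex_of_real (1 / 2) \<cdot>\<^sub>m (C * mat_adjoint M)) * (complex_of_real (1 / 2) \<cdot>\<^sub>m (M * C))"
    unfolding N adjoint_smult_real[OF MC] adjoint_mult[OF M C] adjC ..
  also have "\<dots> = complex_of_real (1 / 4) \<cdot>\<^sub>m (C * mat_adjoint M * (M * C))"
  proof -
    have CM: "C * mat_adjoint M \<in> Mats" by (rule Mats_closed(1)[OF C adjM])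
    show ?thesis
      unfolding mult_smult_distrib[OF Mats_closed(4)[OF CM] MC] mult_smult_assoc_mat[OF CM MC]
      using carrier_matD[OF CM] carrier_matD[OF MC] by (intro eq_matI) (simp_all del: index_mult_mat(1) assoc_mult_mat)
  qed
  also have "C * mat_adjoint M * (M * C) = C * ((mat_adjoint M * M) * C)"
    using M C adjM by (simp only: Mats_assoc Mats_closed)
  also have "\<dots> = 1\<^sub>m d + 1\<^sub>m d + 1\<^sub>m d + 1\<^sub>m d - (B * B + B * B + B * B) + B * (B * B)"
    unfolding A by (rule CAC)
  finally have fin: "mat_adjoint (newton M) * newton M =
    complex_of_real (1 / 4) \<cdot>\<^sub>m (1\<^sub>m d + 1\<^sub>m d + 1\<^sub>m d + 1\<^sub>m d - (B * B + B * B + B * B) + B * (B * B))" .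
  have BB: "B * B \<in> Mats" and BBB: "B * (B * B) \<in> Mats" using B by (auto intro!: Mats_closed(1))
  show ?thesis
    unfolding defect_def[of "newton M"] fin using carrier_matD[OF B] carrier_matD[OF BB] carrier_matD[OF BBB]
    by (intro eq_matI) (simp_all del: index_mult_mat(1) assoc_mult_mat add: algebra_simps)
qed

text \<open>For b at most 1 the cubic term and each of the three quadratic ones have norm at most
  b^2, and the factor 1 / 4 absorbs their number.\<close>

lemma nrm_defect_newton:
  assumes "M \<in> Mats" "nrm (defect M) \<le> 1"
  shows "nrm (defect (newton M)) \<le> (nrm (defect M))\<^sup>2"
proof -
  define B where "B = defect M"
  define b where "b = nrm B"
  have B: "B \<in> Mats" unfolding B_def by (rule defect_carrier[OF assms(1)])
  note BB = Mats_closed(1)[OF B B] and BBB = Mats_closed(1)[OF B Mats_closed(1)[OF B B]]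
  note S2 = Mats_closed(2)[OF BB BB] and S3 = Mats_closed(2)[OF Mats_closed(2)[OF BB BB] BB]
  have b: "0 \<le> b" "b \<le> 1" using assms(2) by (simp_all add: b_def B_def)
  have nBB: "nrm (B * B) \<le> b\<^sup>2" using norm_coords_mult_le[OF B B] by (simp add: b_def power2_eq_square)
  have "nrm (B * (B * B)) \<le> b * nrm (B * B)" using norm_coords_mult_le[OF B BB] by (simp add: b_def)
  also have "\<dots> \<le> 1 * b\<^sup>2" using b nBB by (intro mult_mono) auto
  finally have nBBB: "nrm (B * (B * B)) \<le> b\<^sup>2" by simp
  have "coords d (defect (newton M)) = (1 / 4) *\<^sub>R (coords d (B * (B * B)) - (coords d (B * B) + coords d (B * B) + coords d (B * B)))"
    unfolding defect_newton[OF assms(1)] B_def[symmetric] coords_smult[OF Mats_closed(3)[OF BBB S3]]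
      coords_diff[OF BBB S3] coords_add[OF S2 BB] coords_add[OF BB BB] ..
  then have "nrm (defect (newton M)) = 1 / 4 * norm (coords d (B * (B * B)) - (coords d (B * B) + coords d (B * B) + coords d (B * B)))"
    by simp
  also have "\<dots> \<le> 1 / 4 * (nrm (B * (B * B)) + (nrm (B * B) + nrm (B * B) + nrm (B * B)))"
    by (intro mult_left_mono order_trans[OF norm_triangle_ineq4] add_mono order_refl
        order_trans[OF norm_triangle_ineq]) auto
  also have "\<dots> \<le> b\<^sup>2" using nBB nBBB by simp
  finally show ?thesis by (simp add: b_def B_def)
qed

lemma tendsto_coords_entry:
  assumes "(\<lambda>n. coords d (A n)) \<longlonglongrightarrow> l" "i < d" "j < d"
  shows "(\<lambda>n. A n $$ (i, j)) \<longlonglongrightarrow> mat_of d l $$ (i, j)"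
proof -
  have bound: "norm (A n $$ (i, j) - mat_of d l $$ (i, j)) \<le> norm (coords d (A n) - l)" for n
    using norm_lookup_le[of "coords d (A n) - l" "(i, j)"] assms(2,3) by (simp add: lookup_minus lookup_coords)
  have "(\<lambda>n. norm (coords d (A n) - l)) \<longlonglongrightarrow> 0"
    by (rule tendsto_norm_zero[OF LIM_zero[OF assms(1)]])
  from Lim_null_comparison[OF always_eventually[OF allI[OF bound]] this] show ?thesis
    by (rule LIM_zero_cancel)
qed

lemma tendsto_mult_entry:
  assumes "\<And>n. A n \<in> Mats" "\<And>n. B n \<in> Mats" "A' \<in> Mats" "B' \<in> Mats" "i < d" "j < d"
    "\<And>i j. i < d \<Longrightarrow> j < d \<Longrightarrow> (\<lambda>n. A n $$ (i, j)) \<longlonglongrightarrow> A' $$ (i, j)"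
    "\<And>i j. i < d \<Longrightarrow> j < d \<Longrightarrow> (\<lambda>n. B n $$ (i, j)) \<longlonglongrightarrow> B' $$ (i, j)"
  shows "(\<lambda>n. (A n * B n) $$ (i, j)) \<longlonglongrightarrow> (A' * B') $$ (i, j)"
  unfolding mult_entry[OF assms(1,2,5,6)] mult_entry[OF assms(3,4,5,6)]
  by (intro tendsto_sum tendsto_mult assms(7,8)) (use assms(5,6) in auto)

lemma tendsto_nrm_defect:
  assumes "\<And>n. A n \<in> Mats" "(\<lambda>n. coords d (A n)) \<longlonglongrightarrow> l"
  shows "(\<lambda>n. nrm (defect (A n))) \<longlonglongrightarrow> nrm (defect (mat_of d l))"
proof (rule tendsto_norm, rule tendsto_poly_mapping[where J = "sq d"])
  fix p assume "p \<in> sq d"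
  then obtain i j where p: "p = (i, j)" "i < d" "j < d" by auto
  have L: "mat_of d l \<in> Mats" by simp
  have ent: "(\<lambda>n. A n $$ (i, j)) \<longlonglongrightarrow> mat_of d l $$ (i, j)" if "i < d" "j < d" for i j
    by (rule tendsto_coords_entry[OF assms(2) that])
  have "(\<lambda>n. (mat_adjoint (A n) * A n) $$ (i, j)) \<longlonglongrightarrow> (mat_adjoint (mat_of d l) * mat_of d l) $$ (i, j)"
  proof (rule tendsto_mult_entry[OF adjoint_carrier[OF assms(1)] assms(1) adjoint_carrier[OF L] L p(2,3) _ ent])
    show "(\<lambda>n. mat_adjoint (A n) $$ (i, j)) \<longlonglongrightarrow> mat_adjoint (mat_of d l) $$ (i, j)" if "i < d" "j < d" for i j
      unfolding adjoint_entry[OF assms(1) that] adjoint_entry[OF L that] by (intro tendsto_cnj ent that)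
  qed
  moreover have "lookup (coords d (defect M)) p = (mat_adjoint M * M) $$ (i, j) - 1\<^sub>m d $$ (i, j)" if "M \<in> Mats" for M
    using p Mats_closed(1)[OF adjoint_carrier[OF that] that]
    by (simp add: lookup_coords defect_def del: index_mult_mat(1))
  ultimately show "(\<lambda>n. lookup (coords d (defect (A n))) p) \<longlonglongrightarrow> lookup (coords d (defect (mat_of d l))) p"
    using assms(1) L by (simp del: index_mult_mat(1) index_one_mat(1)) (intro tendsto_diff tendsto_const)
qed (use keys_coords in auto)

text \<open>The diagonal entries of the adjoint of M times M are the squared norms of the columns,
  each within distance 1 of 1. The bound provides compactness when the defect is minimised.\<close>

lemma nrm_bound:
  assumes "M \<in> Mats" "nrm (defect M) \<le> 1" shows "nrm M \<le> sqrt (2 * real d)"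
proof -
  have col: "(\<Sum>i<d. (cmod (M $$ (i, j)))\<^sup>2) \<le> 2" if j: "j < d" for j
  proof -
    have aM: "mat_adjoint M * M \<in> Mats" by (rule Mats_closed(1)[OF adjoint_carrier[OF assms(1)] assms(1)])
    have "(mat_adjoint M * M) $$ (j, j) = of_real (\<Sum>i<d. (cmod (M $$ (i, j)))\<^sup>2)"
      unfolding mult_entry[OF adjoint_carrier[OF assms(1)] assms(1) j j] of_real_sum
    proof (rule sum.cong[OF refl])
      fix i assume "i \<in> {..<d}"
      then have "mat_adjoint M $$ (j, i) = cnj (M $$ (i, j))" using assms(1) j by simp
      then show "mat_adjoint M $$ (j, i) * M $$ (i, j) = of_real ((cmod (M $$ (i, j)))\<^sup>2)"
        by (metis complex_norm_square mult.commute)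
    qed
    moreover have "lookup (coords d (defect M)) (j, j) = (mat_adjoint M * M) $$ (j, j) - 1"
      using j carrier_matD[OF aM] by (simp add: lookup_coords defect_def del: index_mult_mat(1))
    moreover have "cmod (lookup (coords d (defect M)) (j, j)) \<le> 1"
      using norm_lookup_le[of "coords d (defect M)" "(j, j)"] assms(2) by simp
    ultimately have "cmod (of_real ((\<Sum>i<d. (cmod (M $$ (i, j)))\<^sup>2) - 1)) \<le> 1" by simp
    then show ?thesis unfolding norm_of_real by linarith
  qed
  have "(nrm M)\<^sup>2 = (\<Sum>j<d. \<Sum>i<d. (cmod (M $$ (i, j)))\<^sup>2)"
    unfolding norm_coords_sq by (rule sum.swap)
  also have "\<dots> \<le> (\<Sum>j<d. 2)" by (intro sum_mono col) simp
  finally have "(nrm M)\<^sup>2 \<le> 2 * real d" by simp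
  then show ?thesis by (rule real_le_rsqrt)
qed

text \<open>Among the intertwiners with defect norm below 1, compactness yields one with minimal
  defect. A Newton step at this minimiser gives an intertwiner again and would decrease the defect
  unless it is 0.\<close>

lemma unitary_intertwiner:
  assumes \<sigma>: "\<And>g. g \<in> S \<Longrightarrow> \<sigma> g \<in> carrier (unitary_group d)"
    and \<tau>: "\<And>g. g \<in> S \<Longrightarrow> \<tau> g \<in> carrier (unitary_group d)"
    and M: "M \<in> Mats" "\<And>g. g \<in> S \<Longrightarrow> \<sigma> g * M = M * \<tau> g" "nrm (defect M) < 1"
  shows "\<exists>U\<in>carrier (unitary_group d). \<forall>g\<in>S. \<sigma> g * U = U * \<tau> g"
proof -
  have \<sigma>u: "\<sigma> g \<in> Mats" "mat_adjoint (\<sigma> g) * \<sigma> g = 1\<^sub>m d" "\<sigma> g * mat_adjoint (\<sigma> g) = 1\<^sub>m d" if "g \<in> S" for g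
    using \<sigma>[OF that] by (simp_all add: unitary_group_def)
  have \<tau>u: "\<tau> g \<in> Mats" "mat_adjoint (\<tau> g) * \<tau> g = 1\<^sub>m d" "\<tau> g * mat_adjoint (\<tau> g) = 1\<^sub>m d" if "g \<in> S" for g
    using \<tau>[OF that] by (simp_all add: unitary_group_def)
  define K where "K = {M \<in> Mats. (\<forall>g\<in>S. \<sigma> g * M = M * \<tau> g) \<and> nrm (defect M) < 1}"
  have MK: "M \<in> K" using M by (simp add: K_def)
  define \<mu> where "\<mu> = Inf ((\<lambda>M. nrm (defect M)) ` K)"
  have bdd: "bdd_below ((\<lambda>M. nrm (defect M)) ` K)" by (rule bdd_belowI[of _ 0]) auto
  have lower: "\<mu> \<le> nrm (defect M)" if "M \<in> K" for M
    unfolding \<mu>_def by (rule cInf_lower[OF _ bdd]) (use that in auto)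
  have "\<exists>A\<in>K. nrm (defect A) < \<mu> + 1 / real (Suc n)" for n
  proof -
    have "Inf ((\<lambda>M. nrm (defect M)) ` K) < \<mu> + 1 / real (Suc n)" by (simp add: \<mu>_def)
    then show ?thesis using cInf_lessD[of "(\<lambda>M. nrm (defect M)) ` K"] MK by blast
  qed
  then have "\<forall>n. \<exists>A. A \<in> K \<and> nrm (defect A) < \<mu> + 1 / real (Suc n)" by blast
  from choice[OF this] obtain A where A: "\<And>n. A n \<in> K" "\<And>n. nrm (defect (A n)) < \<mu> + 1 / real (Suc n)" by blast
  have AM: "A n \<in> Mats" and Ag: "\<And>g. g \<in> S \<Longrightarrow> \<sigma> g * A n = A n * \<tau> g" and A1: "nrm (defect (A n)) \<le> 1" for n
    using A(1)[of n] by (auto simp: K_def)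
  \<comment> \<open>The one-point index set \<open>{()}\<close> specialises the pointwise statement
    to a single bounded sequence.\<close>
  obtain r and l :: "unit \<Rightarrow> (nat \<times> nat) \<Rightarrow>\<^sub>0 complex" where r: "strict_mono (r :: nat \<Rightarrow> nat)" "(\<lambda>n. coords d (A (r n))) \<longlonglongrightarrow> l ()"
  proof (rule pointwise_convergent_subsequence[of "sq d" "{()}" "\<lambda>n _. coords d (A n)" "\<lambda>_. sqrt (2 * real d)"])
    fix r and l :: "unit \<Rightarrow> (nat \<times> nat) \<Rightarrow>\<^sub>0 complex"
    assume "strict_mono (r :: nat \<Rightarrow> nat)" "\<And>x. x \<in> {()} \<Longrightarrow> (\<lambda>n. coords d (A (r n))) \<longlonglongrightarrow> l x"
    then show thesis using that by blast
  qed (use keys_coords nrm_bound[OF AM A1] in auto)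
  define L where "L = mat_of d (l ())"
  have L: "L \<in> Mats" by (simp add: L_def)
  have ent: "(\<lambda>n. A (r n) $$ (i, j)) \<longlonglongrightarrow> L $$ (i, j)" if "i < d" "j < d" for i j
    unfolding L_def by (rule tendsto_coords_entry[OF r(2) that])
  have Lg: "\<sigma> g * L = L * \<tau> g" if g: "g \<in> S" for g
  proof (rule eq_matI)
    show "dim_row (\<sigma> g * L) = dim_row (L * \<tau> g)" "dim_col (\<sigma> g * L) = dim_col (L * \<tau> g)"
      using carrier_matD[OF L] carrier_matD[OF \<sigma>u(1)[OF g]] carrier_matD[OF \<tau>u(1)[OF g]] by simp_all
    fix i j assume "i < dim_row (L * \<tau> g)" "j < dim_col (L * \<tau> g)"
    then have ij: "i < d" "j < d" using carrier_matD[OF L] carrier_matD[OF \<tau>u(1)[OF g]] by simp_all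
    have "(\<lambda>n. (\<sigma> g * A (r n)) $$ (i, j)) \<longlonglongrightarrow> (\<sigma> g * L) $$ (i, j)"
      by (rule tendsto_mult_entry[OF \<sigma>u(1)[OF g] AM \<sigma>u(1)[OF g] L ij tendsto_const ent])
    moreover have "(\<lambda>n. (A (r n) * \<tau> g) $$ (i, j)) \<longlonglongrightarrow> (L * \<tau> g) $$ (i, j)"
      by (rule tendsto_mult_entry[OF AM \<tau>u(1)[OF g] L \<tau>u(1)[OF g] ij ent tendsto_const])
    ultimately show "(\<sigma> g * L) $$ (i, j) = (L * \<tau> g) $$ (i, j)"
      unfolding Ag[OF g] by (rule LIMSEQ_unique)
  qed
  have L_le: "nrm (defect L) \<le> \<mu>"
  proof (rule LIMSEQ_le)
    show "(\<lambda>n. nrm (defect (A (r n)))) \<longlonglongrightarrow> nrm (defect L)"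
      unfolding L_def by (rule tendsto_nrm_defect[OF AM r(2)])
    have "(\<lambda>n. \<mu> + 1 / real (Suc n)) \<longlonglongrightarrow> \<mu>"
      using LIMSEQ_inverse_real_of_nat_add[of \<mu>] by (simp only: inverse_eq_divide)
    from LIMSEQ_subseq_LIMSEQ[OF this r(1)] show "(\<lambda>n. \<mu> + 1 / real (Suc (r n))) \<longlonglongrightarrow> \<mu>"
      unfolding o_def .
    show "\<exists>N. \<forall>n\<ge>N. nrm (defect (A (r n))) \<le> \<mu> + 1 / real (Suc (r n))"
      by (intro exI[of _ 0] allI impI less_imp_le A(2))
  qed
  have \<mu>1: "\<mu> < 1" using lower[OF MK] M(3) by linarith
  have L1: "nrm (defect L) \<le> 1" using L_le \<mu>1 by linarith
  have "newton L \<in> K \<or> \<not> nrm (defect (newton L)) < 1"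
  proof -
    have aL: "mat_adjoint L \<in> Mats" by (rule adjoint_carrier[OF L])
    have "\<sigma> g * newton L = newton L * \<tau> g" if g: "g \<in> S" for g
    proof -
      note s = \<sigma>u[OF g] and t = \<tau>u[OF g]
      note as = adjoint_carrier[OF s(1)] and at = adjoint_carrier[OF t(1)]
      \<comment> \<open>By unitarity the adjoint of L intertwines in the opposite direction, so the
        product of that adjoint with L commutes with \<open>\<tau> g\<close>. Hence the correction
        factor C does, too.\<close>
      have "mat_adjoint L * mat_adjoint (\<sigma> g) = mat_adjoint (\<tau> g) * mat_adjoint L"
        using arg_cong[OF Lg[OF g], of mat_adjoint] adjoint_mult[OF s(1) L] adjoint_mult[OF L t(1)] by simp
      then have "\<tau> g * (mat_adjoint L * mat_adjoint (\<sigma> g)) * \<sigma> g = \<tau> g * (mat_adjoint (\<tau> g) * mat_adjoint L) * \<sigma> g" by simp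
      moreover have "\<tau> g * (mat_adjoint L * mat_adjoint (\<sigma> g)) * \<sigma> g = \<tau> g * mat_adjoint L"
        using s t as aL by (simp only: Mats_assoc Mats_closed Mats_one)
      moreover have "\<tau> g * (mat_adjoint (\<tau> g) * mat_adjoint L) * \<sigma> g = (\<tau> g * mat_adjoint (\<tau> g)) * (mat_adjoint L * \<sigma> g)"
        using s(1) t(1) at aL by (simp only: Mats_assoc Mats_closed)
      ultimately have comm: "mat_adjoint L * \<sigma> g = \<tau> g * mat_adjoint L"
        using t(3) Mats_one(1)[OF Mats_closed(1)[OF aL s(1)]] by simp
      define C where "C = 1\<^sub>m d + 1\<^sub>m d - (mat_adjoint L * L - 1\<^sub>m d)"
      have C: "C \<in> Mats" unfolding C_def using L aL by (intro Mats_closed) auto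
      have "(mat_adjoint L * L) * \<tau> g = mat_adjoint L * (\<sigma> g * L)"
        using L aL t(1) Lg[OF g] by (simp only: Mats_assoc Mats_closed)
      also have "\<dots> = (mat_adjoint L * \<sigma> g) * L" using L aL s(1) by (simp only: Mats_assoc Mats_closed)
      also have "\<dots> = \<tau> g * (mat_adjoint L * L)" unfolding comm using L aL t(1) by (simp only: Mats_assoc Mats_closed)
      finally have "C * \<tau> g = \<tau> g * C"
        unfolding C_def using L aL t(1) by (simp only: Mats_distrib Mats_one Mats_closed)
      moreover have "\<sigma> g * (L * C) = (\<sigma> g * L) * C" "L * (C * \<tau> g) = (L * C) * \<tau> g" "L * (\<tau> g * C) = (L * \<tau> g) * C"
        using L C s(1) t(1) by (simp_all only: Mats_assoc Mats_closed)
      ultimately have "\<sigma> g * (L * C) = (L * C) * \<tau> g" using Lg[OF g] by simp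
      then show ?thesis
        unfolding newton_def C_def[symmetric]
        using mult_smult_distrib[OF s(1) Mats_closed(1)[OF L C]] mult_smult_assoc_mat[OF Mats_closed(1)[OF L C] t(1)] by simp
    qed
    then show ?thesis using newton_carrier[OF L] by (auto simp: K_def)
  qed
  moreover have sq: "nrm (defect (newton L)) \<le> (nrm (defect L))\<^sup>2" by (rule nrm_defect_newton[OF L L1])
  moreover have "(nrm (defect L))\<^sup>2 \<le> nrm (defect L)"
    using L1 by (simp add: power2_eq_square mult_left_le)
  ultimately have "newton L \<in> K" using L_le \<mu>1 by linarith
  \<comment> \<open>If c is the norm of the defect of L, then c is at most \<mu>, which is at most
    c^2; as c < 1, this forces c = 0.\<close>
  then have "\<mu> \<le> (nrm (defect L))\<^sup>2" using lower sq by (meson order_trans)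
  then have "nrm (defect L) \<le> nrm (defect L) * nrm (defect L)" using L_le by (simp add: power2_eq_square)
  moreover have "nrm (defect L) < 1" using L_le \<mu>1 by linarith
  ultimately have "nrm (defect L) = 0"
    by (metis mult_less_cancel_right2 norm_ge_zero not_less order_less_le)
  then have "coords d (defect L) = 0" by simp
  then have "defect L = mat_of d 0" using mat_of_coords[OF defect_carrier[OF L]] by simp
  then have "mat_adjoint L * L = 1\<^sub>m d"
  proof -
    have aL: "mat_adjoint L * L \<in> Mats" by (rule Mats_closed(1)[OF adjoint_carrier[OF L] L])
    have "(mat_adjoint L * L) $$ (i, j) - 1\<^sub>m d $$ (i, j) = 0" if "i < d" "j < d" for i j
      using arg_cong[OF \<open>defect L = mat_of d 0\<close>, of "\<lambda>M. M $$ (i, j)"] that carrier_matD[OF aL]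
      by (simp add: defect_def del: index_mult_mat(1))
    then show ?thesis using carrier_matD[OF aL] by (intro eq_matI) (simp_all del: index_mult_mat(1))
  qed
  moreover from this have "L * mat_adjoint L = 1\<^sub>m d"
    by (rule mat_mult_left_right_inverse[OF adjoint_carrier[OF L] L])
  ultimately have "L \<in> carrier (unitary_group d)" using L by (simp add: unitary_group_def)
  then show ?thesis by (rule bexI[rotated]) (intro ballI Lg)
qed

end

section \<open>Isomorphism types of unitary representations\<close>

lemma floor_eq_imp_close: "\<lfloor>a\<rfloor> = \<lfloor>b\<rfloor> \<Longrightarrow> \<bar>a - b\<bar> \<le> (1 :: real)"
  using floor_correct[of a] floor_correct[of b] by linarith

lemma norm_coords_adjoint:
  assumes "A \<in> carrier_mat d d" shows "norm (coords d (mat_adjoint A)) = norm (coords d A)"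
proof -
  have "(norm (coords d (mat_adjoint A)))\<^sup>2 = (\<Sum>i<d. \<Sum>j<d. (cmod (A $$ (j, i)))\<^sup>2)"
    unfolding norm_coords_sq using assms by (intro sum.cong refl) simp
  also have "\<dots> = (norm (coords d A))\<^sup>2" unfolding norm_coords_sq by (rule sum.swap)
  finally show ?thesis by (simp add: power2_eq_iff_nonneg)
qed

text \<open>The squared norm is the trace d of the identity. The cruder bound d + 1 avoids the root
  and stays positive for d = 0.\<close>

lemma norm_coords_unitary:
  assumes "A \<in> carrier (unitary_group d)" shows "norm (coords d A) \<le> real d + 1"
proof -
  have A: "A \<in> carrier_mat d d" "A * mat_adjoint A = 1\<^sub>m d" using assms by (auto simp: unitary_group_def)
  have "(norm (coords d A))\<^sup>2 = Re (tr d (1\<^sub>m d))"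
    unfolding power2_norm_eq_inner inner_coords[OF A(1) A(1)] A(2) ..
  also have "\<dots> = real d" by (simp add: tr_def)
  also have "\<dots> \<le> (real d + 1)\<^sup>2" by (simp add: power2_eq_square algebra_simps)
  finally show ?thesis by (rule power2_le_imp_le) simp
qed

text \<open>With N the matrix of w, the defect of 1 - N consists of the product of the adjoint of N
  with N, minus N and its adjoint. Its norm is below 1 / 16 + 1 / 4 + 1 / 4.\<close>

lemma defect_near_one:
  assumes w: "keys w \<subseteq> sq d" "norm w < 1 / 4"
  shows "norm (coords d (defect d (mat_of d (coords d (1\<^sub>m d) - w)))) < 1"
proof -
  define N where "N = mat_of d w"
  have N: "N \<in> carrier_mat d d" and aN: "mat_adjoint N \<in> carrier_mat d d" by (simp_all add: N_def)
  have one: "1\<^sub>m d \<in> carrier_mat d d" by simp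
  have aNN: "mat_adjoint N * N \<in> carrier_mat d d" by (rule Mats_closed(1)[OF aN N])
  have P: "mat_of d (coords d (1\<^sub>m d) - w) = 1\<^sub>m d - N"
    unfolding mat_of_diff mat_of_coords[OF one] N_def ..
  have "defect d (1\<^sub>m d - N) = mat_adjoint N * N - N - mat_adjoint N"
  proof -
    have "mat_adjoint (1\<^sub>m d - N) * (1\<^sub>m d - N) = (1\<^sub>m d - mat_adjoint N) * (1\<^sub>m d - N)"
      unfolding adjoint_diff[OF one N] adjoint_one ..
    also have "\<dots> = 1\<^sub>m d - N - (mat_adjoint N - mat_adjoint N * N)"
      unfolding Mats_distrib(3)[OF one aN Mats_closed(3)[OF one N]] Mats_one(1)[OF Mats_closed(3)[OF one N]]
        Mats_distrib(4)[OF aN one N] Mats_one(2)[OF aN] ..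
    finally show ?thesis
      unfolding defect_def using carrier_matD[OF N] carrier_matD[OF aN] carrier_matD[OF aNN]
      by (intro eq_matI) (simp_all del: index_mult_mat(1))
  qed
  then have "coords d (defect d (1\<^sub>m d - N)) = coords d (mat_adjoint N * N) - coords d N - coords d (mat_adjoint N)"
    by (simp add: coords_diff[OF Mats_closed(3)[OF aNN N] aN] coords_diff[OF aNN N])
  moreover have nN: "norm (coords d N) = norm w" "norm (coords d (mat_adjoint N)) = norm w"
    using coords_mat_of[OF w(1)] norm_coords_adjoint[OF N] by (simp_all add: N_def)
  moreover have "norm (coords d (mat_adjoint N * N)) \<le> norm w * norm w"
    using norm_coords_mult_le[OF aN N] unfolding nN .
  moreover have "norm w * norm w \<le> 1 / 4 * (1 / 4)" using w(2) by (intro mult_mono) auto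
  ultimately have "norm (coords d (defect d (1\<^sub>m d - N))) \<le> 1 / 16 + norm w + norm w"
    using norm_triangle_ineq4[of "coords d (mat_adjoint N * N) - coords d N" "coords d (mat_adjoint N)"]
      norm_triangle_ineq4[of "coords d (mat_adjoint N * N)" "coords d N"] by simp
  then show ?thesis unfolding P using w(2) by simp
qed

lemma unitarily_equivalent_sym:
  assumes "group G" "(\<rho>, \<sigma>) \<in> unitarily_equivalent G d" shows "(\<sigma>, \<rho>) \<in> unitarily_equivalent G d"
proof -
  obtain U where U: "\<rho> \<in> unitary_reps G d" "\<sigma> \<in> unitary_reps G d" "U \<in> carrier (unitary_group d)"
    "\<forall>g\<in>carrier G. U * \<rho> g = \<sigma> g * U" using assms(2) by (auto simp: unitarily_equivalent_def)
  have Uc: "U \<in> carrier_mat d d" "mat_adjoint U * U = 1\<^sub>m d" "U * mat_adjoint U = 1\<^sub>m d" using U(3) by (auto simp: unitary_group_def)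
  note aU = adjoint_carrier[OF Uc(1)]
  have "mat_adjoint U \<in> carrier (unitary_group d)" using Uc aU by (simp add: unitary_group_def)
  moreover have "mat_adjoint U * \<sigma> g = \<rho> g * mat_adjoint U" if g: "g \<in> carrier G" for g
  proof -
    have c: "\<rho> g \<in> carrier_mat d d" "\<sigma> g \<in> carrier_mat d d"
      using U(1,2) g by (auto simp: unitary_reps_def hom_def unitary_group_def)
    have "mat_adjoint U * (U * \<rho> g) * mat_adjoint U = mat_adjoint U * (\<sigma> g * U) * mat_adjoint U" using U(4) g by simp
    moreover have "mat_adjoint U * (U * \<rho> g) * mat_adjoint U = (mat_adjoint U * U) * (\<rho> g * mat_adjoint U)"
      "mat_adjoint U * (\<sigma> g * U) * mat_adjoint U = (mat_adjoint U * \<sigma> g) * (U * mat_adjoint U)"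
      using Uc(1) aU c by (simp_all only: Mats_assoc Mats_closed)
    ultimately show ?thesis using Uc(2,3) Mats_one(1)[OF Mats_closed(1)[OF c(1) aU]] Mats_one(2)[OF Mats_closed(1)[OF aU c(2)]] by simp
  qed
  ultimately show ?thesis using U(1,2) by (auto simp: unitarily_equivalent_def)
qed

lemma unitarily_equivalent_trans:
  assumes "(\<rho>, \<sigma>) \<in> unitarily_equivalent G d" "(\<sigma>, \<tau>) \<in> unitarily_equivalent G d"
  shows "(\<rho>, \<tau>) \<in> unitarily_equivalent G d"
proof -
  obtain U where U: "\<rho> \<in> unitary_reps G d" "\<sigma> \<in> unitary_reps G d" "U \<in> carrier (unitary_group d)"
    "\<forall>g\<in>carrier G. U * \<rho> g = \<sigma> g * U" using assms(1) by (auto simp: unitarily_equivalent_def)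
  obtain U' where U': "\<tau> \<in> unitary_reps G d" "U' \<in> carrier (unitary_group d)"
    "\<forall>g\<in>carrier G. U' * \<sigma> g = \<tau> g * U'" using assms(2) by (auto simp: unitarily_equivalent_def)
  have c: "U \<in> carrier_mat d d" "mat_adjoint U * U = 1\<^sub>m d" "U * mat_adjoint U = 1\<^sub>m d"
    and c': "U' \<in> carrier_mat d d" "mat_adjoint U' * U' = 1\<^sub>m d" "U' * mat_adjoint U' = 1\<^sub>m d"
    using U(3) U'(2) by (auto simp: unitary_group_def)
  note a = adjoint_carrier[OF c(1)] adjoint_carrier[OF c'(1)]
  have "(mat_adjoint U * mat_adjoint U') * (U' * U) = mat_adjoint U * ((mat_adjoint U' * U') * U)"
    "(U' * U) * (mat_adjoint U * mat_adjoint U') = U' * ((U * mat_adjoint U) * mat_adjoint U')"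
    using c(1) c'(1) a by (simp_all only: Mats_assoc Mats_closed)
  then have "U' * U \<in> carrier (unitary_group d)"
    using c c' a Mats_one(1)[OF c(1)] Mats_one(1)[OF a(2)] Mats_closed(1)[OF c'(1) c(1)]
    by (simp add: unitary_group_def adjoint_mult[OF c'(1) c(1)] del: assoc_mult_mat)
  moreover have "(U' * U) * \<rho> g = \<tau> g * (U' * U)" if g: "g \<in> carrier G" for g
  proof -
    have m: "\<rho> g \<in> carrier_mat d d" "\<sigma> g \<in> carrier_mat d d" "\<tau> g \<in> carrier_mat d d"
      using U(1,2) U'(1) g by (auto simp: unitary_reps_def hom_def unitary_group_def)
    have "(U' * U) * \<rho> g = U' * (U * \<rho> g)" using c(1) c'(1) m by (simp only: Mats_assoc Mats_closed)
    also have "\<dots> = U' * (\<sigma> g * U)" using U(4) g by simp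
    also have "\<dots> = (U' * \<sigma> g) * U" using c(1) c'(1) m by (simp only: Mats_assoc Mats_closed)
    also have "\<dots> = (\<tau> g * U') * U" using U'(3) g by simp
    also have "\<dots> = \<tau> g * (U' * U)" using c(1) c'(1) m by (simp only: Mats_assoc Mats_closed)
    finally show ?thesis .
  qed
  ultimately show ?thesis using U(1) U'(1) by (auto simp: unitarily_equivalent_def)
qed

section \<open>From the spectral gap to finitely many isomorphism types\<close>

context graph_action
begin

text \<open>An element g of the test set displaces the identity matrix by
  \<open>(\<sigma> g - \<tau> g) * mat_adjoint (\<tau> g)\<close>, which is small. The gap then
  makes the component w of the identity orthogonal to the invariants short; what remains is an
  intertwiner p close to the identity.\<close>

lemma close_reps_equivalent:
  fixes d :: nat
  defines "W' \<equiv> {v :: (nat \<times> nat) \<Rightarrow>\<^sub>0 complex. keys v \<subseteq> sq d}"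
  assumes rigid: "\<And>h :: 'x \<Rightarrow> (nat \<times> nat) \<Rightarrow>\<^sub>0 complex. (\<And>x. x \<in> X \<Longrightarrow> h x \<in> W') \<Longrightarrow>
      (\<And>g x y x' y'. g \<in> carrier \<Gamma> \<Longrightarrow> x \<in> X \<Longrightarrow> y \<in> X \<Longrightarrow> x' \<in> X \<Longrightarrow> y' \<in> X \<Longrightarrow>
        inner (h (act g x) - h (act g y)) (h (act g x') - h (act g y')) = inner (h x - h y) (h x' - h y')) \<Longrightarrow>
      (\<And>x. x \<in> X \<Longrightarrow> lap h x = 0) \<Longrightarrow> (\<And>x y. x \<in> X \<Longrightarrow> y \<in> X \<Longrightarrow> h x = h y)"
  shows "\<exists>S \<delta>. finite S \<and> S \<subseteq> carrier \<Gamma> \<and> 0 < \<delta> \<and> (\<forall>\<sigma>\<in>unitary_reps \<Gamma> d. \<forall>\<tau>\<in>unitary_reps \<Gamma> d.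
    (\<forall>g\<in>S. norm (coords d (\<sigma> g - \<tau> g)) \<le> \<delta>) \<longrightarrow> (\<tau>, \<sigma>) \<in> unitarily_equivalent \<Gamma> d)"
proof -
  interpret graph_action_dim \<Gamma> X act R E "sq d" by unfold_locales simp
  have WW: "W = W'" by (simp add: W_def W'_def)
  have "\<exists>\<epsilon>>0. \<forall>\<pi> w. isometric_rep \<pi> \<longrightarrow> w \<in> W \<longrightarrow> (\<forall>v\<in>invariants \<pi>. inner w v = 0) \<longrightarrow>
    (\<forall>g\<in>test_set. norm (\<pi> g w - w) \<le> \<epsilon> * norm w) \<longrightarrow> w = 0"
    by (rule spectral_gap) (rule rigid[folded WW])
  then obtain \<epsilon> where \<epsilon>: "0 < \<epsilon>" and gap: "\<And>\<pi> w. isometric_rep \<pi> \<Longrightarrow> w \<in> W \<Longrightarrow> (\<forall>v\<in>invariants \<pi>. inner w v = 0) \<Longrightarrow>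
    (\<forall>g\<in>test_set. norm (\<pi> g w - w) \<le> \<epsilon> * norm w) \<Longrightarrow> w = 0" by blast
  \<comment> \<open>\<delta> times the norm bound d + 1 of a unitary matrix is \<epsilon> / 4, where
    1 / 4 is the threshold of \<open>defect_near_one\<close>.\<close>
  define \<delta> where "\<delta> = \<epsilon> / (4 * (real d + 1))"
  have "(\<tau>, \<sigma>) \<in> unitarily_equivalent \<Gamma> d"
    if \<sigma>: "\<sigma> \<in> unitary_reps \<Gamma> d" and \<tau>: "\<tau> \<in> unitary_reps \<Gamma> d"
      and close: "\<forall>g\<in>test_set. norm (coords d (\<sigma> g - \<tau> g)) \<le> \<delta>" for \<sigma> \<tau>
  proof -
    have \<sigma>u: "\<sigma> g \<in> carrier (unitary_group d)" and \<tau>u: "\<tau> g \<in> carrier (unitary_group d)" if "g \<in> carrier \<Gamma>" for g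
      using \<sigma> \<tau> that by (auto simp: unitary_reps_def hom_def)
    have s: "\<sigma> g \<in> carrier_mat d d" "mat_adjoint (\<sigma> g) * \<sigma> g = 1\<^sub>m d" "\<sigma> g * mat_adjoint (\<sigma> g) = 1\<^sub>m d"
      and t: "\<tau> g \<in> carrier_mat d d" "mat_adjoint (\<tau> g) * \<tau> g = 1\<^sub>m d" "\<tau> g * mat_adjoint (\<tau> g) = 1\<^sub>m d"
      if "g \<in> carrier \<Gamma>" for g using \<sigma>u[OF that] \<tau>u[OF that] by (simp_all add: unitary_group_def)
    have hom: "\<sigma> (g \<otimes> h) = \<sigma> g * \<sigma> h" "\<tau> (g \<otimes> h) = \<tau> g * \<tau> h" if "g \<in> carrier \<Gamma>" "h \<in> carrier \<Gamma>" for g h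
      using \<sigma> \<tau> that by (auto simp: unitary_reps_def hom_def unitary_group_def)
    define \<pi> where "\<pi> = (\<lambda>g v. coords d (\<sigma> g * mat_of d v * mat_adjoint (\<tau> g)))"
    have \<pi>c: "\<sigma> g * mat_of d v * mat_adjoint (\<tau> g) \<in> carrier_mat d d" if "g \<in> carrier \<Gamma>" for g v
      using s(1)[OF that] adjoint_carrier[OF t(1)[OF that]] by (intro Mats_closed) auto
    have mat_\<pi>: "mat_of d (\<pi> g v) = \<sigma> g * mat_of d v * mat_adjoint (\<tau> g)" if "g \<in> carrier \<Gamma>" for g v
      unfolding \<pi>_def by (rule mat_of_coords[OF \<pi>c[OF that]])
    have \<pi>W: "\<pi> g v \<in> W" for g v unfolding \<pi>_def W_def using keys_coords by blast
    have lin: "linear (\<pi> g)" if g: "g \<in> carrier \<Gamma>" for g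
    proof (rule linearI)
      fix v w c
      note at = adjoint_carrier[OF t(1)[OF g]]
      have c: "\<sigma> g * mat_of d v \<in> carrier_mat d d" for v by (rule Mats_closed(1)[OF s(1)[OF g] mat_of_carrier])
      show "\<pi> g (v + w) = \<pi> g v + \<pi> g w"
        unfolding \<pi>_def mat_of_add Mats_distrib(2)[OF s(1)[OF g] mat_of_carrier mat_of_carrier] Mats_distrib(1)[OF c c at]
        by (rule coords_add[OF \<pi>c[OF g] \<pi>c[OF g]])
      show "\<pi> g (c *\<^sub>R v) = c *\<^sub>R \<pi> g v"
        unfolding \<pi>_def mat_of_scaleR mult_smult_distrib[OF s(1)[OF g] mat_of_carrier] mult_smult_assoc_mat[OF c at]
        by (rule coords_smult[OF \<pi>c[OF g]])
    qed
    \<comment> \<open>Unitarity cancels the factors \<open>\<tau> g\<close> in the middle of the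
      product; cyclicity of the trace then brings the factors \<open>\<sigma> g\<close>
      together.\<close>
    have iso: "inner (\<pi> g v) (\<pi> g w) = inner v w" if g: "g \<in> carrier \<Gamma>" and v: "v \<in> W" and w: "w \<in> W" for g v w
    proof -
      define M where "M = mat_of d v"
      define N where "N = mat_of d w"
      have M: "M \<in> carrier_mat d d" and N: "N \<in> carrier_mat d d" by (simp_all add: M_def N_def)
      note aN = adjoint_carrier[OF N] and as = adjoint_carrier[OF s(1)[OF g]] and at = adjoint_carrier[OF t(1)[OF g]]
      note sg = s(1)[OF g] and tg = t(1)[OF g]
      have adj: "mat_adjoint (\<sigma> g * N * mat_adjoint (\<tau> g)) = \<tau> g * (mat_adjoint N * mat_adjoint (\<sigma> g))"
        unfolding adjoint_mult[OF Mats_closed(1)[OF sg N] at] adjoint_mult[OF sg N] adjoint_adjoint[OF tg] ..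
      have "(\<sigma> g * M * mat_adjoint (\<tau> g)) * (\<tau> g * (mat_adjoint N * mat_adjoint (\<sigma> g))) =
          \<sigma> g * M * ((mat_adjoint (\<tau> g) * \<tau> g) * (mat_adjoint N * mat_adjoint (\<sigma> g)))"
        using sg tg M aN as at by (simp only: Mats_assoc Mats_closed)
      also have "\<dots> = \<sigma> g * (M * mat_adjoint N * mat_adjoint (\<sigma> g))"
        unfolding t(2)[OF g] Mats_one(1)[OF Mats_closed(1)[OF aN as]]
        using sg M aN as by (simp only: Mats_assoc Mats_closed)
      finally have prod: "(\<sigma> g * M * mat_adjoint (\<tau> g)) * (\<tau> g * (mat_adjoint N * mat_adjoint (\<sigma> g))) =
          \<sigma> g * (M * mat_adjoint N * mat_adjoint (\<sigma> g))" .
      have "inner (\<pi> g v) (\<pi> g w) = Re (tr d (\<sigma> g * (M * mat_adjoint N * mat_adjoint (\<sigma> g))))"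
        unfolding \<pi>_def M_def[symmetric] N_def[symmetric]
          inner_coords[OF Mats_closed(1)[OF Mats_closed(1)[OF sg M] at] Mats_closed(1)[OF Mats_closed(1)[OF sg N] at]] adj prod ..
      also have "tr d (\<sigma> g * (M * mat_adjoint N * mat_adjoint (\<sigma> g))) = tr d (M * mat_adjoint N * mat_adjoint (\<sigma> g) * \<sigma> g)"
        using sg M aN as by (intro tr_comm Mats_closed)
      also have "M * mat_adjoint N * mat_adjoint (\<sigma> g) * \<sigma> g = M * mat_adjoint N * (mat_adjoint (\<sigma> g) * \<sigma> g)"
        using sg M aN as by (simp only: Mats_assoc Mats_closed)
      also have "\<dots> = M * mat_adjoint N" unfolding s(2)[OF g] using M aN by (intro Mats_one Mats_closed)
      also have "Re (tr d (M * mat_adjoint N)) = inner v w"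
        using inner_coords[OF M N] coords_mat_of[of v d] coords_mat_of[of w d] v w by (simp add: M_def N_def W_def)
      finally show ?thesis .
    qed
    have mul: "\<pi> (g \<otimes> h) v = \<pi> g (\<pi> h v)" if g: "g \<in> carrier \<Gamma>" and h: "h \<in> carrier \<Gamma>" for g h v
    proof -
      have "\<sigma> g * \<sigma> h * mat_of d v * mat_adjoint (\<tau> g * \<tau> h) = \<sigma> g * (\<sigma> h * mat_of d v * mat_adjoint (\<tau> h)) * mat_adjoint (\<tau> g)"
        unfolding adjoint_mult[OF t(1)[OF g] t(1)[OF h]]
        using s(1)[OF g] s(1)[OF h] adjoint_carrier[OF t(1)[OF g]] adjoint_carrier[OF t(1)[OF h]] mat_of_carrier[of d v]
        by (simp only: Mats_assoc Mats_closed)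
      note eq = this
      show ?thesis unfolding \<pi>_def mat_of_coords[OF \<pi>c[OF h]] hom[OF g h] eq ..
    qed
    have rep: "isometric_rep \<pi>"
      unfolding isometric_rep_def by (intro ballI conjI image_subsetI lin iso mul \<pi>W)
    define u where "u = coords d (1\<^sub>m d)"
    have u: "u \<in> W" unfolding u_def W_def using keys_coords by blast
    have sub: "Real_Vector_Spaces.subspace (invariants \<pi>)"
      unfolding real_vector.subspace_def
    proof (intro conjI ballI allI)
      show "0 \<in> invariants \<pi>"
        using real_vector.subspace_0[OF W_subspace] lin by (simp add: invariants_def linear_0)
      fix v w c assume v: "v \<in> invariants \<pi>"
      show "v + w \<in> invariants \<pi>" if "w \<in> invariants \<pi>"
        using v that real_vector.subspace_add[OF W_subspace, of v w] lin by (simp add: invariants_def linear_add)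
      show "c *\<^sub>R v \<in> invariants \<pi>"
        using v real_vector.subspace_scale[OF W_subspace, of v c] lin by (simp add: invariants_def linear_scale)
    qed
    obtain B where B: "finite B" "W \<subseteq> Real_Vector_Spaces.span B"
      using finite_dim_poly_mapping[of "sq d"] unfolding W_def by auto
    have "invariants \<pi> \<subseteq> W" by (auto simp: invariants_def)
    from orthogonal_projection_exists[OF sub B(1) subset_trans[OF this B(2)], of u]
    obtain p where p: "p \<in> invariants \<pi>" "\<forall>v\<in>invariants \<pi>. inner (u - p) v = 0" by (elim bexE)
    have pW: "p \<in> W" and p_inv: "\<And>g. g \<in> carrier \<Gamma> \<Longrightarrow> \<pi> g p = p" using p(1) by (auto simp: invariants_def)
    define w where "w = u - p"
    have w: "w \<in> W" unfolding w_def by (rule W_diff[OF u pW])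
    \<comment> \<open>Since p is invariant, w is displaced exactly as much as the identity, by at
      most \<epsilon> / 4. If w were not short, this would be at most \<epsilon> times its norm, and
      the gap would give w = 0.\<close>
    have "norm w < 1 / 4"
    proof (rule ccontr)
      assume "\<not> norm w < 1 / 4"
      then have big: "1 / 4 \<le> norm w" by simp
      have "norm (\<pi> g w - w) \<le> \<epsilon> * norm w" if g': "g \<in> test_set" for g
      proof -
        have g: "g \<in> carrier \<Gamma>" using g' test_set_carrier by blast
        note sg = s(1)[OF g] and tg = t(1)[OF g] and at = adjoint_carrier[OF t(1)[OF g]]
        have "\<pi> g w - w = \<pi> g u - u" using p_inv[OF g] lin[OF g] by (simp add: w_def linear_diff)
        also have "\<pi> g u = coords d (\<sigma> g * mat_adjoint (\<tau> g))"
          unfolding \<pi>_def u_def mat_of_coords[OF Mats_closed(5)] Mats_one(2)[OF sg] ..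
        also have "coords d (\<sigma> g * mat_adjoint (\<tau> g)) - u = coords d ((\<sigma> g - \<tau> g) * mat_adjoint (\<tau> g))"
          unfolding u_def Mats_distrib(3)[OF sg tg at] t(3)[OF g]
          by (rule coords_diff[OF Mats_closed(1)[OF sg at] Mats_closed(5), symmetric])
        finally have "norm (\<pi> g w - w) \<le> norm (coords d (\<sigma> g - \<tau> g)) * norm (coords d (mat_adjoint (\<tau> g)))"
          using norm_coords_mult_le[OF Mats_closed(3)[OF sg tg] at] by simp
        also have "\<dots> \<le> \<delta> * (real d + 1)"
          unfolding norm_coords_adjoint[OF tg] using close g' norm_coords_unitary[OF \<tau>u[OF g]] \<epsilon>
          by (intro mult_mono) (auto simp: \<delta>_def)
        also have "\<dots> = \<epsilon> * (1 / 4)" by (simp add: \<delta>_def field_simps)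
        also have "\<dots> \<le> \<epsilon> * norm w" using big \<epsilon> by (intro mult_left_mono) auto
        finally show ?thesis .
      qed
      then have "w = 0" using gap[OF rep w] p(2) unfolding w_def by blast
      then show False using big by simp
    qed
    then have small: "norm (coords d (defect d (mat_of d p))) < 1"
      using defect_near_one[of w d] w by (simp add: W_def w_def u_def)
    have inter: "\<sigma> g * mat_of d p = mat_of d p * \<tau> g" if g: "g \<in> carrier \<Gamma>" for g
    proof -
      note sg = s(1)[OF g] and tg = t(1)[OF g] and at = adjoint_carrier[OF t(1)[OF g]]
      have "mat_of d p * \<tau> g = (\<sigma> g * mat_of d p * mat_adjoint (\<tau> g)) * \<tau> g"
        using mat_\<pi>[OF g, of p] p_inv[OF g] by simp
      also have "\<dots> = \<sigma> g * mat_of d p * (mat_adjoint (\<tau> g) * \<tau> g)"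
        using sg tg at mat_of_carrier[of d p] by (simp only: Mats_assoc Mats_closed)
      also have "\<dots> = \<sigma> g * mat_of d p" unfolding t(2)[OF g]
        by (rule Mats_one(2)[OF Mats_closed(1)[OF sg mat_of_carrier]])
      finally show ?thesis ..
    qed
    have "\<exists>U\<in>carrier (unitary_group d). \<forall>g\<in>carrier \<Gamma>. \<sigma> g * U = U * \<tau> g"
      by (rule unitary_intertwiner[of "carrier \<Gamma>" \<sigma> d \<tau> "mat_of d p", OF \<sigma>u \<tau>u mat_of_carrier inter small])
    then obtain U where U: "U \<in> carrier (unitary_group d)" "\<forall>g\<in>carrier \<Gamma>. \<sigma> g * U = U * \<tau> g"
      by (elim bexE)
    have "\<forall>g\<in>carrier \<Gamma>. U * \<tau> g = \<sigma> g * U" using U(2) by simp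
    then show ?thesis unfolding unitarily_equivalent_def using \<sigma> \<tau> U(1) by blast
  qed
  moreover have "0 < \<delta>" using \<epsilon> by (simp add: \<delta>_def)
  ultimately show ?thesis using finite_test_set test_set_carrier by blast
qed

text \<open>Compactness of the unitary group takes the form of rounding: a representation is
  labelled by the rounded entries of its matrices on S. There are finitely many labels, and equal
  labels imply \<delta>-closeness on S.\<close>

theorem finite_unitary_rep_types:
  assumes rigid: "\<And>h :: 'x \<Rightarrow> (nat \<times> nat) \<Rightarrow>\<^sub>0 complex. (\<And>x. x \<in> X \<Longrightarrow> keys (h x) \<subseteq> sq d) \<Longrightarrow>
      (\<And>g x y x' y'. g \<in> carrier \<Gamma> \<Longrightarrow> x \<in> X \<Longrightarrow> y \<in> X \<Longrightarrow> x' \<in> X \<Longrightarrow> y' \<in> X \<Longrightarrow>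
        inner (h (act g x) - h (act g y)) (h (act g x') - h (act g y')) = inner (h x - h y) (h x' - h y')) \<Longrightarrow>
      (\<And>x. x \<in> X \<Longrightarrow> lap h x = 0) \<Longrightarrow> (\<And>x y. x \<in> X \<Longrightarrow> y \<in> X \<Longrightarrow> h x = h y)"
  shows "finite (unitary_rep_types \<Gamma> d)"
proof -
  have "\<exists>S \<delta>. finite S \<and> S \<subseteq> carrier \<Gamma> \<and> 0 < \<delta> \<and> (\<forall>\<sigma>\<in>unitary_reps \<Gamma> d. \<forall>\<tau>\<in>unitary_reps \<Gamma> d.
    (\<forall>g\<in>S. norm (coords d (\<sigma> g - \<tau> g)) \<le> \<delta>) \<longrightarrow> (\<tau>, \<sigma>) \<in> unitarily_equivalent \<Gamma> d)"
    by (rule close_reps_equivalent, rule rigid) (simp_all only: mem_Collect_eq)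
  then obtain S \<delta> where S: "finite S" "S \<subseteq> carrier \<Gamma>" "0 < \<delta>"
    and close: "\<forall>\<sigma>\<in>unitary_reps \<Gamma> d. \<forall>\<tau>\<in>unitary_reps \<Gamma> d.
      (\<forall>g\<in>S. norm (coords d (\<sigma> g - \<tau> g)) \<le> \<delta>) \<longrightarrow> (\<tau>, \<sigma>) \<in> unitarily_equivalent \<Gamma> d"
    by (elim exE conjE)
  \<comment> \<open>Equal labels bound the differences of real and imaginary parts by 1 / k, hence
    of entries by 2 / k and of matrices by 2 d^2 / k, which is at most \<delta>. The summand 1 keeps
    k positive for d = 0.\<close>
  define k where "k = (2 * real (d * d) + 1) / \<delta>"
  have "0 < 2 * real (d * d) + 1" using of_nat_0_le_iff[of "d * d", where ?'a = real] by linarith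
  then have k: "0 < k" unfolding k_def using S(3) by (rule divide_pos_pos)
  define N where "N = \<lceil>k * (real d + 1)\<rceil> + 1"
  define c where "c = (\<lambda>\<sigma> :: 'g \<Rightarrow> complex mat. \<lambda>(g, p)\<in>S \<times> sq d. (\<lfloor>k * Re (\<sigma> g $$ p)\<rfloor>, \<lfloor>k * Im (\<sigma> g $$ p)\<rfloor>))"
  have bound: "\<lfloor>k * x\<rfloor> \<in> {-N..N}" if "\<bar>x\<bar> \<le> real d + 1" for x
  proof -
    have "\<bar>k * x\<bar> \<le> k * (real d + 1)" using that k by (simp only: abs_mult abs_of_pos mult_le_cancel_left_pos)
    then show ?thesis unfolding N_def by (simp add: abs_le_iff) linarith
  qed
  have entry: "cmod (\<sigma> g $$ (i, j)) \<le> real d + 1"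
    if "\<sigma> \<in> unitary_reps \<Gamma> d" "g \<in> S" "i < d" "j < d" for \<sigma> g i j
  proof -
    have "\<sigma> g \<in> carrier (unitary_group d)" using that(1,2) S(2) by (auto simp: unitary_reps_def hom_def)
    from norm_coords_unitary[OF this] norm_lookup_le[of "coords d (\<sigma> g)" "(i, j)"] that(3,4)
    show ?thesis by (simp add: lookup_coords)
  qed
  have "c ` unitary_reps \<Gamma> d \<subseteq> (\<Pi>\<^sub>E q\<in>S \<times> sq d. {-N..N} \<times> {-N..N})"
  proof
    fix f assume "f \<in> c ` unitary_reps \<Gamma> d"
    then obtain \<sigma> where \<sigma>: "\<sigma> \<in> unitary_reps \<Gamma> d" "f = c \<sigma>" by blast
    show "f \<in> (\<Pi>\<^sub>E q\<in>S \<times> sq d. {-N..N} \<times> {-N..N})"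
    proof (rule PiE_I)
      fix q assume "q \<in> S \<times> sq d"
      then obtain g i j where q: "q = (g, (i, j))" "g \<in> S" "i < d" "j < d" by auto
      have "\<bar>Re (\<sigma> g $$ (i, j))\<bar> \<le> real d + 1" "\<bar>Im (\<sigma> g $$ (i, j))\<bar> \<le> real d + 1"
        using entry[OF \<sigma>(1) q(2-4)] abs_Re_le_cmod[of "\<sigma> g $$ (i, j)"] abs_Im_le_cmod[of "\<sigma> g $$ (i, j)"] by linarith+
      then show "f q \<in> {-N..N} \<times> {-N..N}" using bound q unfolding \<sigma>(2) c_def by auto
    qed (auto simp: \<sigma>(2) c_def)
  qed
  then have fin: "finite (c ` unitary_reps \<Gamma> d)"
    by (rule finite_subset) (intro finite_PiE finite_cartesian_product S(1) finite_lessThan finite_atLeastAtMost_int)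
  have "finite ((\<lambda>\<sigma>. unitarily_equivalent \<Gamma> d `` {\<sigma>}) ` unitary_reps \<Gamma> d)"
  proof (rule card_image_le_colours(1)[OF fin])
    fix \<sigma> \<tau> assume \<sigma>: "\<sigma> \<in> unitary_reps \<Gamma> d" and \<tau>: "\<tau> \<in> unitary_reps \<Gamma> d" and eq: "c \<sigma> = c \<tau>"
    have "norm (coords d (\<sigma> g - \<tau> g)) \<le> \<delta>" if g: "g \<in> S" for g
    proof -
      have m: "\<sigma> g \<in> carrier_mat d d" "\<tau> g \<in> carrier_mat d d"
        using \<sigma> \<tau> g S(2) by (auto simp: unitary_reps_def hom_def unitary_group_def)
      have diff: "cmod (\<sigma> g $$ (i, j) - \<tau> g $$ (i, j)) \<le> 2 / k" if ij: "i < d" "j < d" for i j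
      proof -
        have "c \<sigma> (g, (i, j)) = c \<tau> (g, (i, j))" using eq by simp
        then have "\<lfloor>k * Re (\<sigma> g $$ (i, j))\<rfloor> = \<lfloor>k * Re (\<tau> g $$ (i, j))\<rfloor>" "\<lfloor>k * Im (\<sigma> g $$ (i, j))\<rfloor> = \<lfloor>k * Im (\<tau> g $$ (i, j))\<rfloor>"
          using g ij by (simp_all add: c_def)
        then have "\<bar>k * (Re (\<sigma> g $$ (i, j)) - Re (\<tau> g $$ (i, j)))\<bar> \<le> 1" "\<bar>k * (Im (\<sigma> g $$ (i, j)) - Im (\<tau> g $$ (i, j)))\<bar> \<le> 1"
          using floor_eq_imp_close by (auto simp: right_diff_distrib)
        then have "\<bar>Re (\<sigma> g $$ (i, j) - \<tau> g $$ (i, j))\<bar> \<le> 1 / k" "\<bar>Im (\<sigma> g $$ (i, j) - \<tau> g $$ (i, j))\<bar> \<le> 1 / k"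
          using k by (simp_all add: abs_mult pos_le_divide_eq mult.commute)
        then show ?thesis using cmod_le[of "\<sigma> g $$ (i, j) - \<tau> g $$ (i, j)"] by simp
      qed
      have "norm (coords d (\<sigma> g - \<tau> g)) \<le> (\<Sum>p\<in>sq d. norm (lookup (coords d (\<sigma> g - \<tau> g)) p))"
        by (rule norm_le_sum_lookup[OF _ keys_coords]) simp
      also have "\<dots> \<le> (\<Sum>p\<in>sq d. 2 / k)"
        using diff m by (intro sum_mono) (auto simp: lookup_coords)
      also have "\<dots> = (2 * real (d * d)) / k" by simp
      also have "\<dots> \<le> \<delta>" using S(3) k by (simp add: k_def field_simps)
      finally show ?thesis .
    qed
    then have "(\<tau>, \<sigma>) \<in> unitarily_equivalent \<Gamma> d" using close[rule_format, OF \<sigma> \<tau>] by blast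
    then show "unitarily_equivalent \<Gamma> d `` {\<sigma>} = unitarily_equivalent \<Gamma> d `` {\<tau>}"
      using unitarily_equivalent_trans unitarily_equivalent_sym[OF group] by blast
  qed
  moreover have "unitary_rep_types \<Gamma> d = (\<lambda>\<sigma>. unitarily_equivalent \<Gamma> d `` {\<sigma>}) ` unitary_reps \<Gamma> d"
    by (auto simp: unitary_rep_types_def quotient_def)
  ultimately show ?thesis by simp
qed

end

section \<open>Cocompact lattices in products of trees\<close>

lemma openin_cylinder:
  assumes "finite F" "F \<subseteq> verts T"
  shows "openin (aut_topology T) {g \<in> aut_plus T. \<forall>v\<in>F. g v = f v}"
  using assms
proof (induction F)
  case empty
  then show ?case using openin_topspace[of "aut_topology T"] by simp
next
  case (insert v F)
  have cont: "continuous_map (aut_topology T) (discrete_topology (verts T)) (\<lambda>g. g v)"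
    unfolding aut_topology_def using insert.prems
    by (intro continuous_map_from_subtopology continuous_map_product_projection) simp
  have "openin (discrete_topology (verts T)) (verts T \<inter> {f v})" by simp
  from openin_continuous_map_preimage[OF cont this]
  have "openin (aut_topology T) {g \<in> aut_plus T. g v \<in> verts T \<inter> {f v}}" by simp
  moreover have "openin (aut_topology T) {g \<in> aut_plus T. \<forall>v\<in>F. g v = f v}" using insert by simp
  ultimately have "openin (aut_topology T)
    ({g \<in> aut_plus T. g v \<in> verts T \<inter> {f v}} \<inter> {g \<in> aut_plus T. \<forall>v\<in>F. g v = f v})"
    by (rule openin_Int)
  moreover have "g v \<in> verts T" if "g \<in> aut_plus T" for g
    using aut_plus_subset_PiE[of T] that insert.prems by (auto simp: PiE_iff subset_iff)
  then have "{g \<in> aut_plus T. \<forall>v\<in>insert v F. g v = f v} =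
    {g \<in> aut_plus T. g v \<in> verts T \<inter> {f v}} \<inter> {g \<in> aut_plus T. \<forall>v\<in>F. g v = f v}" by auto
  ultimately show ?case by (simp only:)
qed

lemma open_aut_contains_cylinder:
  assumes "openin (aut_topology T) U" "g \<in> U"
  shows "\<exists>F. finite F \<and> F \<subseteq> verts T \<and> (\<forall>h\<in>aut_plus T. (\<forall>v\<in>F. h v = g v) \<longrightarrow> h \<in> U)"
proof -
  obtain S where S: "openin (product_topology (\<lambda>_. discrete_topology (verts T)) (verts T)) S"
      "U = S \<inter> aut_plus T"
    using assms(1) unfolding aut_topology_def openin_subtopology by auto
  then have "g \<in> S" using assms(2) by simp
  from product_topology_open_contains_basis[OF S(1) this]
  obtain B where B: "g \<in> (\<Pi>\<^sub>E v\<in>verts T. B v)" "\<forall>i. openin (discrete_topology (verts T)) (B i)"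
      "finite {v. B v \<noteq> verts T}" "(\<Pi>\<^sub>E v\<in>verts T. B v) \<subseteq> S"
    by (auto simp del: openin_discrete_topology)
  have "h \<in> U" if h: "h \<in> aut_plus T" "\<forall>v\<in>{v \<in> verts T. B v \<noteq> verts T}. h v = g v" for h
  proof -
    have hP: "h \<in> (\<Pi>\<^sub>E v\<in>verts T. verts T)" using aut_plus_subset_PiE h(1) by blast
    have "h v \<in> B v" if v: "v \<in> verts T" for v
    proof (cases "B v = verts T")
      case True
      then show ?thesis using hP v by auto
    next
      case False
      then have "h v = g v" using h(2) v by blast
      then show ?thesis using B(1) v by (simp add: PiE_iff)
    qed
    then have "h \<in> (\<Pi>\<^sub>E v\<in>verts T. B v)" using hP by (simp add: PiE_iff)
    then show ?thesis using B(4) S(2) h(1) by blast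
  qed
  moreover have "finite {v \<in> verts T. B v \<noteq> verts T}" using B(3) by (rule rev_finite_subset) blast
  ultimately show ?thesis by (intro exI[of _ "{v \<in> verts T. B v \<noteq> verts T}"]) blast
qed

lemma open_prod_contains_cylinder:
  assumes "openin (prod_aut_topology I T) U" "g \<in> U"
  shows "\<exists>F. (\<forall>i\<in>I. finite (F i) \<and> F i \<subseteq> verts (T i)) \<and>
    (\<forall>h\<in>\<Pi>\<^sub>E i\<in>I. aut_plus (T i). (\<forall>i\<in>I. \<forall>v\<in>F i. h i v = g i v) \<longrightarrow> h \<in> U)"
proof -
  from product_topology_open_contains_basis[OF assms]
  obtain B where B: "g \<in> (\<Pi>\<^sub>E i\<in>I. B i)" "\<forall>i. openin (aut_topology (T i)) (B i)" "(\<Pi>\<^sub>E i\<in>I. B i) \<subseteq> U"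
    by (elim exE conjE)
  have "\<forall>i\<in>I. \<exists>F. finite F \<and> F \<subseteq> verts (T i) \<and> (\<forall>h\<in>aut_plus (T i). (\<forall>v\<in>F. h v = g i v) \<longrightarrow> h \<in> B i)"
    by (intro ballI open_aut_contains_cylinder[OF B(2)[rule_format] PiE_mem[OF B(1)]])
  from bchoice[OF this] obtain F where
    F: "\<forall>i\<in>I. finite (F i) \<and> F i \<subseteq> verts (T i) \<and> (\<forall>h\<in>aut_plus (T i). (\<forall>v\<in>F i. h v = g i v) \<longrightarrow> h \<in> B i)"
    by (elim exE)
  have "h \<in> U" if h: "h \<in> (\<Pi>\<^sub>E i\<in>I. aut_plus (T i))" "\<forall>i\<in>I. \<forall>v\<in>F i. h i v = g i v" for h
  proof -
    have "h \<in> (\<Pi>\<^sub>E i\<in>I. B i)" using h F by (simp add: PiE_iff)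
    then show ?thesis using B(3) by blast
  qed
  moreover have "\<forall>i\<in>I. finite (F i) \<and> F i \<subseteq> verts (T i)" using F by simp
  ultimately show ?thesis by (intro exI[of _ F] conjI ballI impI) (simp_all only:)
qed

lemma closure_aut_iff:
  assumes "S \<subseteq> aut_plus T"
  shows "g \<in> aut_topology T closure_of S \<longleftrightarrow>
    g \<in> aut_plus T \<and> (\<forall>F. finite F \<longrightarrow> F \<subseteq> verts T \<longrightarrow> (\<exists>h\<in>S. \<forall>v\<in>F. h v = g v))"
proof (intro iffI conjI allI impI)
  assume "g \<in> aut_topology T closure_of S"
  then have g: "g \<in> aut_plus T" "\<And>U. g \<in> U \<Longrightarrow> openin (aut_topology T) U \<Longrightarrow> \<exists>h\<in>S. h \<in> U"
    by (auto simp: in_closure_of)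
  show "g \<in> aut_plus T" by (rule g)
  fix F assume F: "finite F" "F \<subseteq> verts T"
  show "\<exists>h\<in>S. \<forall>v\<in>F. h v = g v" using g(2)[OF _ openin_cylinder[OF F, of g]] g(1) by blast
next
  assume g: "g \<in> aut_plus T \<and> (\<forall>F. finite F \<longrightarrow> F \<subseteq> verts T \<longrightarrow> (\<exists>h\<in>S. \<forall>v\<in>F. h v = g v))"
  show "g \<in> aut_topology T closure_of S"
    unfolding in_closure_of
  proof (intro conjI allI impI)
    show "g \<in> topspace (aut_topology T)" using g by simp
    fix U assume U: "g \<in> U \<and> openin (aut_topology T) U"
    from open_aut_contains_cylinder[OF conjunct2[OF U] conjunct1[OF U]] obtain F where F: "finite F" "F \<subseteq> verts T" "\<forall>h\<in>aut_plus T. (\<forall>v\<in>F. h v = g v) \<longrightarrow> h \<in> U"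
      by (elim exE conjE)
    then obtain h where "h \<in> S" "\<forall>v\<in>F. h v = g v" using g by blast
    then show "\<exists>y. y \<in> S \<and> y \<in> U" using F(3) assms by blast
  qed
qed

lemma AutPlus_apply:
  assumes "v \<in> verts T"
  shows "\<one>\<^bsub>AutPlus T\<^esub> v = v"
    and "g \<in> aut_plus T \<Longrightarrow> h \<in> aut_plus T \<Longrightarrow> (g \<otimes>\<^bsub>AutPlus T\<^esub> h) v = g (h v)"
  using assms by (auto simp: AutPlus_def BijGroup_def aut_plus_def compose_eq)

text \<open>A vertex is a pair at distance 0, so \<open>bounded_pair_orbits\<close> applies; Z
  collects one vertex for each label that occurs.\<close>

lemma (in boundary_transitive) finite_vertex_orbits:
  "\<exists>Z. finite Z \<and> Z \<subseteq> V \<and> (\<forall>v\<in>V. \<exists>g\<in>G. g v \<in> Z)"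
proof -
  from bounded_pair_orbits obtain D :: nat where
    "\<forall>m. \<exists>\<kappa>. \<forall>u\<in>V. \<forall>w\<in>V. d u w = m \<longrightarrow> \<kappa> u w < D \<and>
     (\<forall>u'\<in>V. \<forall>w'\<in>V. d u' w' = m \<longrightarrow> \<kappa> u' w' = \<kappa> u w \<longrightarrow> (\<exists>g\<in>G. g u = u' \<and> g w = w'))"
    by (elim exE)
  from this[rule_format, of 0] obtain \<kappa> where
    \<kappa>: "\<forall>u\<in>V. \<forall>w\<in>V. d u w = 0 \<longrightarrow> \<kappa> u w < D \<and>
     (\<forall>u'\<in>V. \<forall>w'\<in>V. d u' w' = 0 \<longrightarrow> \<kappa> u' w' = \<kappa> u w \<longrightarrow> (\<exists>g\<in>G. g u = u' \<and> g w = w'))"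
    by (elim exE)
  define z where "z = (\<lambda>k. SOME u. u \<in> V \<and> \<kappa> u u = k)"
  have z: "z (\<kappa> v v) \<in> V" "\<kappa> (z (\<kappa> v v)) (z (\<kappa> v v)) = \<kappa> v v" if "v \<in> V" for v
    using someI[of "\<lambda>u. u \<in> V \<and> \<kappa> u u = \<kappa> v v" v] that unfolding z_def by auto
  have "\<kappa> v v < D" if "v \<in> V" for v using \<kappa>[rule_format, OF that that dist_self] by (rule conjunct1)
  then have "(\<lambda>v. z (\<kappa> v v)) ` V \<subseteq> z ` {..<D}" by blast
  then have "finite ((\<lambda>v. z (\<kappa> v v)) ` V)" by (rule finite_subset) simp
  moreover have "\<exists>g\<in>G. g v \<in> (\<lambda>v. z (\<kappa> v v)) ` V" if v: "v \<in> V" for v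
  proof -
    have "\<exists>g\<in>G. g v = z (\<kappa> v v) \<and> g v = z (\<kappa> v v)"
      using \<kappa>[rule_format, OF v v dist_self] z[OF v] dist_self by blast
    then show ?thesis using v by blast
  qed
  ultimately show ?thesis using z(1) by (intro exI[of _ "(\<lambda>v. z (\<kappa> v v)) ` V"]) blast
qed

section \<open>A cocompact lattice acts properly and cocompactly on the vertices of the
  product\<close>

locale tree_lattice =
  fixes I :: "nat set" and T :: "nat \<Rightarrow> ('v, 'x) coloured_graph_scheme" and \<Gamma> :: "(nat \<Rightarrow> 'v \<Rightarrow> 'v) set"
  assumes finite_I: "finite I"
    and tree: "i \<in> I \<Longrightarrow> biregular_tree (T i)"
    and lattice: "cocompact_lattice (prod_AutPlus I T) (prod_aut_topology I T) \<Gamma>"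
    and two_trans: "i \<in> I \<Longrightarrow> two_transitive_on_boundary (T i) (proj_closure T \<Gamma> i)"
begin

abbreviation "P \<equiv> prod_AutPlus I T"
abbreviation "A \<equiv> \<Pi>\<^sub>E i\<in>I. aut_plus (T i)"
abbreviation "X \<equiv> \<Pi>\<^sub>E i\<in>I. verts (T i)"
abbreviation "act \<equiv> \<lambda>\<gamma> x. \<lambda>i\<in>I. \<gamma> i (x i)"

lemma biregular: "i \<in> I \<Longrightarrow> biregular (T i)"
  using tree by (rule biregular.intro)

lemma group_P: "group P"
  by (rule product_group) (rule group_AutPlus)

lemma subgroup: "subgroup \<Gamma> P"
  using lattice by (simp add: cocompact_lattice_def)

lemma carrier_P: "carrier P = A"
  by simp

lemma \<Gamma>_A: "\<Gamma> \<subseteq> A"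
  using subgroup.subset[OF subgroup] by simp

lemma \<Gamma>_aut: "\<gamma> \<in> \<Gamma> \<Longrightarrow> i \<in> I \<Longrightarrow> \<gamma> i \<in> aut_plus (T i)"
  using \<Gamma>_A by (auto simp: PiE_iff subset_iff)

lemma aut_vert: "g \<in> aut_plus (T i) \<Longrightarrow> v \<in> verts (T i) \<Longrightarrow> g v \<in> verts (T i)"
  using aut_plus_subset_PiE[of "T i"] by (auto simp: PiE_iff subset_iff)

lemma act_X: "a \<in> A \<Longrightarrow> x \<in> X \<Longrightarrow> act a x \<in> X"
  using aut_vert by (auto simp: PiE_iff)

lemma mult_apply:
  assumes "a \<in> A" "b \<in> A" "i \<in> I" "v \<in> verts (T i)"
  shows "(a \<otimes>\<^bsub>P\<^esub> b) i v = a i (b i v)"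
  using assms AutPlus_apply(2)[OF assms(4), of "a i" "b i"] by (simp add: PiE_iff)

lemma one_apply: "i \<in> I \<Longrightarrow> v \<in> verts (T i) \<Longrightarrow> \<one>\<^bsub>P\<^esub> i v = v"
  by (simp add: AutPlus_apply)

lemma act_mult: "a \<in> A \<Longrightarrow> b \<in> A \<Longrightarrow> x \<in> X \<Longrightarrow> act (a \<otimes>\<^bsub>P\<^esub> b) x = act a (act b x)"
  using mult_apply by (auto simp del: mult_product_group simp: fun_eq_iff PiE_iff)

lemma act_one: "x \<in> X \<Longrightarrow> act \<one>\<^bsub>P\<^esub> x = x"
  using one_apply by (auto simp del: one_product_group simp: fun_eq_iff PiE_iff extensional_def)

lemma inv_A: "a \<in> A \<Longrightarrow> inv\<^bsub>P\<^esub> a \<in> A"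
  using group.inv_closed[OF group_P] by (simp only: carrier_P)

lemma inv_apply:
  assumes "a \<in> A" "i \<in> I" "v \<in> verts (T i)"
  shows "(inv\<^bsub>P\<^esub> a) i (a i v) = v" "a i ((inv\<^bsub>P\<^esub> a) i v) = v"
  using mult_apply[OF inv_A[OF assms(1)] assms] mult_apply[OF assms(1) inv_A[OF assms(1)] assms(2,3)]
    group.l_inv[OF group_P] group.r_inv[OF group_P] assms(1) one_apply[OF assms(2,3)]
  by (simp_all only: carrier_P)

lemma act_inv:
  assumes "a \<in> A" "x \<in> X"
  shows "act (inv\<^bsub>P\<^esub> a) (act a x) = x" "act a (act (inv\<^bsub>P\<^esub> a) x) = x"
  using act_mult[OF inv_A[OF assms(1)] assms] act_mult[OF assms(1) inv_A[OF assms(1)] assms(2)]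
    group.l_inv[OF group_P] group.r_inv[OF group_P] assms(1) act_one[OF assms(2)]
  by (simp_all only: carrier_P)

lemma proj_closure_iff:
  assumes "i \<in> I"
  shows "g \<in> proj_closure T \<Gamma> i \<longleftrightarrow>
    g \<in> aut_plus (T i) \<and> (\<forall>F. finite F \<longrightarrow> F \<subseteq> verts (T i) \<longrightarrow> (\<exists>\<gamma>\<in>\<Gamma>. \<forall>v\<in>F. \<gamma> i v = g v))"
proof -
  have "(\<lambda>\<gamma>. \<gamma> i) ` \<Gamma> \<subseteq> aut_plus (T i)" using \<Gamma>_aut assms by blast
  from closure_aut_iff[OF this] show ?thesis unfolding proj_closure_def by simp
qed

text \<open>The closure of a projection is again a group, checked on finite sets F. For the inverse
  of g one approximates g on the preimage of F and inverts the approximation; for a product, the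
  second factor is approximated on F and the first on the image of F.\<close>

lemma boundary_transitive:
  assumes i: "i \<in> I" shows "boundary_transitive (T i) (proj_closure T \<Gamma> i)"
proof (intro boundary_transitive.intro boundary_transitive_axioms.intro biregular[OF i])
  fix g h
  assume g: "g \<in> proj_closure T \<Gamma> i"
  then have gA: "g \<in> aut_plus (T i)" by (simp add: proj_closure_iff[OF i])
  show "g \<in> aut_plus (T i)" by (rule gA)
  note grp = group_AutPlus[of "T i"]
  let ?k = "inv\<^bsub>AutPlus (T i)\<^esub> g"
  have kA: "?k \<in> aut_plus (T i)" using group.inv_closed[OF grp] gA by simp
  have k: "?k (g v) = v \<and> g (?k v) = v" if "v \<in> verts (T i)" for v
    using AutPlus_apply(2)[OF that kA gA] AutPlus_apply(2)[OF that gA kA] AutPlus_apply(1)[OF that]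
      group.l_inv[OF grp, of g] group.r_inv[OF grp, of g] gA by simp
  have "\<exists>\<gamma>\<in>\<Gamma>. \<forall>v\<in>F. \<gamma> i v = ?k v" if F: "finite F" "F \<subseteq> verts (T i)" for F
  proof -
    have "finite (?k ` F)" "?k ` F \<subseteq> verts (T i)" using F aut_vert[OF kA] by auto
    then obtain \<gamma> where \<gamma>: "\<gamma> \<in> \<Gamma>" "\<forall>v\<in>?k ` F. \<gamma> i v = g v"
      using g unfolding proj_closure_iff[OF i] by blast
    have "(inv\<^bsub>P\<^esub> \<gamma>) i v = ?k v" if v: "v \<in> F" for v
    proof -
      have vV: "v \<in> verts (T i)" using v F(2) by blast
      have "\<gamma> i (?k v) = v" using \<gamma>(2) k[OF vV] v by simp
      then show ?thesis using inv_apply(1)[OF subsetD[OF \<Gamma>_A \<gamma>(1)] i aut_vert[OF kA vV]] by simp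
    qed
    moreover have "inv\<^bsub>P\<^esub> \<gamma> \<in> \<Gamma>" using subgroup.m_inv_closed[OF subgroup \<gamma>(1)] .
    ultimately show ?thesis by blast
  qed
  then have "?k \<in> proj_closure T \<Gamma> i" using kA unfolding proj_closure_iff[OF i] by blast
  then show "\<exists>k\<in>proj_closure T \<Gamma> i. \<forall>v\<in>verts (T i). k (g v) = v \<and> g (k v) = v" using k by blast
  assume h: "h \<in> proj_closure T \<Gamma> i"
  then have hA: "h \<in> aut_plus (T i)" by (simp add: proj_closure_iff[OF i])
  let ?m = "g \<otimes>\<^bsub>AutPlus (T i)\<^esub> h"
  have mA: "?m \<in> aut_plus (T i)" using group.is_monoid[OF grp] gA hA monoid.m_closed by fastforce
  have m: "?m v = g (h v)" if "v \<in> verts (T i)" for v using AutPlus_apply(2)[OF that gA hA] .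
  have "\<exists>\<gamma>\<in>\<Gamma>. \<forall>v\<in>F. \<gamma> i v = ?m v" if F: "finite F" "F \<subseteq> verts (T i)" for F
  proof -
    obtain \<delta> where \<delta>: "\<delta> \<in> \<Gamma>" "\<forall>v\<in>F. \<delta> i v = h v"
      using h F unfolding proj_closure_iff[OF i] by blast
    have "finite (h ` F)" "h ` F \<subseteq> verts (T i)" using F aut_vert[OF hA] by auto
    then obtain \<gamma> where \<gamma>: "\<gamma> \<in> \<Gamma>" "\<forall>v\<in>h ` F. \<gamma> i v = g v"
      using g unfolding proj_closure_iff[OF i] by blast
    have "(\<gamma> \<otimes>\<^bsub>P\<^esub> \<delta>) i v = ?m v" if v: "v \<in> F" for v
      using mult_apply[OF subsetD[OF \<Gamma>_A \<gamma>(1)] subsetD[OF \<Gamma>_A \<delta>(1)] i subsetD[OF F(2) v]]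
        \<gamma>(2) \<delta>(2) m[OF subsetD[OF F(2) v]] v by (simp del: mult_product_group)
    moreover have "\<gamma> \<otimes>\<^bsub>P\<^esub> \<delta> \<in> \<Gamma>" using subgroup.m_closed[OF subgroup \<gamma>(1) \<delta>(1)] .
    ultimately show ?thesis by blast
  qed
  then have "?m \<in> proj_closure T \<Gamma> i" using mA unfolding proj_closure_iff[OF i] by blast
  then show "\<exists>k\<in>proj_closure T \<Gamma> i. \<forall>v\<in>verts (T i). k v = g (h v)" using m by blast
qed (rule two_trans[OF i])

lemma dense_action:
  assumes i: "i \<in> I" shows "dense_action (T i) (proj_closure T \<Gamma> i) ((\<lambda>\<gamma>. \<gamma> i) ` \<Gamma>)"
proof (intro dense_action.intro dense_action_axioms.intro boundary_transitive[OF i])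
  show "\<exists>e\<in>(\<lambda>\<gamma>. \<gamma> i) ` \<Gamma>. \<forall>v\<in>verts (T i). e v = v"
    using subgroup.one_closed[OF subgroup] one_apply[OF i] by blast
  fix g h assume "g \<in> (\<lambda>\<gamma>. \<gamma> i) ` \<Gamma>"
  then obtain \<gamma> where \<gamma>: "\<gamma> \<in> \<Gamma>" "g = \<gamma> i" by blast
  show "g \<in> aut_plus (T i)" using \<Gamma>_aut[OF \<gamma>(1) i] \<gamma>(2) by simp
  have "(inv\<^bsub>P\<^esub> \<gamma>) i (g v) = v \<and> g ((inv\<^bsub>P\<^esub> \<gamma>) i v) = v" if "v \<in> verts (T i)" for v
    unfolding \<gamma>(2) using inv_apply[OF subsetD[OF \<Gamma>_A \<gamma>(1)] i that] by (rule conjI)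
  then show "\<exists>k\<in>(\<lambda>\<gamma>. \<gamma> i) ` \<Gamma>. \<forall>v\<in>verts (T i). k (g v) = v \<and> g (k v) = v"
    using subgroup.m_inv_closed[OF subgroup \<gamma>(1)] by blast
  assume "h \<in> (\<lambda>\<gamma>. \<gamma> i) ` \<Gamma>"
  then obtain \<delta> where \<delta>: "\<delta> \<in> \<Gamma>" "h = \<delta> i" by blast
  have "(\<gamma> \<otimes>\<^bsub>P\<^esub> \<delta>) i v = g (h v)" if "v \<in> verts (T i)" for v
    unfolding \<gamma>(2) \<delta>(2) using mult_apply[OF subsetD[OF \<Gamma>_A \<gamma>(1)] subsetD[OF \<Gamma>_A \<delta>(1)] i that] .
  then show "\<exists>k\<in>(\<lambda>\<gamma>. \<gamma> i) ` \<Gamma>. \<forall>v\<in>verts (T i). k v = g (h v)"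
    using subgroup.m_closed[OF subgroup \<gamma>(1) \<delta>(1)] by blast
next
  fix g F assume "g \<in> proj_closure T \<Gamma> i" "finite F" "F \<subseteq> verts (T i)"
  then show "\<exists>h\<in>(\<lambda>\<gamma>. \<gamma> i) ` \<Gamma>. \<forall>v\<in>F. h v = g v"
    unfolding proj_closure_iff[OF i] by blast
qed

text \<open>Discreteness yields finite sets \<open>F i\<close> such that the values there determine
  an element of \<Gamma>. If r goes to x, preservation of distances confines these values to finite
  balls around the \<open>x i\<close>.\<close>

lemma finite_carrying:
  assumes x: "x \<in> X" and r: "r \<in> X"
  shows "finite {\<gamma> \<in> \<Gamma>. act \<gamma> r = x}"
proof -
  have "openin (subtopology (prod_aut_topology I T) \<Gamma>) {\<one>\<^bsub>P\<^esub>}"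
    using lattice subgroup.one_closed[OF subgroup] unfolding cocompact_lattice_def
    by (simp del: one_product_group)
  then obtain U where U: "openin (prod_aut_topology I T) U" "{\<one>\<^bsub>P\<^esub>} = U \<inter> \<Gamma>"
    unfolding openin_subtopology by (elim exE conjE)
  have "\<one>\<^bsub>P\<^esub> \<in> U" using U(2) by blast
  from open_prod_contains_cylinder[OF U(1) this]
  obtain F where F: "\<forall>i\<in>I. finite (F i) \<and> F i \<subseteq> verts (T i)"
    "\<forall>h\<in>A. (\<forall>i\<in>I. \<forall>v\<in>F i. h i v = \<one>\<^bsub>P\<^esub> i v) \<longrightarrow> h \<in> U"
    by (elim exE conjE)
  define \<rho> where "\<rho> = (\<lambda>\<gamma> :: nat \<Rightarrow> 'v \<Rightarrow> 'v. \<lambda>i\<in>I. \<lambda>v\<in>F i. \<gamma> i v)"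
  have "inj_on \<rho> \<Gamma>"
  proof (rule inj_onI)
    fix \<gamma> \<delta> assume \<gamma>: "\<gamma> \<in> \<Gamma>" and \<delta>: "\<delta> \<in> \<Gamma>" and eq: "\<rho> \<gamma> = \<rho> \<delta>"
    note A = subsetD[OF \<Gamma>_A \<gamma>] subsetD[OF \<Gamma>_A \<delta>]
    have "(inv\<^bsub>P\<^esub> \<gamma> \<otimes>\<^bsub>P\<^esub> \<delta>) i v = \<one>\<^bsub>P\<^esub> i v" if iv: "i \<in> I" "v \<in> F i" for i v
    proof -
      have v: "v \<in> verts (T i)" using F(1) iv by blast
      have "\<rho> \<gamma> i v = \<rho> \<delta> i v" using eq by simp
      then have "\<gamma> i v = \<delta> i v" using iv by (simp add: \<rho>_def)
      then show ?thesis
        using mult_apply[OF inv_A[OF A(1)] A(2) iv(1) v] inv_apply(1)[OF A(1) iv(1) v] one_apply[OF iv(1) v]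
        by simp
    qed
    moreover have m: "inv\<^bsub>P\<^esub> \<gamma> \<otimes>\<^bsub>P\<^esub> \<delta> \<in> \<Gamma>"
      using subgroup.m_closed[OF subgroup subgroup.m_inv_closed[OF subgroup \<gamma>] \<delta>] .
    ultimately have "inv\<^bsub>P\<^esub> \<gamma> \<otimes>\<^bsub>P\<^esub> \<delta> \<in> U" using F(2) \<Gamma>_A by blast
    then have e: "inv\<^bsub>P\<^esub> \<gamma> \<otimes>\<^bsub>P\<^esub> \<delta> = \<one>\<^bsub>P\<^esub>" using m U(2) by blast
    have c: "\<gamma> \<in> carrier P" "\<delta> \<in> carrier P" using A by (simp_all only: carrier_P)
    have "\<gamma> = \<gamma> \<otimes>\<^bsub>P\<^esub> (inv\<^bsub>P\<^esub> \<gamma> \<otimes>\<^bsub>P\<^esub> \<delta>)" unfolding e using monoid.r_one[OF group.is_monoid[OF group_P] c(1)] ..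
    also have "\<dots> = \<delta>" by (rule group.inv_solve_left[OF group_P, THEN iffD1, symmetric])
      (use c group.inv_closed[OF group_P] monoid.m_closed[OF group.is_monoid[OF group_P]] in blast)+
    finally show "\<gamma> = \<delta>" .
  qed
  then have inj: "inj_on \<rho> {\<gamma> \<in> \<Gamma>. act \<gamma> r = x}" by (rule inj_on_subset) blast
  have "\<rho> ` {\<gamma> \<in> \<Gamma>. act \<gamma> r = x} \<subseteq>
    (\<Pi>\<^sub>E i\<in>I. \<Pi>\<^sub>E v\<in>F i. {w \<in> verts (T i). graph_dist (T i) (x i) w \<le> graph_dist (T i) (r i) v})"
  proof
    fix f assume "f \<in> \<rho> ` {\<gamma> \<in> \<Gamma>. act \<gamma> r = x}"
    then obtain \<gamma> where \<gamma>: "\<gamma> \<in> \<Gamma>" "act \<gamma> r = x" "f = \<rho> \<gamma>" by blast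
    have "\<gamma> i v \<in> {w \<in> verts (T i). graph_dist (T i) (x i) w \<le> graph_dist (T i) (r i) v}"
      if iv: "i \<in> I" "v \<in> F i" for i v
    proof -
      interpret biregular "T i" by (rule biregular[OF iv(1)])
      have v: "v \<in> verts (T i)" "r i \<in> verts (T i)" using F(1) iv r by auto
      have "x i = \<gamma> i (r i)" using \<gamma>(2) iv(1) by auto
      then show ?thesis using aut_dist[OF \<Gamma>_aut[OF \<gamma>(1) iv(1)] v(2,1)] aut_verts[OF \<Gamma>_aut[OF \<gamma>(1) iv(1)] v(1)] by simp
    qed
    then show "f \<in> (\<Pi>\<^sub>E i\<in>I. \<Pi>\<^sub>E v\<in>F i. {w \<in> verts (T i). graph_dist (T i) (x i) w \<le> graph_dist (T i) (r i) v})"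
      unfolding \<gamma>(3) \<rho>_def by (intro restrict_PiE_iff[THEN iffD2] ballI)
  qed
  moreover have "finite (\<Pi>\<^sub>E i\<in>I. \<Pi>\<^sub>E v\<in>F i. {w \<in> verts (T i). graph_dist (T i) (x i) w \<le> graph_dist (T i) (r i) v})"
    using F(1) x biregular.finite_ball[OF biregular] by (intro finite_PiE finite_I) (auto simp: PiE_iff)
  ultimately have "finite (\<rho> ` {\<gamma> \<in> \<Gamma>. act \<gamma> r = x})" by (rule finite_subset)
  then show ?thesis using inj by (rule finite_imageD)
qed

lemma openin_moving:
  assumes "x \<in> X"
  shows "openin (prod_aut_topology I T) {a \<in> A. act a x = z}"
proof (cases "z \<in> extensional I")
  case True
  have "{a \<in> A. act a x = z} = (\<Pi>\<^sub>E i\<in>I. {g \<in> aut_plus (T i). \<forall>v\<in>{x i}. g v = z i})"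
    using True by (auto simp: PiE_iff fun_eq_iff extensional_def restrict_def)
  moreover have "openin (prod_aut_topology I T) (\<Pi>\<^sub>E i\<in>I. {g \<in> aut_plus (T i). \<forall>v\<in>{x i}. g v = z i})"
    unfolding openin_PiE[OF finite_I]
    using assms by (intro disjI2 ballI openin_cylinder[where f = "\<lambda>_. _"]) (auto simp: PiE_iff)
  ultimately show ?thesis by simp
next
  case False
  then have "{a \<in> A. act a x = z} = {}" by auto
  then show ?thesis by (simp only: openin_empty)
qed

text \<open>\<open>W y\<close> consists of the elements that carry some point of the \<Gamma>-orbit
  of y to z. It is open and invariant under right multiplication by \<Gamma>, so its image in the
  coset space is open; compactness leaves finitely many y whose images cover.\<close>

lemma finite_cover_of_orbit:
  assumes z: "z \<in> X"
  shows "\<exists>Y. finite Y \<and> Y \<subseteq> X \<and> (\<forall>p\<in>X. \<forall>a\<in>A. act a p = z \<longrightarrow> (\<exists>\<gamma>\<in>\<Gamma>. p \<in> act \<gamma> ` Y))"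
proof -
  let ?c = "\<lambda>a. a <#\<^bsub>P\<^esub> \<Gamma>" and ?Q = "coset_space P (prod_aut_topology I T) \<Gamma>"
  define W where "W = (\<lambda>y. {a \<in> A. \<exists>\<gamma>\<in>\<Gamma>. act a (act \<gamma> y) = z})"
  have top: "topspace (prod_aut_topology I T) = A" by simp
  have q: "quotient_map (prod_aut_topology I T) ?Q ?c"
    by (rule quotient_map_coset_space) simp
  have Q: "topspace ?Q = ?c ` A"
    using quotient_imp_surjective_map[OF q] by (simp only: top)
  have W_inv: "a \<in> W y" if a: "a \<in> A" and ac: "?c a \<in> ?c ` W y" and y: "y \<in> X" for a y
  proof -
    obtain b where b: "b \<in> W y" "?c a = ?c b" using ac by (elim imageE)
    have "a \<in> ?c a" using group.lcos_self[OF group_P _ subgroup] a by (simp only: carrier_P)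
    then have "a \<in> ?c b" by (simp only: b(2))
    then have "\<exists>\<delta>\<in>\<Gamma>. a = b \<otimes>\<^bsub>P\<^esub> \<delta>" by (simp only: l_coset_def UN_iff singleton_iff)
    then obtain \<delta> where \<delta>: "\<delta> \<in> \<Gamma>" "a = b \<otimes>\<^bsub>P\<^esub> \<delta>" by (elim bexE)
    from b(1) have bA: "b \<in> A" and "\<exists>\<gamma>\<in>\<Gamma>. act b (act \<gamma> y) = z" by (simp_all only: W_def mem_Collect_eq)
    then obtain \<gamma> where \<gamma>: "\<gamma> \<in> \<Gamma>" "act b (act \<gamma> y) = z" by (elim bexE)
    let ?\<epsilon> = "inv\<^bsub>P\<^esub> \<delta> \<otimes>\<^bsub>P\<^esub> \<gamma>"
    note A = subsetD[OF \<Gamma>_A \<gamma>(1)] subsetD[OF \<Gamma>_A \<delta>(1)]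
    have \<epsilon>: "?\<epsilon> \<in> \<Gamma>" using subgroup.m_closed[OF subgroup subgroup.m_inv_closed[OF subgroup \<delta>(1)] \<gamma>(1)] .
    have "act a (act ?\<epsilon> y) = act b (act \<delta> (act (inv\<^bsub>P\<^esub> \<delta>) (act \<gamma> y)))"
      unfolding \<delta>(2) act_mult[OF inv_A[OF A(2)] A(1) y]
      by (rule act_mult[OF bA A(2) act_X[OF inv_A[OF A(2)] act_X[OF A(1) y]]])
    also have "\<dots> = z" unfolding act_inv(2)[OF A(2) act_X[OF A(1) y]] by (rule \<gamma>(2))
    finally have "\<exists>\<gamma>\<in>\<Gamma>. act a (act \<gamma> y) = z" using \<epsilon> by (rule bexI)
    then show ?thesis using a by (simp only: W_def mem_Collect_eq)
  qed
  have W_open: "openin (prod_aut_topology I T) (W y)" if y: "y \<in> X" for y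
  proof -
    have eq: "W y = \<Union>((\<lambda>\<gamma>. {a \<in> A. act a (act \<gamma> y) = z}) ` \<Gamma>)" unfolding W_def by blast
    show ?thesis unfolding eq
      by (rule openin_Union) (elim imageE, simp only: openin_moving[OF act_X[OF subsetD[OF \<Gamma>_A] y]])
  qed
  have U_open: "openin ?Q (?c ` W y)" if y: "y \<in> X" for y
  proof -
    have sub: "?c ` W y \<subseteq> topspace ?Q" unfolding Q W_def by (rule image_mono) (rule Collect_restrict)
    have pre: "{a \<in> topspace (prod_aut_topology I T). ?c a \<in> ?c ` W y} = W y"
    proof
      show "{a \<in> topspace (prod_aut_topology I T). ?c a \<in> ?c ` W y} \<subseteq> W y"
        unfolding top by (rule subsetI) (elim CollectE conjE, rule W_inv[OF _ _ y])
      show "W y \<subseteq> {a \<in> topspace (prod_aut_topology I T). ?c a \<in> ?c ` W y}"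
        unfolding top by (rule subsetI, rule CollectI, rule conjI) (simp only: W_def mem_Collect_eq, rule imageI)
    qed
    have "openin (prod_aut_topology I T) {a \<in> topspace (prod_aut_topology I T). ?c a \<in> ?c ` W y} =
        openin ?Q (?c ` W y)"
      using conjunct2[OF q[unfolded quotient_map_def]] sub by (elim allE impE) assumption+
    then show ?thesis unfolding pre using W_open[OF y] by (rule iffD1)
  qed
  have cover: "topspace ?Q \<subseteq> \<Union>((\<lambda>y. ?c ` W y) ` X)"
  proof
    fix k assume "k \<in> topspace ?Q"
    then obtain a where a: "a \<in> A" "k = ?c a" unfolding Q by (elim imageE)
    let ?y = "act (inv\<^bsub>P\<^esub> a) z"
    have y: "?y \<in> X" by (rule act_X[OF inv_A[OF a(1)] z])
    have "act a (act \<one>\<^bsub>P\<^esub> ?y) = z" unfolding act_one[OF y] by (rule act_inv(2)[OF a(1) z])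
    then have "\<exists>\<gamma>\<in>\<Gamma>. act a (act \<gamma> ?y) = z" using subgroup.one_closed[OF subgroup] by (rule bexI)
    then have "a \<in> W ?y" using a(1) by (simp only: W_def mem_Collect_eq)
    then show "k \<in> \<Union>((\<lambda>y. ?c ` W y) ` X)" unfolding a(2) by (intro UN_I[OF y] imageI)
  qed
  have "compactin ?Q (topspace ?Q)"
    using lattice by (simp only: cocompact_lattice_def compact_space_def)
  then have "\<exists>\<F>. finite \<F> \<and> \<F> \<subseteq> (\<lambda>y. ?c ` W y) ` X \<and> topspace ?Q \<subseteq> \<Union>\<F>"
    by (rule compactinD[OF _ _ cover]) (use U_open in \<open>elim imageE, simp only:\<close>)
  then obtain \<F> where \<F>: "finite \<F>" "\<F> \<subseteq> (\<lambda>y. ?c ` W y) ` X" "topspace ?Q \<subseteq> \<Union>\<F>" by (elim exE conjE)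
  from finite_subset_image[OF \<F>(1,2)] obtain Y where Y: "Y \<subseteq> X" "finite Y" "\<F> = (\<lambda>y. ?c ` W y) ` Y"
    by (elim exE conjE)
  have "\<exists>\<gamma>\<in>\<Gamma>. p \<in> act \<gamma> ` Y" if p: "p \<in> X" "a \<in> A" "act a p = z" for p a
  proof -
    have "?c a \<in> topspace ?Q" unfolding Q using p(2) by (rule imageI)
    then have "?c a \<in> (\<Union>y\<in>Y. ?c ` W y)" using \<F>(3) unfolding Y(3) by (rule rev_subsetD)
    then obtain y where y: "y \<in> Y" "?c a \<in> ?c ` W y" by (elim UN_E)
    have yX: "y \<in> X" using y(1) Y(1) by blast
    have "a \<in> W y" by (rule W_inv[OF p(2) y(2) yX])
    then have "\<exists>\<gamma>\<in>\<Gamma>. act a (act \<gamma> y) = z" by (simp only: W_def mem_Collect_eq)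
    then obtain \<gamma> where \<gamma>: "\<gamma> \<in> \<Gamma>" "act a (act \<gamma> y) = z" by (elim bexE)
    have "act \<gamma> y = act (inv\<^bsub>P\<^esub> a) (act a (act \<gamma> y))"
      by (rule act_inv(1)[OF p(2) act_X[OF subsetD[OF \<Gamma>_A \<gamma>(1)] yX], symmetric])
    also have "\<dots> = p" unfolding \<gamma>(2) p(3)[symmetric] by (rule act_inv(1)[OF p(2,1)])
    finally have "p = act \<gamma> y" by (rule sym)
    then have "p \<in> act \<gamma> ` Y" using y(1) by (rule image_eqI)
    then show ?thesis using \<gamma>(1) by (rule bexI)
  qed
  then show ?thesis using Y(1,2) by (intro exI[of _ Y] conjI ballI impI)
qed

text \<open>By \<open>finite_vertex_orbits\<close> in each factor, some product of automorphisms
  moves a given point into the finite product of the sets \<open>Z i\<close>. So R can be the union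
  of the finite sets that \<open>finite_cover_of_orbit\<close> provides for these finitely many
  z.\<close>

lemma finite_fundamental_set:
  "\<exists>R. finite R \<and> R \<subseteq> X \<and> (\<forall>p\<in>X. \<exists>\<gamma>\<in>\<Gamma>. p \<in> act \<gamma> ` R)"
proof -
  have "\<forall>i\<in>I. \<exists>Z. finite Z \<and> Z \<subseteq> verts (T i) \<and> (\<forall>v\<in>verts (T i). \<exists>g\<in>proj_closure T \<Gamma> i. g v \<in> Z)"
    by (intro ballI boundary_transitive.finite_vertex_orbits[OF boundary_transitive])
  from bchoice[OF this] obtain Z where Z: "\<forall>i\<in>I. finite (Z i) \<and> Z i \<subseteq> verts (T i) \<and>
      (\<forall>v\<in>verts (T i). \<exists>g\<in>proj_closure T \<Gamma> i. g v \<in> Z i)" by (elim exE)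
  have ZX: "z \<in> X" if "z \<in> (\<Pi>\<^sub>E i\<in>I. Z i)" for z using that Z by (auto simp: PiE_iff)
  have finZ: "finite (\<Pi>\<^sub>E i\<in>I. Z i)" using Z by (intro finite_PiE finite_I) blast
  have "\<forall>z\<in>\<Pi>\<^sub>E i\<in>I. Z i. \<exists>Y. finite Y \<and> Y \<subseteq> X \<and> (\<forall>p\<in>X. \<forall>a\<in>A. act a p = z \<longrightarrow> (\<exists>\<gamma>\<in>\<Gamma>. p \<in> act \<gamma> ` Y))"
    by (intro ballI finite_cover_of_orbit[OF ZX])
  from bchoice[OF this] obtain Y where Y: "\<forall>z\<in>\<Pi>\<^sub>E i\<in>I. Z i. finite (Y z) \<and> Y z \<subseteq> X \<and>
      (\<forall>p\<in>X. \<forall>a\<in>A. act a p = z \<longrightarrow> (\<exists>\<gamma>\<in>\<Gamma>. p \<in> act \<gamma> ` Y z))" by (elim exE)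
  have "\<exists>\<gamma>\<in>\<Gamma>. p \<in> act \<gamma> ` (\<Union>z\<in>\<Pi>\<^sub>E i\<in>I. Z i. Y z)" if p: "p \<in> X" for p
  proof -
    have "\<forall>i\<in>I. \<exists>g. g \<in> aut_plus (T i) \<and> g (p i) \<in> Z i"
    proof
      fix i assume i: "i \<in> I"
      have "p i \<in> verts (T i)" using p i by auto
      then obtain g where "g \<in> proj_closure T \<Gamma> i" "g (p i) \<in> Z i" using Z i by blast
      then show "\<exists>g. g \<in> aut_plus (T i) \<and> g (p i) \<in> Z i" unfolding proj_closure_iff[OF i] by blast
    qed
    from bchoice[OF this] obtain g where g: "\<forall>i\<in>I. g i \<in> aut_plus (T i) \<and> g i (p i) \<in> Z i" by (elim exE)
    define a where "a = restrict g I"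
    have a: "a \<in> A" using g by (auto simp: a_def)
    have z: "act a p \<in> (\<Pi>\<^sub>E i\<in>I. Z i)" using g by (auto simp: a_def)
    have "\<exists>\<gamma>\<in>\<Gamma>. p \<in> act \<gamma> ` Y (act a p)" using Y z p a by blast
    then show ?thesis using z by blast
  qed
  moreover have "finite (\<Union>z\<in>\<Pi>\<^sub>E i\<in>I. Z i. Y z)" using finZ Y by blast
  moreover have "(\<Union>z\<in>\<Pi>\<^sub>E i\<in>I. Z i. Y z) \<subseteq> X" using Y by blast
  ultimately show ?thesis by (intro exI[of _ "\<Union>z\<in>\<Pi>\<^sub>E i\<in>I. Z i. Y z"]) blast
qed

end

section \<open>The Cartesian product of the trees as one graph\<close>

context product_of_trees
begin

text \<open>One coordinate moves at a time, so the Laplacian of this graph is the sum of the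
  coordinate Laplacians, which is the form of harmonicity in \<open>rigidity\<close>.\<close>

definition product_edges :: "(('i \<Rightarrow> 'v) \<times> ('i \<Rightarrow> 'v)) set" where
  "product_edges = {(x, x(j := a)) | x j a. x \<in> X \<and> j \<in> I \<and> (x j, a) \<in> adj (T j)}"

lemma product_edgesI: "x \<in> X \<Longrightarrow> j \<in> I \<Longrightarrow> (x j, a) \<in> adj (T j) \<Longrightarrow> (x, x(j := a)) \<in> product_edges"
  unfolding product_edges_def by (intro CollectI exI conjI) (rule refl)

lemma product_edgesE:
  assumes "(x, y) \<in> product_edges"
  obtains j a where "x \<in> X" "j \<in> I" "(x j, a) \<in> adj (T j)" "y = x(j := a)"
  using assms unfolding product_edges_def by (elim CollectE exE conjE Pair_inject) (simp only:)

lemma product_edges_Image: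
  "x \<in> X \<Longrightarrow> product_edges `` {x} = (\<Union>j\<in>I. (\<lambda>a. x(j := a)) ` (adj (T j) `` {x j}))"
  by (auto simp: product_edges_def)

lemma nbr_neq: "j \<in> I \<Longrightarrow> (a, b) \<in> adj (T j) \<Longrightarrow> a \<noteq> b"
  using biregular.adj_colour[OF boundary_transitive.axioms(1)[OF dense_action.axioms(1)[OF dense]]] by metis

text \<open>Trees have no loops, so moves in different coordinates lead to different vertices and
  the neighbour set splits disjointly.\<close>

lemma sum_product_edges:
  fixes f :: "('i \<Rightarrow> 'v) \<Rightarrow> 'w :: comm_monoid_add"
  assumes x: "x \<in> X"
  shows "(\<Sum>y\<in>product_edges `` {x}. f y) = (\<Sum>j\<in>I. \<Sum>a\<in>adj (T j) `` {x j}. f (x(j := a)))"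
proof -
  have fin: "finite (adj (T j) `` {x j})" if "j \<in> I" for j using E_finite[OF that X_nth[OF x that]] .
  have disj: "(\<lambda>a. x(j := a)) ` (adj (T j) `` {x j}) \<inter> (\<lambda>a. x(k := a)) ` (adj (T k) `` {x k}) = {}"
    if jk: "j \<in> I" "k \<in> I" "j \<noteq> k" for j k
  proof -
    have "x(j := a) \<noteq> x(k := b)" if "(x j, a) \<in> adj (T j)" for a b
      using nbr_neq[OF jk(1) that] jk(3) by (metis fun_upd_apply)
    then show ?thesis by blast
  qed
  have "(\<Sum>y\<in>product_edges `` {x}. f y) = (\<Sum>j\<in>I. \<Sum>y\<in>(\<lambda>a. x(j := a)) ` (adj (T j) `` {x j}). f y)"
    unfolding product_edges_Image[OF x] using fin disj by (intro sum.UNION_disjoint finite_I) auto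
  also have "\<dots> = (\<Sum>j\<in>I. \<Sum>a\<in>adj (T j) `` {x j}. f (x(j := a)))"
  proof (rule sum.cong[OF refl])
    fix j
    have "inj_on (\<lambda>a. x(j := a)) (adj (T j) `` {x j})" by (auto simp: inj_on_def dest: fun_upd_eqD)
    then show "(\<Sum>y\<in>(\<lambda>a. x(j := a)) ` (adj (T j) `` {x j}). f y) = (\<Sum>a\<in>adj (T j) `` {x j}. f (x(j := a)))"
      by (rule sum.reindex_cong) (rule refl)+
  qed
  finally show ?thesis .
qed

lemma product_edge_path:
  assumes x: "x \<in> X" and j: "j \<in> I" and b: "(x j, b) \<in> (adj (T j))\<^sup>*"
  shows "(x, x(j := b)) \<in> product_edges\<^sup>*"
  using b
proof (induction rule: rtrancl_induct)
  case base
  then show ?case by simp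
next
  case (step a b)
  have "a \<in> verts (T j)" using E_verts[OF j] step.hyps(2) by blast
  then have "x(j := a) \<in> X" by (rule X_upd[OF x j])
  then have "(x(j := a), (x(j := a))(j := b)) \<in> product_edges"
    using j step.hyps(2) by (intro product_edgesI) (simp_all only: fun_upd_same)
  with step.IH show ?case unfolding fun_upd_upd by (rule rtrancl.rtrancl_into_rtrancl)
qed

lemma product_edges_connected:
  assumes x: "x \<in> X" and y: "y \<in> X"
  shows "(x, y) \<in> product_edges\<^sup>*"
proof -
  have "(x, \<lambda>i. if i \<in> J then y i else x i) \<in> product_edges\<^sup>*" if "finite J" "J \<subseteq> I" for J
    using that
  proof (induction J)
    case empty
    then show ?case by simp
  next
    case (insert j J)
    let ?z = "\<lambda>i. if i \<in> J then y i else x i"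
    have j: "j \<in> I" and IH: "(x, ?z) \<in> product_edges\<^sup>*" using insert by auto
    have z: "?z \<in> X" using x y insert.prems by (auto simp: PiE_iff extensional_def)
    have "(?z j, y j) \<in> (adj (T j))\<^sup>*" by (rule E_connected[OF j X_nth[OF z j] X_nth[OF y j]])
    from rtrancl_trans[OF IH product_edge_path[OF z j this]]
    have "(x, ?z(j := y j)) \<in> product_edges\<^sup>*" .
    moreover have "?z(j := y j) = (\<lambda>i. if i \<in> insert j J then y i else x i)" by (auto simp: fun_eq_iff)
    ultimately show ?case by (simp only:)
  qed
  from this[OF finite_I subset_refl] have "(x, \<lambda>i. if i \<in> I then y i else x i) \<in> product_edges\<^sup>*" .
  moreover have "(\<lambda>i. if i \<in> I then y i else x i) = y"
    using PiE_arb[OF x] PiE_arb[OF y] by (auto simp: fun_eq_iff)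
  ultimately show ?thesis by simp
qed

lemma product_graph_action: "graph_action \<Gamma> X act R product_edges"
proof (intro graph_action.intro graph_action_axioms.intro)
  show "cocompact_action \<Gamma> X act R" by (rule cocompact_action_axioms)
  show "product_edges \<subseteq> X \<times> X"
    by (rule subrelI, elim product_edgesE) (simp only: X_upd E_in mem_Sigma_iff simp_thms)
  show "X \<noteq> {}"
  proof -
    have "verts (T i) \<noteq> {}" if "i \<in> I" for i
      using biregular.verts_nonempty[OF boundary_transitive.axioms(1)[OF dense_action.axioms(1)[OF dense[OF that]]]] .
    then show ?thesis by (simp add: PiE_eq_empty_iff)
  qed
  show "(y, x) \<in> product_edges" if e: "(x, y) \<in> product_edges" for x y
  proof -
    obtain j a where xy: "x \<in> X" "j \<in> I" "(x j, a) \<in> adj (T j)" "y = x(j := a)"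
      using e by (rule product_edgesE)
    have y: "y \<in> X" unfolding xy(4) by (rule X_upd[OF xy(1,2) E_in[OF xy(2,3)]])
    have "(y j, x j) \<in> adj (T j)" using E_sym[OF xy(2,3)] xy(4) by simp
    moreover have "x = y(j := x j)" unfolding xy(4) by simp
    ultimately show ?thesis using product_edgesI[OF y xy(2)] by metis
  qed
  show "finite (product_edges `` {x})" if "x \<in> X" for x
    unfolding product_edges_Image[OF that] by (intro finite_UN_I finite_I finite_imageI E_finite X_nth[OF that])
  show "(act g x, act g y) \<in> product_edges" if g: "g \<in> carrier \<Gamma>" and xy: "(x, y) \<in> product_edges" for g x y
  proof -
    obtain j a where xy: "x \<in> X" "j \<in> I" "(x j, a) \<in> adj (T j)" "y = x(j := a)"
      using xy by (rule product_edgesE)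
    have "\<alpha> g j a \<in> adj (T j) `` {\<alpha> g j (x j)}"
      unfolding \<alpha>_nbrs[OF g xy(2) X_nth[OF xy(1,2)]] by (rule imageI) (simp only: Image_singleton_iff xy(3))
    then have "(act g x j, \<alpha> g j a) \<in> adj (T j)" by (simp only: Image_singleton_iff restrict_apply' xy(2))
    then show ?thesis
      unfolding xy(4) act_upd[OF xy(2)] by (rule product_edgesI[OF act_closed[OF g xy(1)] xy(2)])
  qed
  show "(x, y) \<in> product_edges\<^sup>*" if "x \<in> X" "y \<in> X" for x y
    by (rule product_edges_connected[OF that])
qed

theorem finite_unitary_rep_types_product: "finite (unitary_rep_types \<Gamma> d)"
proof (rule graph_action.finite_unitary_rep_types[OF product_graph_action])
  fix h :: "('i \<Rightarrow> 'v) \<Rightarrow> (nat \<times> nat) \<Rightarrow>\<^sub>0 complex" and x y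
  assume fin: "\<And>x. x \<in> X \<Longrightarrow> keys (h x) \<subseteq> sq d"
    and gram: "\<And>g x y x' y'. g \<in> carrier \<Gamma> \<Longrightarrow> x \<in> X \<Longrightarrow> y \<in> X \<Longrightarrow> x' \<in> X \<Longrightarrow> y' \<in> X \<Longrightarrow>
        inner (h (act g x) - h (act g y)) (h (act g x') - h (act g y')) = inner (h x - h y) (h x' - h y')"
    and lap: "\<And>x. x \<in> X \<Longrightarrow> graph_action.lap product_edges h x = 0" and xy: "x \<in> X" "y \<in> X"
  have "finite (sq d)" by simp
  from finite_dim_poly_mapping[OF this] obtain B :: "((nat \<times> nat) \<Rightarrow>\<^sub>0 complex) set"
    where B: "finite B" "{f. keys f \<subseteq> sq d} \<subseteq> span B" by (elim exE conjE)
  have hB: "h ` X \<subseteq> span B" using fin B(2) by blast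
  have harm: "(\<Sum>j\<in>I. \<Sum>a\<in>adj (T j) `` {x j}. h (x(j := a)) - h x) = 0" if "x \<in> X" for x
    using lap[OF that] unfolding graph_action.lap_def[OF product_graph_action] sum_product_edges[OF that] .
  show "h x = h y" by (rule rigidity[OF gram harm B(1) hB xy(2,1)])
qed

end

section \<open>Finiteness of isomorphism types for lattices in products of trees\<close>

context tree_lattice
begin

text \<open>Properness comes from discreteness through \<open>finite_carrying\<close>, cocompactness
  from the choice of R, and the density of each projection from \<open>dense_action\<close>.\<close>

lemma product_of_trees_lattice:
  assumes R: "finite R" "R \<subseteq> X" "\<forall>p\<in>X. \<exists>\<gamma>\<in>\<Gamma>. p \<in> act \<gamma> ` R"
  shows "product_of_trees (P\<lparr>carrier := \<Gamma>\<rparr>) I T (\<lambda>\<gamma>. \<gamma>) R (proj_closure T \<Gamma>)"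
proof (intro product_of_trees.intro product_of_trees_axioms.intro product_action.intro
    product_action_axioms.intro cocompact_action.intro)
  show "group (P\<lparr>carrier := \<Gamma>\<rparr>)" by (rule subgroup.subgroup_is_group[OF subgroup group_P])
  show "act g x \<in> X" if "g \<in> carrier (P\<lparr>carrier := \<Gamma>\<rparr>)" "x \<in> X" for g x
    using act_X[OF subsetD[OF \<Gamma>_A] that(2)] that(1) by simp
  show "act \<one>\<^bsub>P\<lparr>carrier := \<Gamma>\<rparr>\<^esub> x = x" if "x \<in> X" for x
    using act_one[OF that] by simp
  show "act (g \<otimes>\<^bsub>P\<lparr>carrier := \<Gamma>\<rparr>\<^esub> h) x = act g (act h x)"
    if "g \<in> carrier (P\<lparr>carrier := \<Gamma>\<rparr>)" "h \<in> carrier (P\<lparr>carrier := \<Gamma>\<rparr>)" "x \<in> X" for g h x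
    using act_mult[OF subsetD[OF \<Gamma>_A] subsetD[OF \<Gamma>_A] that(3)] that(1,2) by simp
  show "finite R" "R \<subseteq> X" by (rule R)+
  show "finite {g \<in> carrier (P\<lparr>carrier := \<Gamma>\<rparr>). x \<in> act g ` R}" if x: "x \<in> X" for x
  proof -
    have "{g \<in> carrier (P\<lparr>carrier := \<Gamma>\<rparr>). x \<in> act g ` R} = (\<Union>r\<in>R. {\<gamma> \<in> \<Gamma>. act \<gamma> r = x})" by auto
    moreover have "finite (\<Union>r\<in>R. {\<gamma> \<in> \<Gamma>. act \<gamma> r = x})"
      using R(1,2) by (intro finite_UN_I finite_carrying[OF x]) blast+
    ultimately show ?thesis by (simp only:)
  qed
  show "\<exists>g\<in>carrier (P\<lparr>carrier := \<Gamma>\<rparr>). x \<in> act g ` R" if "x \<in> X" for x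
    using R(3) that by simp
  show "finite I" by (rule finite_I)
  fix i assume i: "i \<in> I"
  interpret b: biregular "T i" by (rule biregular[OF i])
  show "adj (T i) \<subseteq> verts (T i) \<times> verts (T i)" using b.adj_verts by (intro subrelI SigmaI)
  show "(b, a) \<in> adj (T i)" if "(a, b) \<in> adj (T i)" for a b by (rule b.adj_sym[OF that])
  show "finite (adj (T i) `` {a})" if "a \<in> verts (T i)" for a by (rule b.finite_nbrs[OF that])
  show "(a, b) \<in> (adj (T i))\<^sup>*" if "a \<in> verts (T i)" "b \<in> verts (T i)" for a b by (rule b.reachable[OF that])
  show "dense_action (T i) (proj_closure T \<Gamma> i) ((\<lambda>g. g i) ` carrier (P\<lparr>carrier := \<Gamma>\<rparr>))"
    using dense_action[OF i] by simp
  fix g assume "g \<in> carrier (P\<lparr>carrier := \<Gamma>\<rparr>)"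
  then have g: "g i \<in> aut_plus (T i)" using \<Gamma>_aut[OF _ i] by simp
  show "inj_on (g i) (verts (T i))" using b.aut_bij[OF g] by (rule bij_betw_imp_inj_on)
  show "g i a \<in> verts (T i)" if "a \<in> verts (T i)" for a by (rule b.aut_verts[OF g that])
  show "adj (T i) `` {g i a} = g i ` (adj (T i) `` {a})" if "a \<in> verts (T i)" for a
    by (rule b.aut_adj_iff[OF g that])
qed

theorem finite_unitary_rep_types_lattice: "finite (unitary_rep_types (P\<lparr>carrier := \<Gamma>\<rparr>) d)"
proof -
  obtain R where R: "finite R" "R \<subseteq> X" "\<forall>p\<in>X. \<exists>\<gamma>\<in>\<Gamma>. p \<in> act \<gamma> ` R"
    using finite_fundamental_set by (elim exE conjE)
  show ?thesis
    by (rule product_of_trees.finite_unitary_rep_types_product[OF product_of_trees_lattice[OF R]])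
qed

end

theorem proposition7p3:
  fixes n :: nat
    and T :: "nat \<Rightarrow> 'v coloured_graph"
    and \<Gamma> :: "(nat \<Rightarrow> 'v \<Rightarrow> 'v) set"
    and G :: "nat \<Rightarrow> ('v \<Rightarrow> 'v) set"
  assumes "n \<ge> 2"
    and "\<And>i. i \<in> {1..n} \<Longrightarrow> biregular_tree (T i)"
    and "cocompact_lattice (prod_AutPlus {1..n} T) (prod_aut_topology {1..n} T) \<Gamma>"
    and "\<And>i. i \<in> {1..n} \<Longrightarrow> G i = proj_closure T \<Gamma> i"
    and "\<And>i. i \<in> {1..n} \<Longrightarrow> two_transitive_on_boundary (T i) (G i)"
    and "dense_projections {1..n} T G \<Gamma>"
  shows "\<forall>d::nat. finite (unitary_rep_types ((prod_AutPlus {1..n} T)\<lparr>carrier := \<Gamma>\<rparr>) d)"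
proof -
  have "tree_lattice {1..n} T \<Gamma>"
    using assms(2-5) by (intro tree_lattice.intro) auto
  then show ?thesis by (intro allI tree_lattice.finite_unitary_rep_types_lattice)
qed

end
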